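(* Let $R=k[x_1,\dots,x_n]$ and let $J=(F_1,\dots,F_n)\subset R$ be a complete intersection of general forms with $\deg F_i=d_i$ for $1\le i\le n$. Assume $2<d_1\le\dots\le d_n$. Let $d=d_1+\dots+d_n$ and $c=d-n-1$. Choose general forms $F_{n+1},\dots,F_{n+p}$ all of degree $c$, with $1\le p\le n-2$, and let $I=(F_1,\dots,F_n,F_{n+1},\dots,F_{n+p})$. Then for every $j=p+1,\dots,n-1$, the minimal graded free resolution of $R/I$ has ghost terms $R(-c-j)$ between the $j$-th and the $(j+1)$-st free modules, and these do not arise from any Koszul syzygies (i.e. they are non-Koszul ghost terms).
   Context: $k$ is an infinite field and $R$ is standard graded. "General forms" of prescribed degrees means: the statement holds for all tuples of forms in a nonempty Zariski open subset of the product of the corresponding spaces $R_{\deg F_i}$. Write the minimal graded free resolution of $R/I$ as $0\to\mathbb F_n\to\dots\to\mathbb F_2\to\mathbb F_1\to R\to R/I\to 0$; $\mathbb F_i$ is called the $i$-th free module. A ghost term $R(-t)$ between the $i$-th and the $(i+1)$-st free modules means that $R(-t)$ occurs as a direct summand of both $\mathbb F_i$ and $\mathbb F_{i+1}$. Let $K_\bullet$ be the Koszul complex on the given generators of $I$, so $K_i=\bigoplus R(-(\deg F_{j_1}+\dots+\deg F_{j_i}))$ over $j_1<\dots<j_i$. A comparison map $K_\bullet\to\mathbb F_\bullet$ over the identity of $R/I$ induces a well-defined map $(K_i\otimes_R k)_t\to(\mathbb F_i\otimes_R k)_t=\mathrm{Tor}_i^R(R/I,k)_t$. The copies of $R(-t)$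 in $\mathbb F_i$ are called Koszul ($i$-th Koszul syzygies) if this map is surjective. A ghost term $R(-t)$ between the $i$-th and $(i+1)$-st free modules is said to arise from Koszul syzygies (to be Koszul) if the copies of $R(-t)$ in $\mathbb F_{i+1}$ are Koszul; otherwise it is non-Koszul. *)

theory Defs
  imports
    "HOL-Library.Cardinality"
    "HOL-Library.Poly_Mapping"
    "Jordan_Normal_Form.Matrix_Kernel"
begin

section \<open>The polynomial ring, forms and ideals\<close>

text \<open>The ring \<open>k[x\<^sub>1,\<dots>,x\<^sub>n]\<close> has its variables indexed by a finite type with \<open>n\<close> elements.\<close>

type_synonym 'n monom = "'n \<Rightarrow>\<^sub>0 nat"
type_synonym ('n, 'k) mpol = "'n monom \<Rightarrow>\<^sub>0 'k"

definition mdeg :: "'n::finite monom \<Rightarrow> nat" where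
  "mdeg m = (\<Sum>x\<in>UNIV. Poly_Mapping.lookup m x)"

text \<open>The graded piece \<open>R\<^sub>e\<close>, with an integer degree so that it vanishes for \<open>e < 0\<close>.\<close>

definition forms :: "int \<Rightarrow> ('n::finite, 'k::field) mpol set" where
  "forms e = {f. \<forall>m\<in>Poly_Mapping.keys f. int (mdeg m) = e}"

definition const_coeff :: "('n, 'k::zero) mpol \<Rightarrow> 'k" where
  "const_coeff f = Poly_Mapping.lookup f 0"

definition ideal_of :: "'a::comm_ring_1 set \<Rightarrow> 'a set" where
  "ideal_of S = Modules.module.span (*) S"

text \<open>A complete intersection is given by a regular sequence of generators.\<close>

definition complete_intersection :: "'a::comm_ring_1 list \<Rightarrow> bool" where
  "complete_intersection Fs \<longleftrightarrow>
     1 \<notin> ideal_of (set Fs) \<and>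
     (\<forall>i<length Fs. \<forall>g. Fs ! i * g \<in> ideal_of (set (take i Fs)) \<longrightarrow> g \<in> ideal_of (set (take i Fs)))"


section \<open>General forms\<close>

definition form_tuples :: "nat list \<Rightarrow> ('n::finite, 'k::field) mpol list set" where
  "form_tuples es = {Fs. length Fs = length es \<and> (\<forall>i<length es. Fs ! i \<in> forms (int (es ! i)))}"

definition poly_value :: "('v \<Rightarrow> 'k::comm_semiring_1) \<Rightarrow> (('v \<Rightarrow>\<^sub>0 nat) \<Rightarrow>\<^sub>0 'k) \<Rightarrow> 'k" where
  "poly_value a q =
     (\<Sum>m\<in>Poly_Mapping.keys q. Poly_Mapping.lookup q m *
        (\<Prod>v\<in>Poly_Mapping.keys m. a v ^ Poly_Mapping.lookup m v))"

text \<open>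
  The affine coordinates on the product of the spaces of forms are the coefficients of the forms:
  the coordinate \<open>(i, m)\<close> of \<open>Fs\<close> is the coefficient of the monomial \<open>m\<close> in the
  \<open>i\<close>-th form. A Zariski open set is the complement in the product of the common zero locus
  of a set of polynomials in these coordinates.
\<close>

definition zariski_open :: "nat list \<Rightarrow> ('n::finite, 'k::field) mpol list set \<Rightarrow> bool" where
  "zariski_open es U \<longleftrightarrow>
     (\<exists>Q :: ((nat \<times> 'n monom \<Rightarrow>\<^sub>0 nat) \<Rightarrow>\<^sub>0 'k) set.
        U = form_tuples es -
            {Fs. \<forall>q\<in>Q. poly_value (\<lambda>(i, m). Poly_Mapping.lookup (Fs ! i) m) q = 0})"

definition for_general_forms :: "nat list \<Rightarrow> (('n::finite, 'k::field) mpol list \<Rightarrow> bool) \<Rightarrow> bool" where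
  "for_general_forms es P \<longleftrightarrow> (\<exists>U. zariski_open es U \<and> U \<noteq> {} \<and> (\<forall>Fs\<in>U. P Fs))"


section \<open>Graded free resolutions\<close>

text \<open>
  The list \<open>[s\<^sub>1,\<dots>,s\<^sub>r]\<close> stands for the graded free module
  \<open>R(-s\<^sub>1) \<oplus> \<dots> \<oplus> R(-s\<^sub>r)\<close>, and a homomorphism of free modules
  is given by its matrix, acting on column vectors. The homomorphism is homogeneous of degree
  \<open>0\<close> iff the entry from \<open>R(-s)\<close> to \<open>R(-t)\<close> is a form of degree
  \<open>s - t\<close>.
\<close>

definition graded_hom :: "int list \<Rightarrow> int list \<Rightarrow> ('n::finite, 'k::field) mpol mat \<Rightarrow> bool" where
  "graded_hom src tgt A \<longleftrightarrow>
     A \<in> carrier_mat (length tgt) (length src) \<and>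
     (\<forall>a<length tgt. \<forall>b<length src. A $$ (a, b) \<in> forms (src ! b - tgt ! a))"

definition mat_image :: "'a::comm_ring_1 mat \<Rightarrow> 'a vec set" where
  "mat_image A = (\<lambda>v. A *\<^sub>v v) ` carrier_vec (dim_col A)"

text \<open>
  The complex is \<open>\<F>\<^sub>0 \<leftarrow> \<F>\<^sub>1 \<leftarrow> \<F>\<^sub>2 \<leftarrow> \<dots>\<close> with
  \<open>\<F>\<^sub>i\<close> given by \<open>sh i\<close>, \<open>\<F>\<^sub>0 = R\<close>, and
  \<open>D i : \<F>\<^sub>i\<^sub>+\<^sub>1 \<rightarrow> \<F>\<^sub>i\<close>.
  Minimality says that all entries of the differentials lie in the maximal ideal
  \<open>(x\<^sub>1,\<dots>,x\<^sub>n)\<close>.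
\<close>

definition minimal_free_resolution ::
    "('n::finite, 'k::field) mpol set \<Rightarrow> (nat \<Rightarrow> int list) \<Rightarrow> (nat \<Rightarrow> ('n, 'k) mpol mat) \<Rightarrow> bool" where
  "minimal_free_resolution I sh D \<longleftrightarrow>
     sh 0 = [0] \<and>
     (\<forall>i>CARD('n). sh i = []) \<and>
     (\<forall>i. graded_hom (sh (Suc i)) (sh i) (D i)) \<and>
     mat_image (D 0) = {vec 1 (\<lambda>_. f) | f. f \<in> I} \<and>
     (\<forall>i. mat_kernel (D i) = mat_image (D (Suc i))) \<and>
     (\<forall>i. \<forall>f\<in>elements_mat (D i). const_coeff f = 0)"

text \<open>\<open>R(-t)\<close> is a ghost term between the \<open>i\<close>-th and the \<open>(i+1)\<close>-st free modules.\<close>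

definition ghost_term :: "(nat \<Rightarrow> int list) \<Rightarrow> nat \<Rightarrow> int \<Rightarrow> bool" where
  "ghost_term sh i t \<longleftrightarrow> t \<in> set (sh i) \<and> t \<in> set (sh (Suc i))"


section \<open>The Koszul complex and Koszul syzygies\<close>

text \<open>
  The basis of the \<open>i\<close>-th module of the Koszul complex on \<open>N\<close> elements: the
  increasing lists \<open>j\<^sub>1 < \<dots> < j\<^sub>i\<close> of indices below \<open>N\<close>.
\<close>

definition koszul_basis :: "nat \<Rightarrow> nat \<Rightarrow> nat list list" where
  "koszul_basis N i = filter (\<lambda>S. length S = i) (subseqs [0..<N])"

text \<open>
  The degrees \<open>es\<close> of the forms are passed separately, since a form alone does not
  determine its degree when it is zero.
\<close>

definition koszul_shifts :: "nat list \<Rightarrow> nat \<Rightarrow> int list" where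
  "koszul_shifts es i = map (\<lambda>S. \<Sum>j\<leftarrow>S. int (es ! j)) (koszul_basis (length es) i)"

text \<open>
  \<open>koszul_diff Fs i : K\<^sub>i\<^sub>+\<^sub>1 \<rightarrow> K\<^sub>i\<close> sends the basis element
  of \<open>S\<close> to the sum over the positions \<open>r\<close> of \<open>(-1)\<^sup>r F\<^bsub>S ! r\<^esub>\<close>
  times the basis element of \<open>S\<close> with its \<open>r\<close>-th entry removed.
\<close>

definition koszul_diff :: "'a::comm_ring_1 list \<Rightarrow> nat \<Rightarrow> 'a mat" where
  "koszul_diff Fs i =
     (let B = koszul_basis (length Fs) in
      mat (length (B i)) (length (B (Suc i)))
        (\<lambda>(a, b). let S = B (Suc i) ! b in
           \<Sum>r<Suc i. if B i ! a = take r S @ drop (Suc r) S then (-1) ^ r * Fs ! (S ! r) else 0))"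

text \<open>A chain map \<open>K \<rightarrow> \<F>\<close> of graded complexes that lifts the identity of \<open>R/I\<close>.\<close>

definition comparison_map ::
    "nat list \<Rightarrow> ('n::finite, 'k::field) mpol list \<Rightarrow>
     (nat \<Rightarrow> int list) \<Rightarrow> (nat \<Rightarrow> ('n, 'k) mpol mat) \<Rightarrow> (nat \<Rightarrow> ('n, 'k) mpol mat) \<Rightarrow> bool" where
  "comparison_map es Fs sh D \<alpha> \<longleftrightarrow>
     (\<forall>i. graded_hom (koszul_shifts es i) (sh i) (\<alpha> i)) \<and>
     (\<forall>i. D i * \<alpha> (Suc i) = \<alpha> i * koszul_diff Fs i) \<and>
     \<alpha> 0 $$ (0, 0) - 1 \<in> ideal_of (set Fs)"

text \<open>
  For a graded free module \<open>\<F>\<close> with shifts \<open>s\<close> this is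
  \<open>(\<F> \<otimes>\<^sub>R k)\<^sub>t\<close>, in coordinates with respect to the standard basis.
  Tensoring a homomorphism with \<open>k\<close> replaces its matrix entries by their constant terms.
\<close>

definition residue_part :: "int list \<Rightarrow> int \<Rightarrow> 'k::field vec set" where
  "residue_part s t = {v \<in> carrier_vec (length s). \<forall>a<length s. s ! a \<noteq> t \<longrightarrow> v $ a = 0}"

text \<open>
  The copies of \<open>R(-t)\<close> in \<open>\<F>\<^sub>i\<close> are Koszul: the map
  \<open>(K\<^sub>i \<otimes>\<^sub>R k)\<^sub>t \<rightarrow> (\<F>\<^sub>i \<otimes>\<^sub>R k)\<^sub>t\<close>
  is surjective. That map does not depend on the comparison map inducing it.
\<close>

definition koszul_syzygies ::
    "nat list \<Rightarrow> ('n::finite, 'k::field) mpol list \<Rightarrow>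
     (nat \<Rightarrow> int list) \<Rightarrow> (nat \<Rightarrow> ('n, 'k) mpol mat) \<Rightarrow> nat \<Rightarrow> int \<Rightarrow> bool" where
  "koszul_syzygies es Fs sh D i t \<longleftrightarrow>
     (\<exists>\<alpha>. comparison_map es Fs sh D \<alpha> \<and>
        (\<lambda>v. map_mat const_coeff (\<alpha> i) *\<^sub>v v) ` residue_part (koszul_shifts es i) t = residue_part (sh i) t)"

definition koszul_ghost_term ::
    "nat list \<Rightarrow> ('n::finite, 'k::field) mpol list \<Rightarrow>
     (nat \<Rightarrow> int list) \<Rightarrow> (nat \<Rightarrow> ('n, 'k) mpol mat) \<Rightarrow> nat \<Rightarrow> int \<Rightarrow> bool" where
  "koszul_ghost_term es Fs sh D i t \<longleftrightarrow>
     ghost_term sh i t \<and> koszul_syzygies es Fs sh D (Suc i) t"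

definition non_koszul_ghost_term ::
    "nat list \<Rightarrow> ('n::finite, 'k::field) mpol list \<Rightarrow>
     (nat \<Rightarrow> int list) \<Rightarrow> (nat \<Rightarrow> ('n, 'k) mpol mat) \<Rightarrow> nat \<Rightarrow> int \<Rightarrow> bool" where
  "non_koszul_ghost_term es Fs sh D i t \<longleftrightarrow>
     ghost_term sh i t \<and> \<not> koszul_ghost_term es Fs sh D i t"

end

theory Submission
  imports Defs "HOL-Library.Function_Algebras"
begin

text \<open>
  Let \<open>J\<close> be the complete intersection and \<open>\<phi>\<close> a generator of the dual of its
  one-dimensional socle, which lives in degree \<open>c + 1\<close>. The resolution of \<open>R/I\<close> is
  compared with the Koszul complex of \<open>R/I\<close> on the variables by zigzags in a double complex.
  In degree \<open>c + j\<close> the relevant Koszul homology is controlled by the vectors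
  \<open>v\<^sub>l = (\<phi>(x\<^sub>i G\<^sub>l))\<^sub>i\<close>, where \<open>G\<^sub>1, \<dots>, G\<^sub>p\<close> are the additional
  forms of degree \<open>c\<close>. For \<open>j > p\<close> the functional
  \<open>f \<mapsto> v\<^sub>1 \<and> \<dots> \<and> v\<^sub>p \<and> \<dots> \<and> \<phi>(\<partial>f)\<close>
  detects a class in the \<open>j\<close>-th homology. A class in the next homology is given by
  \<open>g e\<^sub>S\<close>, where \<open>g\<close> has degree \<open>c - 1\<close> and
  \<open>\<phi>(x\<^sub>a x\<^sub>b g)\<close> is the product of the \<open>a\<close>-th and \<open>b\<close>-th entries of
  \<open>v\<^sub>1\<close>, so that \<open>x\<^sub>a g\<close> is a multiple of \<open>G\<^sub>1\<close> modulo \<open>J\<close>. For degree reasons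
  a Koszul syzygy in this degree involves only the generators of \<open>J\<close>, and its boundary is then
  zero modulo \<open>J\<close>, while the boundary of \<open>g e\<^sub>S\<close> is not.

  All that is needed of the forms are finitely many nonvanishing determinants. Division with
  remainder of exponents by the degrees turns monomials into products of monomials in a box with
  powers of the \<open>F\<^sub>i\<close>; if these span the polynomials of low degree they form a basis
  of the whole ring, which therefore behaves as for \<open>F\<^sub>i = x\<^sub>i ^ d\<^sub>i\<close>. The
  conditions hold for these powers together with the monomials of degree \<open>c\<close> that divide
  the socle monomial.
\<close>

text \<open>The socle degree of \<open>R/J\<close> is the sum of the \<open>d_i - 1\<close>, which
  is \<open>c + 1\<close>. One nonzero \<open>v_l\<close> therefore puts every form of degree
  \<open>c + 1\<close> into \<open>I\<close>, and a form of degree \<open>c\<close> times any basis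
  element is a cycle over \<open>R/I\<close>. After applying \<open>\<phi>\<close>, such a cycle can
  bound only through the \<open>v_l\<close>; the test functional wedges with all \<open>p\<close> of
  them and with \<open>j - 1 - p\<close> further unit vectors, whence \<open>j > p\<close>. For the
  upper copy a nonzero class is not enough, because there may be Koszul basis elements of the same
  degree. The class is shown to differ from every class represented by a chain whose boundary lies
  in \<open>J\<close>. The zero class and the Koszul classes are of this type, so one obstruction
  gives both the copy and the failure to be Koszul. Duality for \<open>R/J\<close> is obtained from
  an invertible matrix that pairs monomials of degree at most two with their complements in the
  socle monomial; the complements exist because \<open>d_i \<ge> 3\<close>.\<close>

abbreviation "lookup \<equiv> Poly_Mapping.lookup"
abbreviation "keys \<equiv> Poly_Mapping.keys"
abbreviation "single \<equiv> Poly_Mapping.single"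

section \<open>Exterior multiplication and the Koszul complex\<close>

text \<open>
  A function on sets of naturals stands for the element of an exterior algebra whose coefficient at
  the basis element \<open>e\<^sub>S\<close> is its value at \<open>S\<close>.
\<close>

definition wedge :: "(nat \<Rightarrow> 'a::comm_ring_1) \<Rightarrow> (nat set \<Rightarrow> 'a) \<Rightarrow> nat set \<Rightarrow> 'a" where
  "wedge y f S = (\<Sum>i\<in>S. (-1) ^ card {j\<in>S. j < i} * (y i * f (S - {i})))"

text \<open>The terms cancel pairwise, without dividing by two; concluding from the sum being its
  own negative would fail in characteristic two.\<close>

lemma sum_antisymmetric_pairs:
  fixes g :: "nat \<Rightarrow> nat \<Rightarrow> 'a::ab_group_add"
  assumes S: "finite S" and g: "\<And>i j. i \<in> S \<Longrightarrow> j \<in> S \<Longrightarrow> i < j \<Longrightarrow> g i j = - g j i"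
  shows "(\<Sum>i\<in>S. \<Sum>j\<in>S - {i}. g i j) = 0"
proof -
  have "(\<Sum>j\<in>S - {i}. g i j) = (\<Sum>j | j \<in> S \<and> j < i. g i j) + (\<Sum>j | j \<in> S \<and> i < j. g i j)" for i
  proof -
    have "S - {i} = {j. j \<in> S \<and> j < i} \<union> {j. j \<in> S \<and> i < j}" by auto
    moreover have "sum (g i) ({j. j \<in> S \<and> j < i} \<union> {j. j \<in> S \<and> i < j}) =
      (\<Sum>j | j \<in> S \<and> j < i. g i j) + (\<Sum>j | j \<in> S \<and> i < j. g i j)"
      using S by (intro sum.union_disjoint) auto
    ultimately show ?thesis by simp
  qed
  then have "(\<Sum>i\<in>S. \<Sum>j\<in>S - {i}. g i j) =
      (\<Sum>i\<in>S. \<Sum>j | j \<in> S \<and> j < i. g i j) + (\<Sum>i\<in>S. \<Sum>j | j \<in> S \<and> i < j. g i j)"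
    by (simp add: sum.distrib)
  also have "(\<Sum>i\<in>S. \<Sum>j | j \<in> S \<and> i < j. g i j) = (\<Sum>j\<in>S. \<Sum>i | i \<in> S \<and> i < j. g i j)"
    using S by (intro sum.swap_restrict) auto
  also have "\<dots> = (\<Sum>i\<in>S. \<Sum>j | j \<in> S \<and> j < i. - g i j)"
  proof (intro sum.cong refl)
    fix i j assume "i \<in> S" "j \<in> {j. j \<in> S \<and> j < i}"
    then show "g j i = - g i j" using g[of j i] by simp
  qed
  also have "(\<Sum>i\<in>S. \<Sum>j | j \<in> S \<and> j < i. g i j) + \<dots> = 0"
    by (simp add: sum_negf)
  finally show ?thesis .
qed

text \<open>Deleting the smaller index lowers the position of the larger one by one, while deleting
  the larger index leaves the smaller in place.\<close>

lemma position_sign_swap: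
  fixes S :: "nat set"
  assumes S: "finite S" and ij: "i \<in> S" "j \<in> S" "i < j"
  shows "(-1 :: 'a::comm_ring_1) ^ card {k\<in>S. k < i} * (-1) ^ card {k\<in>S - {i}. k < j} =
    - ((-1) ^ card {k\<in>S. k < j} * (-1) ^ card {k\<in>S - {j}. k < i})"
proof -
  have 1: "{k\<in>S - {j}. k < i} = {k\<in>S. k < i}" using ij by auto
  have "{k\<in>S. k < j} = insert i {k\<in>S - {i}. k < j}" using ij by auto
  moreover have "finite {k\<in>S - {i}. k < j}" using S by auto
  ultimately have "card {k\<in>S. k < j} = Suc (card {k\<in>S - {i}. k < j})" by simp
  then show ?thesis unfolding 1 by simp
qed

lemma wedge_wedge_unfold:
  "wedge y (wedge z f) S = (\<Sum>i\<in>S. \<Sum>j\<in>S - {i}.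
     (-1) ^ card {k\<in>S. k < i} * (-1) ^ card {k\<in>S - {i}. k < j} * (y i * z j * f (S - {i, j})))"
proof -
  have *: "S - {i} - {j} = S - {i, j}" for i j by auto
  show ?thesis
    unfolding wedge_def sum_distrib_left * by (intro sum.cong refl) (simp add: algebra_simps)
qed

lemma wedge_infinite: "infinite S \<Longrightarrow> wedge y f S = 0"
  by (simp add: wedge_def)

lemma wedge_anticommute: "wedge y (wedge z f) S + wedge z (wedge y f) S = 0"
proof (cases "finite S")
  case True
  let ?s = "\<lambda>i j. (-1) ^ card {k\<in>S. k < i} * (-1) ^ card {k\<in>S - {i}. k < j} :: 'a"
  have "wedge y (wedge z f) S + wedge z (wedge y f) S =
     (\<Sum>i\<in>S. \<Sum>j\<in>S - {i}. ?s i j * ((y i * z j + z i * y j) * f (S - {i, j})))"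
    unfolding wedge_wedge_unfold sum.distrib[symmetric] by (intro sum.cong refl) (simp add: algebra_simps)
  also have "\<dots> = 0"
  proof (rule sum_antisymmetric_pairs[OF True])
    fix i j assume ij: "i \<in> S" "j \<in> S" "i < j"
    have "?s i j = - ?s j i" by (rule position_sign_swap[OF True ij])
    moreover have "S - {i, j} = S - {j, i}" by auto
    ultimately show "?s i j * ((y i * z j + z i * y j) * f (S - {i, j})) =
        - (?s j i * ((y j * z i + z j * y i) * f (S - {j, i})))"
      by (simp add: algebra_simps)
  qed
  finally show ?thesis .
qed (simp add: wedge_infinite)

text \<open>Needs its own proof: for \<open>y = z\<close>, \<open>wedge_anticommute\<close> says
  nothing in characteristic two.\<close>

lemma wedge_wedge_self: "wedge y (wedge y f) S = 0"
proof (cases "finite S")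
  case True
  let ?s = "\<lambda>i j. (-1) ^ card {k\<in>S. k < i} * (-1) ^ card {k\<in>S - {i}. k < j} :: 'a"
  show ?thesis unfolding wedge_wedge_unfold
  proof (rule sum_antisymmetric_pairs[OF True])
    fix i j assume ij: "i \<in> S" "j \<in> S" "i < j"
    have "?s i j = - ?s j i" by (rule position_sign_swap[OF True ij])
    moreover have "S - {i, j} = S - {j, i}" by auto
    ultimately show "?s i j * (y i * y j * f (S - {i, j})) = - (?s j i * (y j * y i * f (S - {j, i})))"
      by (simp add: algebra_simps)
  qed
qed (simp add: wedge_infinite)

lemma wedge_add: "wedge y (\<lambda>S. f S + g S) S = wedge y f S + wedge y g S"
  by (simp add: wedge_def algebra_simps sum.distrib)

lemma wedge_diff: "wedge y (\<lambda>S. f S - g S) S = wedge y f S - wedge y g S"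
  by (simp add: wedge_def algebra_simps sum_subtractf)

lemma wedge_mult: "wedge y (\<lambda>S. c * f S) S = c * wedge y f S"
  by (simp add: wedge_def algebra_simps sum_distrib_left)

lemma wedge_sum: "wedge y (\<lambda>S. \<Sum>b\<in>B. f b S) S = (\<Sum>b\<in>B. wedge y (f b) S)"
  unfolding wedge_def sum_distrib_left by (rule sum.swap)

lemma wedge_zero [simp]: "wedge y (\<lambda>S. 0) S = 0"
  by (simp add: wedge_def)

lemma wedge_cong:
  "(\<And>i. i \<in> S \<Longrightarrow> y i * f (S - {i}) = z i * g (S - {i})) \<Longrightarrow> wedge y f S = wedge z g S"
  by (simp add: wedge_def)

definition wedges :: "(nat \<Rightarrow> 'a::comm_ring_1) list \<Rightarrow> (nat set \<Rightarrow> 'a) \<Rightarrow> nat set \<Rightarrow> 'a" where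
  "wedges vs = foldr wedge vs"

lemma wedges_simps [simp]: "wedges [] f = f" "wedges (v # vs) f = wedge v (wedges vs f)"
  by (simp_all add: wedges_def)

lemma wedges_append: "wedges (vs @ us) f = wedges vs (wedges us f)"
  by (simp add: wedges_def)

lemma wedges_zero [simp]: "wedges vs (\<lambda>S. 0) = (\<lambda>S. 0)"
  by (induction vs) auto

lemma wedges_sum: "wedges vs (\<lambda>S. \<Sum>b\<in>B. f b S) S = (\<Sum>b\<in>B. wedges vs (f b) S)"
proof (induction vs arbitrary: S)
  case (Cons v vs)
  have "wedges vs (\<lambda>S. \<Sum>b\<in>B. f b S) = (\<lambda>S. \<Sum>b\<in>B. wedges vs (f b) S)" using Cons by auto
  then show ?case by (simp add: wedge_sum)
qed simp

lemma wedges_wedge_commute: "wedges vs (wedge v f) S = (-1) ^ length vs * wedge v (wedges vs f) S"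
proof (induction vs arbitrary: S)
  case (Cons w vs)
  have "wedges vs (wedge v f) = (\<lambda>S. (-1) ^ length vs * wedge v (wedges vs f) S)" using Cons by auto
  moreover have "wedge w (wedge v (wedges vs f)) S = - wedge v (wedge w (wedges vs f)) S"
    using wedge_anticommute[of w v "wedges vs f" S] by (simp add: eq_neg_iff_add_eq_0)
  ultimately show ?case by (simp add: wedge_mult)
qed simp

text \<open>The vector is moved through the product until it meets its copy. Such products
  annihilate what the extra forms contribute to a boundary.\<close>

lemma wedges_wedge_eq_zero:
  assumes "v \<in> set vs"
  shows "wedges vs (wedge v f) S = 0"
  using assms
proof (induction vs arbitrary: S)
  case (Cons w vs)
  show ?case
  proof (cases "v \<in> set vs")
    case True
    then have "wedges vs (wedge v f) = (\<lambda>S. 0)" using Cons.IH by auto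
    then show ?thesis by simp
  next
    case False
    then have "w = v" using Cons.prems by simp
    then show ?thesis
      unfolding wedges_simps by (subst wedges_wedge_commute[abs_def]) (simp add: wedge_mult wedge_wedge_self)
  qed
qed simp

definition unit_at :: "nat \<Rightarrow> nat \<Rightarrow> 'a::zero_neq_one" where
  "unit_at k i = (if i = k then 1 else 0)"

definition set_basis :: "nat set \<Rightarrow> nat set \<Rightarrow> 'a::zero_neq_one" where
  "set_basis A S = (if S = A then 1 else 0)"

lemma wedge_unit_at:
  assumes "m < n"
  shows "wedge (unit_at m) (set_basis {Suc m..<n}) = set_basis {m..<n}"
proof
  fix S :: "nat set"
  show "wedge (unit_at m) (set_basis {Suc m..<n}) S = (set_basis {m..<n} S :: 'a)"
  proof (cases "finite S")
    case fin: True
    have *: "(\<Sum>i\<in>S. (-1) ^ card {j\<in>S. j < i} * (unit_at m i * set_basis {Suc m..<n} (S - {i}))) =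
        (\<Sum>i\<in>S. if i = m then (-1) ^ card {j\<in>S. j < m} * set_basis {Suc m..<n} (S - {m}) else (0::'a))"
      by (intro sum.cong refl) (simp add: unit_at_def)
    have eq: "m \<in> S \<and> S - {m} = {Suc m..<n} \<longleftrightarrow> S = {m..<n}"
    proof
      assume "m \<in> S \<and> S - {m} = {Suc m..<n}"
      then have "S = insert m {Suc m..<n}" by blast
      then show "S = {m..<n}" using assms by auto
    qed (use assms in auto)
    have sum_eq: "(\<Sum>i\<in>S. if i = m then a else 0) = (if m \<in> S then a else (0::'a))" for a
      using fin by simp
    show ?thesis
    proof (cases "S = {m..<n}")
      case True
      have 0: "{j\<in>S. j < m} = {}" using True by auto
      show ?thesis unfolding wedge_def * sum_eq 0 using True eq by (simp add: set_basis_def)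
    next
      case False
      then have "\<not> (m \<in> S \<and> S - {m} = {Suc m..<n})" using eq by blast
      then show ?thesis unfolding wedge_def * sum_eq using False by (auto simp: set_basis_def)
    qed
  next
    case False
    then show ?thesis by (auto simp: wedge_infinite set_basis_def)
  qed
qed

lemma wedges_unit_at:
  "p + m \<le> n \<Longrightarrow> wedges (map unit_at [p..<p + m]) (set_basis {p + m..<n}) = set_basis {p..<n}"
  by (induction m) (simp_all add: wedges_append wedge_unit_at)

subsection \<open>Exactness of the Koszul complex\<close>

text \<open>As \<open>m\<close> exceeds every index of \<open>T\<close>, no sign at an index of
  \<open>T\<close> changes. This displays the Koszul complex on \<open>m + 1\<close> elements as the
  mapping cone of multiplication by \<open>x m\<close> on the complex on \<open>m\<close>
  elements.\<close>

lemma wedge_insert_top: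
  assumes T: "T \<subseteq> {..<m}"
  shows "wedge x f (insert m T) = wedge x (\<lambda>U. f (insert m U)) T + (-1) ^ card T * (x m * f T)"
proof -
  have fin: "finite T" using T finite_subset by blast
  have m: "m \<notin> T" using T by auto
  have "{j \<in> insert m T. j < m} = T" using T by auto
  then have 1: "(-1) ^ card {j \<in> insert m T. j < m} * (x m * f (insert m T - {m})) = (-1) ^ card T * (x m * f T)"
    using m by simp
  have 2: "(\<Sum>i\<in>T. (-1) ^ card {j \<in> insert m T. j < i} * (x i * f (insert m T - {i}))) = wedge x (\<lambda>U. f (insert m U)) T"
    unfolding wedge_def
  proof (intro sum.cong refl)
    fix i assume i: "i \<in> T"
    have "{j \<in> insert m T. j < i} = {j \<in> T. j < i}" using T i by auto
    moreover have "insert m T - {i} = insert m (T - {i})" using i m by auto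
    ultimately show "(-1) ^ card {j \<in> insert m T. j < i} * (x i * f (insert m T - {i})) =
        (-1) ^ card {j \<in> T. j < i} * (x i * f (insert m (T - {i})))" by simp
  qed
  show ?thesis
    unfolding wedge_def[of x f "insert m T"] sum.insert[OF fin m] 1 2 by (simp add: add.commute)
qed

text \<open>The Koszul complex of a regular sequence has cohomology only at the full set, where it
  is the quotient by the ideal; \<open>top\<close> says that the class there is zero. The induction
  follows the mapping cone of \<open>wedge_insert_top\<close>, and \<open>f\<close> may mix sets of
  all sizes.\<close>

lemma koszul_exact:
  fixes x :: "nat \<Rightarrow> 'a::comm_ring_1"
  defines "I' \<equiv> \<lambda>k. {\<Sum>i<k. r i * x i | r. True}"
  assumes reg: "\<And>k g. k < m \<Longrightarrow> x k * g \<in> I' k \<Longrightarrow> g \<in> I' k"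
    and f: "\<And>S. S \<subseteq> {..<m} \<Longrightarrow> wedge x f S = 0" and top: "f {..<m} \<in> I' m"
  shows "\<exists>g. \<forall>S\<subseteq>{..<m}. wedge x g S = f S"
  using reg f top
proof (induction m arbitrary: f)
  case 0
  then show ?case by (intro exI[of _ "\<lambda>_. 0"]) (auto simp: I'_def)
next
  case (Suc m)
  have uminus: "- a \<in> I' k" if a: "a \<in> I' k" for a k
  proof -
    obtain r where "a = (\<Sum>i<k. r i * x i)" using a unfolding I'_def by auto
    then have "- a = (\<Sum>i<k. (\<lambda>i. - r i) i * x i)" by (simp add: sum_negf)
    then show ?thesis unfolding I'_def by (intro CollectI exI[of _ "\<lambda>i. - r i"]) simp
  qed
  have wedge_top: "wedge x h {..<k} \<in> I' k" for h k
  proof -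
    have "wedge x h {..<k} = (\<Sum>i<k. ((-1) ^ card {j\<in>{..<k}. j < i} * h ({..<k} - {i})) * x i)"
      unfolding wedge_def by (intro sum.cong) (auto simp: algebra_simps)
    then show ?thesis unfolding I'_def
      by (intro CollectI exI[of _ "\<lambda>i. (-1) ^ card {j\<in>{..<k}. j < i} * h ({..<k} - {i})"]) simp
  qed
  have f1: "wedge x (\<lambda>U. f (insert m U)) T + (-1) ^ card T * (x m * f T) = 0" if T: "T \<subseteq> {..<m}" for T
  proof -
    have "insert m T \<subseteq> {..<Suc m}" using T by auto
    then show ?thesis using Suc.prems(2) wedge_insert_top[OF T, of x f] by metis
  qed
  \<comment> \<open>The cycle condition at all \<open>m + 1\<close> indices puts
    \<open>x m * f {..<m}\<close> into the ideal of the first \<open>m\<close> elements, and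
    regularity cancels \<open>x m\<close>.\<close>
  have "(-1) ^ m * (x m * f {..<m}) = - wedge x (\<lambda>U. f (insert m U)) {..<m}"
    using f1[of "{..<m}"] by (simp add: eq_neg_iff_add_eq_0 add.commute)
  then have "(-1) ^ m * ((-1) ^ m * (x m * f {..<m})) = (-1) ^ m * (- wedge x (\<lambda>U. f (insert m U)) {..<m})"
    by simp
  then have "x m * f {..<m} = (-1) ^ m * (- wedge x (\<lambda>U. f (insert m U)) {..<m})"
    by simp
  moreover have "(-1) ^ m * a \<in> I' m" if "a \<in> I' m" for a
    using that uminus by (cases "even m") auto
  ultimately have "x m * f {..<m} \<in> I' m" using wedge_top uminus by metis
  then have fm: "f {..<m} \<in> I' m" using Suc.prems(1) by blast
  have "\<exists>g. \<forall>S\<subseteq>{..<m}. wedge x g S = f S"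
  proof (rule Suc.IH)
    show "wedge x f S = 0" if "S \<subseteq> {..<m}" for S
      by (rule Suc.prems(2)) (use that in \<open>auto simp: lessThan_Suc\<close>)
  qed (use fm Suc.prems(1) less_Suc_eq in blast)+
  then obtain g0' where g0': "\<And>S. S \<subseteq> {..<m} \<Longrightarrow> wedge x g0' S = f S" by blast
  obtain r where r: "f {..<Suc m} = (\<Sum>i<Suc m. r i * x i)" using Suc.prems(3) unfolding I'_def by auto
  \<comment> \<open>The value of a primitive of \<open>f\<close> at the top set is free; this choice makes \<open>k\<close> below land in the smaller ideal.\<close>
  define g0 where "g0 = g0'({..<m} := (-1) ^ m * r m)"
  have g0: "wedge x g0 S = f S" if S: "S \<subseteq> {..<m}" for S
  proof -
    have "wedge x g0 S = wedge x g0' S"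
      by (intro wedge_cong) (use S in \<open>auto simp: g0_def\<close>)
    then show ?thesis using g0' S by simp
  qed
  \<comment> \<open>On sets containing \<open>m\<close> the function \<open>g0\<close> already
    contributes the subtracted term; \<open>k\<close> is what \<open>g1\<close> has to account
    for.\<close>
  define k where "k = (\<lambda>T. f (insert m T) - x m * ((-1) ^ card T * g0 T))"
  have "\<exists>g. \<forall>S\<subseteq>{..<m}. wedge x g S = k S"
  proof (rule Suc.IH)
    fix S assume S: "S \<subseteq> {..<m}"
    have fin: "finite S" using S finite_subset by blast
    have "wedge x (\<lambda>T. (-1) ^ card T * g0 T) S = - ((-1) ^ card S * wedge x g0 S)"
    proof -
      have "(-1) ^ card (S - {i}) = - ((-1) ^ card S :: 'a)" if i: "i \<in> S" for i
        using card.remove[OF fin i] by simp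
      then have "wedge x (\<lambda>T. (-1) ^ card T * g0 T) S = wedge x (\<lambda>T. (- ((-1) ^ card S)) * g0 T) S"
        unfolding wedge_def by (intro sum.cong refl) simp
      also have "\<dots> = - ((-1) ^ card S * wedge x g0 S)" by (simp only: wedge_mult) simp
      finally show ?thesis .
    qed
    then show "wedge x k S = 0"
      unfolding k_def wedge_diff wedge_mult using f1[OF S] g0[OF S] by (simp add: algebra_simps)
  next
    have "insert m {..<m} = {..<Suc m}" by auto
    then have "k {..<m} = (\<Sum>i<Suc m. r i * x i) - x m * ((-1) ^ m * ((-1) ^ m * r m))"
      unfolding k_def g0_def r[symmetric] by simp
    also have "\<dots> = (\<Sum>i<m. r i * x i)"
      by (simp only: left_minus_one_mult_self sum.lessThan_Suc) (simp add: mult.commute[of "x m"])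
    finally show "k {..<m} \<in> I' m" unfolding I'_def by auto
  qed (use Suc.prems(1) less_Suc_eq in blast)
  then obtain g1 where g1: "\<And>S. S \<subseteq> {..<m} \<Longrightarrow> wedge x g1 S = k S" by blast
  define g where "g S = (if m \<in> S then g1 (S - {m}) else g0 S)" for S
  have "wedge x g S = f S" if S: "S \<subseteq> {..<Suc m}" for S
  proof (cases "m \<in> S")
    case False
    then have S': "S \<subseteq> {..<m}" using S by (auto simp: lessThan_Suc)
    have "wedge x g S = wedge x g0 S" by (intro wedge_cong) (use False in \<open>auto simp: g_def\<close>)
    then show ?thesis using g0[OF S'] by simp
  next
    case True
    define T where "T = S - {m}"
    have T: "T \<subseteq> {..<m}" and ST: "S = insert m T" using S True by (auto simp: T_def lessThan_Suc)
    have mT: "m \<notin> T" using T by auto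
    have "wedge x (\<lambda>U. g (insert m U)) T = wedge x g1 T"
      by (intro wedge_cong) (use mT in \<open>auto simp: g_def insert_Diff_if\<close>)
    moreover have "g T = g0 T" using mT by (simp add: g_def)
    ultimately have "wedge x g S = k T + (-1) ^ card T * (x m * g0 T)"
      unfolding ST wedge_insert_top[OF T] using g1[OF T] by simp
    also have "\<dots> = f S" by (simp add: k_def ST algebra_simps)
    finally show ?thesis .
  qed
  then show ?case by blast
qed

section \<open>Ideals and homogeneous polynomials\<close>

lemma module_times: "Modules.module ((*) :: 'a::comm_ring_1 \<Rightarrow> 'a \<Rightarrow> 'a)"
  by (simp add: module_def algebra_simps)

lemma ideal_of_zero [simp]: "0 \<in> ideal_of S"
  unfolding ideal_of_def by (rule module.span_zero[OF module_times])

lemma ideal_of_base: "f \<in> S \<Longrightarrow> f \<in> ideal_of S"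
  unfolding ideal_of_def by (rule module.span_base[OF module_times])

lemma ideal_of_add: "f \<in> ideal_of S \<Longrightarrow> g \<in> ideal_of S \<Longrightarrow> f + g \<in> ideal_of S"
  unfolding ideal_of_def by (rule module.span_add[OF module_times])

lemma ideal_of_mult_left: "f \<in> ideal_of S \<Longrightarrow> c * f \<in> ideal_of S"
  unfolding ideal_of_def by (rule module.span_scale[OF module_times])

lemma ideal_of_mult_right: "f \<in> ideal_of S \<Longrightarrow> f * c \<in> ideal_of S"
  using ideal_of_mult_left[of f S c] by (simp add: mult.commute)

lemma ideal_of_sum: "(\<And>i. i \<in> A \<Longrightarrow> f i \<in> ideal_of S) \<Longrightarrow> (\<Sum>i\<in>A. f i) \<in> ideal_of S"
  unfolding ideal_of_def by (rule module.span_sum[OF module_times])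

lemma ideal_of_mono: "S \<subseteq> T \<Longrightarrow> f \<in> ideal_of S \<Longrightarrow> f \<in> ideal_of T"
  unfolding ideal_of_def using module.span_mono[OF module_times] by blast

lemma ideal_of_image:
  "f \<in> ideal_of (F ` {..<k::nat}) \<longleftrightarrow> (\<exists>r. f = (\<Sum>i<k. r i * F i))"
proof
  assume "f \<in> ideal_of (F ` {..<k})"
  then show "\<exists>r. f = (\<Sum>i<k. r i * F i)"
    unfolding ideal_of_def
  proof (rule module.span_induct[OF module_times, of f "F ` {..<k}" "\<lambda>f. \<exists>r. f = (\<Sum>i<k. r i * F i)"])
    show "module.subspace (*) {f. \<exists>r. f = (\<Sum>i<k. r i * F i)}"
      unfolding module.subspace_def[OF module_times]
    proof (intro conjI ballI allI)
      show "0 \<in> {f. \<exists>r. f = (\<Sum>i<k. r i * F i)}" by (auto intro!: exI[of _ "\<lambda>_. 0"])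
    next
      fix a b assume "a \<in> {f. \<exists>r. f = (\<Sum>i<k. r i * F i)}" "b \<in> {f. \<exists>r. f = (\<Sum>i<k. r i * F i)}"
      then obtain r s where "a = (\<Sum>i<k. r i * F i)" "b = (\<Sum>i<k. s i * F i)" by auto
      then show "a + b \<in> {f. \<exists>r. f = (\<Sum>i<k. r i * F i)}"
        by (intro CollectI exI[of _ "\<lambda>i. r i + s i"]) (simp add: sum.distrib distrib_right)
    next
      fix c a assume "a \<in> {f. \<exists>r. f = (\<Sum>i<k. r i * F i)}"
      then obtain r where "a = (\<Sum>i<k. r i * F i)" by auto
      then show "c * a \<in> {f. \<exists>r. f = (\<Sum>i<k. r i * F i)}"
        by (intro CollectI exI[of _ "\<lambda>i. c * r i"]) (simp add: sum_distrib_left mult.assoc)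
    qed
  next
    fix a assume "a \<in> F ` {..<k}"
    then obtain j where j: "j < k" "a = F j" by auto
    have "(\<Sum>i<k. unit_at j i * F i) = (\<Sum>i<k. if i = j then F j else 0)"
      by (intro sum.cong) (auto simp: unit_at_def)
    also have "\<dots> = a" using j by (simp add: sum.delta)
    finally have "a = (\<Sum>i<k. unit_at j i * F i)" ..
    then show "\<exists>r. a = (\<Sum>i<k. r i * F i)" by blast
  qed
next
  assume "\<exists>r. f = (\<Sum>i<k. r i * F i)"
  then show "f \<in> ideal_of (F ` {..<k})"
    by (elim exE) (simp only: ideal_of_sum ideal_of_mult_left ideal_of_base imageI)
qed

section \<open>Coefficients of products, degrees and homogeneous components\<close>

lemma mpol_expand: "f = (\<Sum>m\<in>keys f. single m (lookup f m))"
proof (rule poly_mapping_eqI)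
  fix m
  have "lookup (\<Sum>m\<in>keys f. single m (lookup f m)) m =
     (\<Sum>k\<in>keys f. if k = m then lookup f m else 0)"
    unfolding lookup_sum by (intro sum.cong refl) (simp add: lookup_single when_def)
  also have "\<dots> = lookup f m"
    by (simp add: in_keys_iff)
  finally show "lookup f m = lookup (\<Sum>m\<in>keys f. single m (lookup f m)) m" ..
qed

lemma mpol_times_expand:
  fixes f g :: "'a::comm_monoid_add \<Rightarrow>\<^sub>0 'k::comm_ring_1"
  shows "f * g = (\<Sum>a\<in>keys f. \<Sum>b\<in>keys g.
      single (a + b) (lookup f a * lookup g b))"
  by (rule arg_cong2[of _ _ _ _ times, OF mpol_expand[of f] mpol_expand[of g], unfolded sum_product mult_single])

lemma lookup_times:
  fixes f g :: "'a::comm_monoid_add \<Rightarrow>\<^sub>0 'k::comm_ring_1"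
  shows "lookup (f * g) m = (\<Sum>a\<in>keys f. \<Sum>b\<in>keys g.
    if a + b = m then lookup f a * lookup g b else 0)"
  by (subst mpol_times_expand) (simp only: lookup_sum lookup_single when_def)

lemma lookup_single_times:
  fixes g :: "('a \<Rightarrow>\<^sub>0 nat) \<Rightarrow>\<^sub>0 'k::comm_ring_1"
  shows "lookup (single a c * g) (a + m) = c * lookup g m"
proof (cases "c = 0")
  case False
  then have keys: "keys (single a c) = {a}" by simp
  have "lookup (single a c * g) (a + m) =
      (\<Sum>b\<in>keys g. if b = m then c * lookup g b else 0)"
    unfolding lookup_times keys by simp
  also have "\<dots> = c * lookup g m"
    by (cases "m \<in> keys g") (auto simp: in_keys_iff)
  finally show ?thesis .
qed simp

lemma mdeg_add [simp]: "mdeg (a + b) = mdeg a + mdeg b"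
  by (simp add: mdeg_def lookup_add sum.distrib)

lemma mdeg_zero [simp]: "mdeg 0 = 0"
  by (simp add: mdeg_def)

lemma mdeg_eq_zero: "mdeg m = 0 \<longleftrightarrow> m = 0"
proof
  assume "mdeg m = 0"
  then show "m = 0" by (intro poly_mapping_eqI) (simp add: mdeg_def)
qed simp

lemma mdeg_single [simp]: "mdeg (single x k) = k"
  by (simp add: mdeg_def lookup_single when_def)

lemma finite_mdeg: "finite {m :: 'n::finite monom. mdeg m \<le> e}"
proof -
  have "inj_on (lookup :: 'n monom \<Rightarrow> _) A" for A
    by (auto intro: inj_onI poly_mapping_eqI)
  moreover have "lookup ` {m :: 'n monom. mdeg m \<le> e} \<subseteq> Pi UNIV (\<lambda>_. {..e})"
  proof (clarsimp)
    fix m :: "'n monom" and x assume m: "mdeg m \<le> e"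
    have "lookup m x \<le> mdeg m" unfolding mdeg_def by (intro member_le_sum) auto
    then show "lookup m x \<le> e" using m by simp
  qed
  moreover have "finite (Pi (UNIV :: 'n set) (\<lambda>_. {..e}))"
    using finite_PiE[of "UNIV :: 'n set" "\<lambda>_. {..e}"] by (simp add: PiE_UNIV_domain)
  ultimately show ?thesis by (meson finite_imageD finite_subset)
qed

lemma forms_zero [simp]: "0 \<in> forms e"
  by (simp add: forms_def)

lemma forms_add: "f \<in> forms e \<Longrightarrow> g \<in> forms e \<Longrightarrow> f + g \<in> forms e"
  unfolding forms_def using keys_add[of f g] by blast

lemma forms_uminus: "f \<in> forms e \<Longrightarrow> - f \<in> forms e"
  by (auto simp: forms_def in_keys_iff)

lemma forms_diff: "f \<in> forms e \<Longrightarrow> g \<in> forms e \<Longrightarrow> f - g \<in> forms e"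
  by (simp only: diff_conv_add_uminus forms_add forms_uminus)

lemma forms_sum: "(\<And>i. i \<in> A \<Longrightarrow> f i \<in> forms e) \<Longrightarrow> (\<Sum>i\<in>A. f i) \<in> forms e"
  by (induction A rule: infinite_finite_induct) (auto intro: forms_add)

lemma forms_mult: "f \<in> forms d \<Longrightarrow> g \<in> forms e \<Longrightarrow> f * g \<in> forms (d + e)"
  unfolding forms_def using keys_mult[of f g] by fastforce

lemma forms_minus_one_power: "f \<in> forms e \<Longrightarrow> (-1) ^ k * f \<in> forms e"
  by (cases "even k") (auto intro: forms_uminus)

lemma forms_single: "int (mdeg m) = e \<Longrightarrow> single m c \<in> forms e"
  by (auto simp: forms_def)

lemma forms_const: "single 0 c \<in> forms 0"
  by (rule forms_single) simp

lemma forms_neg: "e < 0 \<Longrightarrow> f \<in> forms e \<Longrightarrow> f = 0"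
  by (auto simp: forms_def intro: ccontr dest!: poly_mapping_eqI simp flip: keys_eq_empty)

lemma forms_const_coeff: "f \<in> forms e \<Longrightarrow> e \<noteq> 0 \<Longrightarrow> const_coeff f = 0"
  unfolding forms_def const_coeff_def by (metis (mono_tags, lifting) in_keys_iff mdeg_zero mem_Collect_eq of_nat_0)

lemma forms_degree_zero: 
  assumes "f \<in> forms 0"
  shows "f = single 0 (const_coeff f)"
proof (rule poly_mapping_eqI)
  fix m
  show "lookup f m = lookup (single 0 (const_coeff f)) m"
    using assms by (cases "m = 0") (auto simp: const_coeff_def lookup_single when_def forms_def in_keys_iff mdeg_eq_zero)
qed

definition hpart :: "int \<Rightarrow> ('n::finite, 'k::field) mpol \<Rightarrow> ('n, 'k) mpol" where
  "hpart e f = (\<Sum>m\<in>{m\<in>keys f. int (mdeg m) = e}. single m (lookup f m))"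

lemma lookup_hpart: "lookup (hpart e f) m = (if int (mdeg m) = e then lookup f m else 0)"
proof -
  have "lookup (hpart e f) m =
      (\<Sum>k\<in>{m\<in>keys f. int (mdeg m) = e}. if k = m then lookup f m else 0)"
    unfolding hpart_def lookup_sum by (intro sum.cong refl) (simp add: lookup_single when_def)
  then show ?thesis by (simp add: in_keys_iff)
qed

lemma hpart_in_forms [simp]: "hpart e f \<in> forms e"
  by (auto simp: forms_def in_keys_iff lookup_hpart split: if_splits)

lemma hpart_zero [simp]: "hpart e 0 = 0"
  by (simp add: hpart_def)

lemma hpart_add: "hpart e (f + g) = hpart e f + hpart e g"
  by (rule poly_mapping_eqI) (simp add: lookup_hpart lookup_add)

lemma hpart_sum: "hpart e (\<Sum>i\<in>A. f i) = (\<Sum>i\<in>A. hpart e (f i))"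
  by (induction A rule: infinite_finite_induct) (auto simp: hpart_add)

lemma hpart_minus_one_power: "hpart e ((-1) ^ k * f) = (-1) ^ k * hpart e f"
  by (cases "even k") (auto intro!: poly_mapping_eqI simp: lookup_hpart)

lemma hpart_forms: "f \<in> forms e \<Longrightarrow> hpart d f = (if d = e then f else 0)"
  by (rule poly_mapping_eqI) (auto simp: lookup_hpart forms_def in_keys_iff)

text \<open>Taking components is compatible with multiplication by a form, so a solution of a
  homogeneous linear system may be replaced by a homogeneous one.\<close>

lemma hpart_mult:
  assumes f: "f \<in> forms d"
  shows "hpart e (f * g) = f * hpart (e - d) g"
proof -
  have "hpart e (f * (g - hpart (e - d) g)) = 0"
  proof (rule poly_mapping_eqI)
    fix m :: "'a monom"
    have "lookup (f * (g - hpart (e - d) g)) m = 0" if m: "int (mdeg m) = e"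
    proof (rule ccontr)
      assume "lookup (f * (g - hpart (e - d) g)) m \<noteq> 0"
      then have "m \<in> keys (f * (g - hpart (e - d) g))" by (simp add: in_keys_iff)
      then obtain a b where ab: "a \<in> keys f" "b \<in> keys (g - hpart (e - d) g)" "m = a + b"
        using keys_mult by blast
      have "int (mdeg a) = d" using f ab(1) by (simp add: forms_def)
      then have "int (mdeg b) = e - d" using m ab(3) by simp
      then show False using ab(2) by (simp add: in_keys_iff lookup_minus lookup_hpart)
    qed
    then show "lookup (hpart e (f * (g - hpart (e - d) g))) m = lookup 0 m"
      by (simp add: lookup_hpart)
  qed
  moreover have "hpart e (f * hpart (e - d) g) = f * hpart (e - d) g"
    using forms_mult[OF f hpart_in_forms[of "e - d" g]] by (simp add: hpart_forms)
  moreover have "f * g = f * (g - hpart (e - d) g) + f * hpart (e - d) g" by (simp add: algebra_simps)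
  ultimately show ?thesis by (metis add_0 hpart_add)
qed

text \<open>The variables carry no order, but exterior signs and intervals of indices need one; any
  enumeration will do.\<close>

definition var_at :: "nat \<Rightarrow> 'n::finite" where
  "var_at = (SOME b. bij_betw b {..<CARD('n)} (UNIV :: 'n set))"

lemma var_at_bij: "bij_betw var_at {..<CARD('n)} (UNIV :: 'n::finite set)"
proof -
  have "\<exists>b. bij_betw b {..<CARD('n)} (UNIV :: 'n set)"
    using ex_bij_betw_nat_finite[of "UNIV :: 'n set"] by (auto simp: atLeast0LessThan)
  then show ?thesis unfolding var_at_def by (rule someI_ex)
qed

lemma var_at_eq_iff: "i < CARD('n) \<Longrightarrow> j < CARD('n) \<Longrightarrow> (var_at i :: 'n::finite) = var_at j \<longleftrightarrow> i = j"
  using var_at_bij[where 'n='n] by (auto simp: bij_betw_def inj_on_def)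

lemma var_at_surj: "\<exists>i<CARD('n). (x :: 'n::finite) = var_at i"
  using var_at_bij[where 'n='n] by (auto simp: bij_betw_def)

lemma sum_var_at: "(\<Sum>x\<in>(UNIV :: 'n::finite set). f x) = (\<Sum>i<CARD('n). f (var_at i))"
  using sum.reindex_bij_betw[OF var_at_bij[where 'n='n], of f] by simp

definition var_power :: "nat \<Rightarrow> nat \<Rightarrow> 'n::finite monom" where
  "var_power i k = single (var_at i) k"

definition monic :: "'n monom \<Rightarrow> ('n::finite, 'k::field) mpol" where
  "monic m = single m 1"

lemma lookup_var_power: 
  "i < CARD('n) \<Longrightarrow> j < CARD('n) \<Longrightarrow> lookup (var_power i k :: 'n::finite monom) (var_at j) = (if i = j then k else 0)"
  by (simp add: var_power_def lookup_single when_def var_at_eq_iff)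

lemma mdeg_var_power [simp]: "mdeg (var_power i k) = k"
  by (simp add: var_power_def)

lemma monic_mult: "monic (a + b) = monic a * monic b"
  by (simp add: monic_def mult_single)

lemma monic_in_forms: "int (mdeg m) = e \<Longrightarrow> monic m \<in> forms e"
  by (simp add: monic_def forms_single)

lemma monom_eqI:
  fixes a b :: "'n::finite monom"
  assumes "\<And>i. i < CARD('n) \<Longrightarrow> lookup a (var_at i) = lookup b (var_at i)"
  shows "a = b"
proof (rule poly_mapping_eqI)
  fix x show "lookup a x = lookup b x"
    using var_at_surj[of x] assms by auto
qed

text \<open>An ideal generated by powers of variables is spanned by monomials. Exponents one give
  the maximal ideal, the exponents \<open>ds\<close> the model complete intersection.\<close>

lemma monomial_ideal_iff:
  fixes f :: "('n::finite, 'k::field) mpol" and e :: "nat \<Rightarrow> nat"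
  assumes k: "k \<le> CARD('n)"
  shows "f \<in> ideal_of ((\<lambda>i. monic (var_power i (e i))) ` {..<k}) \<longleftrightarrow>
    (\<forall>m\<in>keys f. \<exists>i<k. e i \<le> lookup m (var_at i))"
proof
  assume "f \<in> ideal_of ((\<lambda>i. monic (var_power i (e i))) ` {..<k})"
  then obtain r where r: "f = (\<Sum>i<k. r i * monic (var_power i (e i)))" unfolding ideal_of_image by auto
  show "\<forall>m\<in>keys f. \<exists>i<k. e i \<le> lookup m (var_at i)"
  proof
    fix m assume "m \<in> keys f"
    then obtain i where i: "i < k" "m \<in> keys (r i * monic (var_power i (e i)))"
      unfolding r using keys_sum[of "\<lambda>i. r i * monic (var_power i (e i))" "{..<k}"] by auto
    then obtain a where "m = a + var_power i (e i)"
      using keys_mult[of "r i" "monic (var_power i (e i))"] by (auto simp: monic_def)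
    then show "\<exists>i<k. e i \<le> lookup m (var_at i)"
      using i k by (auto intro!: exI[of _ i] simp: lookup_add lookup_var_power)
  qed
next
  assume f: "\<forall>m\<in>keys f. \<exists>i<k. e i \<le> lookup m (var_at i)"
  show "f \<in> ideal_of ((\<lambda>i. monic (var_power i (e i))) ` {..<k})"
  proof (subst mpol_expand, rule ideal_of_sum)
    fix m assume "m \<in> keys f"
    then obtain i where i: "i < k" "e i \<le> lookup m (var_at i)" using f by blast
    have "m = (m - var_power i (e i)) + var_power i (e i)"
      using i by (intro poly_mapping_eqI) (auto simp: lookup_add lookup_minus var_power_def lookup_single when_def)
    then have "single m (lookup f m) =
        single (m - var_power i (e i)) (lookup f m) * monic (var_power i (e i))"
      unfolding monic_def mult_single by simp
    then show "single m (lookup f m) \<in> ideal_of ((\<lambda>i. monic (var_power i (e i))) ` {..<k})"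
      using i by (simp only: ideal_of_mult_left ideal_of_base image_eqI lessThan_iff)
  qed
qed

text \<open>Multiplying by a power of variable \<open>k\<close> does not touch the exponents of the
  earlier variables.\<close>

lemma var_powers_regular:
  fixes g :: "('n::finite, 'k::field) mpol" and e :: "nat \<Rightarrow> nat"
  assumes k: "k < CARD('n)" and g: "monic (var_power k (e k)) * g \<in> ideal_of ((\<lambda>i. monic (var_power i (e i))) ` {..<k})"
  shows "g \<in> ideal_of ((\<lambda>i. monic (var_power i (e i))) ` {..<k})"
proof -
  have le: "k \<le> CARD('n)" using k by simp
  show ?thesis unfolding monomial_ideal_iff[OF le]
  proof
    fix m assume "m \<in> keys g"
    then have "var_power k (e k) + m \<in> keys (monic (var_power k (e k)) * g)"
      by (simp add: in_keys_iff monic_def lookup_single_times)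
    then obtain i where "i < k" "e i \<le> lookup (var_power k (e k) + m) (var_at i)"
      using g unfolding monomial_ideal_iff[OF le] by blast
    then show "\<exists>i<k. e i \<le> lookup m (var_at i)"
      using k by (auto intro!: exI[of _ i] simp: lookup_add lookup_var_power)
  qed
qed

text \<open>Zero beyond the number of variables, so that exterior multiplication never leads out of
  the subsets of the index range.\<close>

definition X :: "nat \<Rightarrow> ('n::finite, 'k::field) mpol" where
  "X i = (if i < CARD('n) then monic (var_power i 1) else 0)"

lemma X_in_forms: "X i \<in> forms 1"
  by (simp add: X_def monic_in_forms)

lemma X_image: "k \<le> CARD('n) \<Longrightarrow>
    (X ` {..<k} :: ('n::finite, 'k::field) mpol set) = (\<lambda>i. monic (var_power i 1)) ` {..<k}"
  by (intro image_cong) (auto simp: X_def)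

lemma const_coeff_zero_imp_in_maximal_ideal:
  fixes f :: "('n::finite, 'k::field) mpol"
  assumes "const_coeff f = 0"
  shows "f \<in> ideal_of (X ` {..<CARD('n)})"
  unfolding X_image[OF order_refl] monomial_ideal_iff[OF order_refl, of f "\<lambda>_. 1"]
proof
  fix m assume "m \<in> keys f"
  then have "m \<noteq> 0" using assms by (auto simp: const_coeff_def in_keys_iff)
  then obtain x where "lookup m x \<noteq> 0" by (metis lookup_zero poly_mapping_eqI)
  moreover obtain i where "i < CARD('n)" "x = var_at i" using var_at_surj by blast
  ultimately show "\<exists>i<CARD('n). 1 \<le> lookup m (var_at i)"
    by (auto intro!: exI[of _ i])
qed

lemma koszul_exact_variables:
  fixes f :: "nat set \<Rightarrow> ('n::finite, 'k::field) mpol"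
  assumes "\<And>S. S \<subseteq> {..<CARD('n)} \<Longrightarrow> wedge X f S = 0" and "const_coeff (f {..<CARD('n)}) = 0"
  shows "\<exists>g. \<forall>S\<subseteq>{..<CARD('n)}. wedge X g S = f S"
proof (rule koszul_exact)
  fix k and g :: "('n, 'k) mpol"
  assume k: "k < CARD('n)" and "X k * g \<in> {\<Sum>i<k. r i * X i |r. True}"
  then have "X k * g \<in> ideal_of (X ` {..<k})" unfolding ideal_of_image by blast
  then have "g \<in> ideal_of (X ` {..<k})"
    using var_powers_regular[of k "\<lambda>_. 1" g] k by (simp add: X_image) (simp add: X_def)
  then show "g \<in> {\<Sum>i<k. r i * X i |r. True}" unfolding ideal_of_image by blast
next
  show "f {..<CARD('n)} \<in> {\<Sum>i<CARD('n). r i * X i |r. True}"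
    using const_coeff_zero_imp_in_maximal_ideal[OF assms(2)] unfolding ideal_of_image by blast
qed (use assms in auto)

section \<open>Double complexes of homogeneous chains\<close>

text \<open>
  The Koszul complex on the variables is indexed by complements: the coefficient at a set with
  \<open>card S + b = n\<close> has homological degree \<open>b\<close>, so that its differential is
  multiplication by the vector of the variables. Here \<open>t\<close> is the total degree.
\<close>

definition hchains :: "int \<Rightarrow> int list \<Rightarrow> (nat \<Rightarrow> bool) \<Rightarrow> nat \<Rightarrow> (nat set \<Rightarrow> nat \<Rightarrow> ('n::finite, 'k::field) mpol) set" where
  "hchains t sh Q b = {f. \<forall>S i. f S i \<in> forms (t - int b - sh ! i) \<and>
     (f S i \<noteq> 0 \<longrightarrow> S \<subseteq> {..<CARD('n)} \<and> card S + b = CARD('n) \<and> i < length sh \<and> Q i)}"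

definition kos :: "(nat set \<Rightarrow> nat \<Rightarrow> ('n::finite, 'k::field) mpol) \<Rightarrow> nat set \<Rightarrow> nat \<Rightarrow> ('n, 'k) mpol" where
  "kos f S i = wedge X (\<lambda>T. f T i) S"

definition mat_map :: "'a::comm_ring_1 mat \<Rightarrow> (nat set \<Rightarrow> nat \<Rightarrow> 'a) \<Rightarrow> nat set \<Rightarrow> nat \<Rightarrow> 'a" where
  "mat_map A f S i = (if i < dim_row A then \<Sum>k<dim_col A. A $$ (i, k) * f S k else 0)"

lemma hchains_forms: "f \<in> hchains t sh Q b \<Longrightarrow> f S i \<in> forms (t - int b - sh ! i)"
  by (simp add: hchains_def)

lemma hchains_support:
  fixes f :: "nat set \<Rightarrow> nat \<Rightarrow> ('n::finite, 'k::field) mpol"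
  assumes "f \<in> hchains t sh Q b" "f S i \<noteq> 0"
  shows "S \<subseteq> {..<CARD('n)}" "card S + b = CARD('n)" "i < length sh" "Q i"
  using assms by (simp_all add: hchains_def)

lemma hchains_zero: "0 \<in> hchains t sh Q b"
  by (simp add: hchains_def)

lemma hchains_diff:
  assumes "f \<in> hchains t sh Q b" "g \<in> hchains t sh Q b"
  shows "f - g \<in> hchains t sh Q b"
  unfolding hchains_def
proof (intro CollectI allI conjI impI)
  fix S i
  show "(f - g) S i \<in> forms (t - int b - sh ! i)"
    using assms by (simp add: forms_diff hchains_forms)
  assume "(f - g) S i \<noteq> 0"
  then have "f S i \<noteq> 0 \<or> g S i \<noteq> 0" by auto
  then show "S \<subseteq> {..<CARD('a)}" "card S + b = CARD('a)" "i < length sh" "Q i"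
    using assms hchains_support by metis+
qed

lemma kos_diff: "kos (f - g) = kos f - kos g"
  by (auto simp: kos_def wedge_diff intro!: ext)

lemma kos_zero [simp]: "kos 0 = 0"
  by (auto simp: kos_def intro!: ext)

lemma kos_kos: "kos (kos f) = 0"
  by (auto simp: kos_def wedge_wedge_self intro!: ext)

lemma mat_map_diff: "mat_map A (f - g) = mat_map A f - mat_map A g"
  by (auto simp: mat_map_def algebra_simps sum_subtractf intro!: ext)

lemma mat_map_zero [simp]: "mat_map A 0 = 0"
  by (auto simp: mat_map_def intro!: ext)

lemma kos_mat_map: "kos (mat_map A f) = mat_map A (kos f)"
proof (intro ext)
  fix S i
  show "kos (mat_map A f) S i = mat_map A (kos f) S i"
    by (cases "i < dim_row A") (simp_all add: kos_def mat_map_def wedge_sum wedge_mult)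
qed

lemma mat_map_mat_map:
  assumes "dim_col A = dim_row B"
  shows "mat_map A (mat_map B f) = mat_map (A * B) f"
proof (intro ext)
  fix S i
  show "mat_map A (mat_map B f) S i = mat_map (A * B) f S i"
  proof (cases "i < dim_row A")
    case True
    have "(\<Sum>k<dim_col A. A $$ (i, k) * (\<Sum>l<dim_col B. B $$ (k, l) * f S l)) =
        (\<Sum>l<dim_col B. \<Sum>k<dim_col A. A $$ (i, k) * B $$ (k, l) * f S l)"
      unfolding sum_distrib_left by (subst sum.swap) (simp add: mult.assoc)
    also have "\<dots> = (\<Sum>l<dim_col B. (A * B) $$ (i, l) * f S l)"
      using True assms by (intro sum.cong refl) (simp add: scalar_prod_def sum_distrib_right atLeast0LessThan)
    finally show ?thesis using True assms by (simp add: mat_map_def)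
  qed (simp add: mat_map_def)
qed

lemma mat_map_zero_mat:
  assumes "\<And>i k. i < dim_row A \<Longrightarrow> k < dim_col A \<Longrightarrow> A $$ (i, k) = 0"
  shows "mat_map A f = 0"
  using assms by (auto simp: mat_map_def intro!: ext sum.neutral)

lemma mat_map_eq_mult_mat_vec:
  assumes "i < dim_row A"
  shows "mat_map A f S i = (A *\<^sub>v vec (dim_col A) (f S)) $ i"
  using assms by (simp add: mat_map_def scalar_prod_def atLeast0LessThan)

lemma kos_hchains:
  assumes f: "f \<in> hchains t sh Q (Suc b)"
  shows "kos f \<in> hchains t sh Q b"
  unfolding hchains_def
proof (intro CollectI allI conjI impI)
  fix S i
  show "kos f S i \<in> forms (t - int b - sh ! i)"
    unfolding kos_def wedge_def
  proof (intro forms_sum forms_minus_one_power)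
    fix l
    have "X l * f (S - {l}) i \<in> forms (1 + (t - int (Suc b) - sh ! i))"
      by (intro forms_mult X_in_forms hchains_forms[OF f])
    moreover have "1 + (t - int (Suc b) - sh ! i) = t - int b - sh ! i" by simp
    ultimately show "X l * f (S - {l}) i \<in> forms (t - int b - sh ! i)" by metis
  qed
  assume nz: "kos f S i \<noteq> 0"
  then have fin: "finite S" using wedge_infinite unfolding kos_def by blast
  have "\<exists>l\<in>S. X l * f (S - {l}) i \<noteq> 0"
  proof (rule ccontr)
    assume "\<not> ?thesis"
    then have "kos f S i = 0" unfolding kos_def wedge_def by (intro sum.neutral) simp
    then show False using nz by simp
  qed
  then obtain l where l: "l \<in> S" "X l * f (S - {l}) i \<noteq> 0" by blast
  have nz': "f (S - {l}) i \<noteq> 0" "X l \<noteq> (0 :: ('a, 'b) mpol)" using l(2) by auto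
  then have "l < CARD('a)" by (auto simp: X_def split: if_splits)
  then show "S \<subseteq> {..<CARD('a)}" using hchains_support(1)[OF f nz'(1)] by auto
  show "card S + b = CARD('a)"
    using hchains_support(2)[OF f nz'(1)] card.remove[OF fin l(1)] by simp
  show "i < length sh" "Q i" using hchains_support[OF f nz'(1)] by auto
qed

text \<open>The equation is first solved without gradings. Cutting the solution down to the right
  degree and support keeps it a solution, because \<open>f\<close> already has them.\<close>

lemma kos_exact_homog:
  fixes f :: "nat set \<Rightarrow> nat \<Rightarrow> ('n::finite, 'k::field) mpol"
  assumes f: "f \<in> hchains t sh Q b"
    and cyc: "\<And>S i. S \<subseteq> {..<CARD('n)} \<Longrightarrow> kos f S i = 0"
    and top: "\<And>i. const_coeff (f {..<CARD('n)} i) = 0"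
  shows "\<exists>g\<in>hchains t sh Q (Suc b). kos g = f"
proof -
  have "\<exists>g. \<forall>S\<subseteq>{..<CARD('n)}. wedge X g S = f S i" for i
    using koszul_exact_variables[of "\<lambda>S. f S i"] cyc top by (simp add: kos_def)
  then obtain h where h: "\<And>i S. S \<subseteq> {..<CARD('n)} \<Longrightarrow> wedge X (h i) S = f S i" by metis
  define ok where "ok S i \<longleftrightarrow> S \<subseteq> {..<CARD('n)} \<and> card S + Suc b = CARD('n) \<and> i < length sh \<and> Q i" for S i
  define g where "g S i = (if ok S i then hpart (t - int (Suc b) - sh ! i) (h i S) else 0)" for S i
  have "g \<in> hchains t sh Q (Suc b)"
    by (auto simp: hchains_def g_def ok_def)
  moreover have "kos g S i = f S i" for S i
  proof (cases "S \<subseteq> {..<CARD('n)} \<and> card S + b = CARD('n) \<and> i < length sh \<and> Q i")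
    case True
    then have fin: "finite S" using finite_subset by blast
    have ok: "ok (S - {l}) i" if "l \<in> S" for l
      using True card.remove[OF fin that] by (auto simp: ok_def)
    have "kos g S i = (\<Sum>l\<in>S. (-1) ^ card {j \<in> S. j < l} * (X l * hpart (t - int (Suc b) - sh ! i) (h i (S - {l}))))"
      unfolding kos_def wedge_def by (intro sum.cong refl) (simp add: g_def ok)
    also have "\<dots> = (\<Sum>l\<in>S. hpart (t - int b - sh ! i) ((-1) ^ card {j \<in> S. j < l} * (X l * h i (S - {l}))))"
    proof (intro sum.cong refl)
      fix l
      have "t - int b - sh ! i - 1 = t - int (Suc b) - sh ! i" by simp
      then have "hpart (t - int b - sh ! i) (X l * h i (S - {l})) = X l * hpart (t - int (Suc b) - sh ! i) (h i (S - {l}))"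
        using hpart_mult[OF X_in_forms] by metis
      then show "(-1) ^ card {j \<in> S. j < l} * (X l * hpart (t - int (Suc b) - sh ! i) (h i (S - {l}))) =
          hpart (t - int b - sh ! i) ((-1) ^ card {j \<in> S. j < l} * (X l * h i (S - {l})))"
        by (simp only: hpart_minus_one_power)
    qed
    also have "\<dots> = hpart (t - int b - sh ! i) (f S i)"
      using h[of S i] True unfolding wedge_def hpart_sum[symmetric] by simp
    also have "\<dots> = f S i" by (subst hpart_forms[OF hchains_forms[OF f, of S i]]) simp
    finally show ?thesis .
  next
    case False
    then have 0: "f S i = 0" using hchains_support[OF f] by blast
    have "X l * g (S - {l}) i = 0" if l: "l \<in> S" "finite S" for l
    proof (rule ccontr)
      assume nz: "X l * g (S - {l}) i \<noteq> 0"
      have "X l \<noteq> (0 :: ('n, 'k) mpol)" "ok (S - {l}) i" using nz by (auto simp: g_def split: if_splits)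
      then have "l < CARD('n)" "ok (S - {l}) i" by (auto simp: X_def split: if_splits)
      then show False using False card.remove[OF l(2,1)] by (auto simp: ok_def)
    qed
    then have "kos g S i = 0" unfolding kos_def wedge_def
      by (cases "finite S") (auto intro!: sum.neutral)
    then show ?thesis using 0 by simp
  qed
  ultimately show ?thesis by (intro bexI[of _ g]) auto
qed

text \<open>\<open>Q\<close> records which basis elements of the free module may occur. It is
  trivial for the resolution; for the Koszul complex it will single out the basis elements built
  from generators of \<open>J\<close>.\<close>

lemma mat_map_hchains:
  assumes A: "graded_hom src tgt A" and f: "f \<in> hchains t src Q b"
    and Q': "\<And>i k. i < length tgt \<Longrightarrow> k < length src \<Longrightarrow> Q k \<Longrightarrow> A $$ (i, k) \<noteq> 0 \<Longrightarrow> Q' i"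
  shows "mat_map A f \<in> hchains t tgt Q' b"
  unfolding hchains_def
proof (intro CollectI allI conjI impI)
  have dim: "dim_row A = length tgt" "dim_col A = length src"
    and gr: "\<And>i k. i < length tgt \<Longrightarrow> k < length src \<Longrightarrow> A $$ (i, k) \<in> forms (src ! k - tgt ! i)"
    using A by (auto simp: graded_hom_def)
  fix S i
  show "mat_map A f S i \<in> forms (t - int b - tgt ! i)"
  proof (cases "i < length tgt")
    case True
    have "A $$ (i, k) * f S k \<in> forms (t - int b - tgt ! i)" if "k < length src" for k
      using forms_mult[OF gr[OF True that] hchains_forms[OF f, of S k]] by (simp add: algebra_simps)
    then show ?thesis using True by (auto simp: mat_map_def dim intro!: forms_sum)
  qed (simp add: mat_map_def dim)
  assume nz: "mat_map A f S i \<noteq> 0"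
  then show i: "i < length tgt" by (auto simp: mat_map_def dim split: if_splits)
  obtain k where k: "k < length src" "A $$ (i, k) * f S k \<noteq> 0"
    using nz i by (auto simp: mat_map_def dim elim!: sum.not_neutral_contains_not_neutral)
  then have nz': "f S k \<noteq> 0" "A $$ (i, k) \<noteq> 0" by auto
  show "S \<subseteq> {..<CARD('a)}" "card S + b = CARD('a)" using hchains_support[OF f nz'(1)] by auto
  show "Q' i" using Q' i k(1) hchains_support(4)[OF f nz'(1)] nz'(2) by blast
qed

text \<open>Preimages chosen separately for each set are cut down as in
  \<open>kos_exact_homog\<close>; the grading of \<open>B\<close> makes the components fit.\<close>

lemma mat_map_lift:
  fixes f :: "nat set \<Rightarrow> nat \<Rightarrow> ('n::finite, 'k::field) mpol"
  assumes B: "graded_hom src tgt B" and f: "f \<in> hchains t tgt (\<lambda>_. True) b"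
    and im: "\<And>S. vec (length tgt) (f S) \<in> mat_image B"
  shows "\<exists>g\<in>hchains t src (\<lambda>_. True) b. mat_map B g = f"
proof -
  have dim: "dim_row B = length tgt" "dim_col B = length src"
    and gr: "\<And>i k. i < length tgt \<Longrightarrow> k < length src \<Longrightarrow> B $$ (i, k) \<in> forms (src ! k - tgt ! i)"
    using B by (auto simp: graded_hom_def)
  have "\<exists>v\<in>carrier_vec (length src). B *\<^sub>v v = vec (length tgt) (f S)" for S
    using im[of S] unfolding mat_image_def dim by auto
  then obtain v where v: "\<And>S. v S \<in> carrier_vec (length src)" "\<And>S. B *\<^sub>v v S = vec (length tgt) (f S)"
    by metis
  define ok where "ok S k \<longleftrightarrow> S \<subseteq> {..<CARD('n)} \<and> card S + b = CARD('n) \<and> k < length src" for S k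
  define g where "g S k = (if ok S k then hpart (t - int b - src ! k) (v S $ k) else 0)" for S k
  have "g \<in> hchains t src (\<lambda>_. True) b"
    by (auto simp: hchains_def g_def ok_def)
  moreover have "mat_map B g S i = f S i" for S i
  proof (cases "S \<subseteq> {..<CARD('n)} \<and> card S + b = CARD('n) \<and> i < length tgt")
    case True
    have "mat_map B g S i = (\<Sum>k<length src. B $$ (i, k) * hpart (t - int b - src ! k) (v S $ k))"
      using True by (simp add: mat_map_def dim g_def ok_def)
    also have "\<dots> = (\<Sum>k<length src. hpart (t - int b - tgt ! i) (B $$ (i, k) * v S $ k))"
    proof (intro sum.cong refl)
      fix k assume k: "k \<in> {..<length src}"
      have "t - int b - tgt ! i - (src ! k - tgt ! i) = t - int b - src ! k" by simp
      then show "B $$ (i, k) * hpart (t - int b - src ! k) (v S $ k) = hpart (t - int b - tgt ! i) (B $$ (i, k) * v S $ k)"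
        using hpart_mult[OF gr] True k by (metis lessThan_iff)
    qed
    also have "\<dots> = hpart (t - int b - tgt ! i) ((B *\<^sub>v v S) $ i)"
      using True v(1)[of S] by (simp add: hpart_sum scalar_prod_def dim atLeast0LessThan)
    also have "\<dots> = f S i"
      using True v(2)[of S] hchains_forms[OF f, of S i] by (simp add: hpart_forms)
    finally show ?thesis .
  next
    case False
    then have 0: "f S i = 0" using hchains_support[OF f] by blast
    have "\<not> ok S k" if "i < length tgt" for k using False that by (auto simp: ok_def)
    then show ?thesis using 0 by (simp add: mat_map_def g_def dim)
  qed
  ultimately show ?thesis by (intro bexI[of _ g]) auto
qed

text \<open>
  In the next three lemmas \<open>d a\<close> maps column \<open>a + 1\<close> of a double complex to column
  \<open>a\<close>, and \<open>e\<close> lowers the second index. Moving along an antidiagonal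
  relates the homology of the first column to that of the bottom row.
\<close>

lemma zigzag_up:
  fixes C :: "nat \<Rightarrow> nat \<Rightarrow> 'm::ab_group_add set"
  assumes d: "\<And>a b z. z \<in> C (Suc a) b \<Longrightarrow> d a z \<in> C a b"
    and e: "\<And>a b z. z \<in> C a (Suc b) \<Longrightarrow> e z \<in> C a b"
    and comm: "\<And>a z. d a (e z) = e (d a z)" and ee: "\<And>z. e (e z) = 0"
    and exact: "\<And>a b z. z \<in> C (Suc a) b \<Longrightarrow> d a z = 0 \<Longrightarrow> \<exists>w\<in>C (Suc (Suc a)) b. d (Suc a) w = z"
    and z0: "z0 \<in> C 0 (Suc m)" and z1: "z1 \<in> C 1 m" "d 0 z1 = e z0"
  shows "\<exists>z. z 0 = z0 \<and> (\<forall>a\<le>Suc m. z a \<in> C a (Suc m - a)) \<and> (\<forall>a\<le>m. d a (z (Suc a)) = e (z a))"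
proof -
  have "\<exists>z. z 0 = z0 \<and> (\<forall>a\<le>Suc k. z a \<in> C a (Suc m - a)) \<and> (\<forall>a\<le>k. d a (z (Suc a)) = e (z a))" if "k \<le> m" for k
    using that
  proof (induction k)
    case 0
    show ?case
      by (rule exI[of _ "\<lambda>a. if a = 0 then z0 else z1"]) (use z0 z1 in \<open>auto simp: le_Suc_eq\<close>)
  next
    case (Suc k)
    then obtain z where z: "z 0 = z0" "\<And>a. a \<le> Suc k \<Longrightarrow> z a \<in> C a (Suc m - a)"
      "\<And>a. a \<le> k \<Longrightarrow> d a (z (Suc a)) = e (z a)" by auto
    have "z (Suc k) \<in> C (Suc k) (Suc (m - Suc k))" using z(2)[of "Suc k"] Suc.prems by (simp add: Suc_diff_Suc)
    then have "e (z (Suc k)) \<in> C (Suc k) (m - Suc k)" by (rule e)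
    moreover have "d k (e (z (Suc k))) = 0" using z(3)[of k] by (simp add: comm ee)
    ultimately obtain w where w: "w \<in> C (Suc (Suc k)) (m - Suc k)" "d (Suc k) w = e (z (Suc k))"
      using exact by blast
    have "z (Suc k) \<in> C (Suc k) (m - k)" using z(2)[of "Suc k"] by simp
    then show ?case
      by (intro exI[of _ "z(Suc (Suc k) := w)"]) (use z w in \<open>auto simp: le_Suc_eq\<close>)
  qed
  then show ?thesis by blast
qed

text \<open>In terms of the total complex: once the last component of a cycle is an
  \<open>e\<close>-boundary, the cycle is corrected column by column until column zero is
  reached.\<close>

lemma zigzag_boundary:
  fixes C :: "nat \<Rightarrow> nat \<Rightarrow> 'm::ab_group_add set"
  assumes d: "\<And>a b z. z \<in> C (Suc a) b \<Longrightarrow> d a z \<in> C a b"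
    and C0: "\<And>a b. 0 \<in> C a b" and Cdiff: "\<And>a b y z. y \<in> C a b \<Longrightarrow> z \<in> C a b \<Longrightarrow> y - z \<in> C a b"
    and comm: "\<And>a z. d a (e z) = e (d a z)" and dd: "\<And>a z. d a (d (Suc a) z) = 0"
    and d0: "\<And>a. d a 0 = 0" and d_diff: "\<And>a y z. d a (y - z) = d a y - d a z" and e_diff: "\<And>y z. e (y - z) = e y - e z"
    and exact: "\<And>a b z. z \<in> C a (Suc b) \<Longrightarrow> e z = 0 \<Longrightarrow> \<exists>w\<in>C a (Suc (Suc b)). e w = z"
    and z: "\<And>a. a \<le> m \<Longrightarrow> z a \<in> C a (m - a)" and dz: "\<And>a. a < m \<Longrightarrow> d a (z (Suc a)) = e (z a)"
    and w: "w \<in> C m 1" "e w = z m"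
  shows "\<exists>u\<in>C 0 (Suc m). \<exists>v\<in>C 1 m. z 0 = e u + d 0 v"
proof -
  have "\<exists>u\<in>C (m - k) (Suc k). \<exists>v\<in>C (Suc (m - k)) k. z (m - k) = e u + d (m - k) v" if "k \<le> m" for k
    using that
  proof (induction k)
    case 0
    show ?case using w C0 by (intro bexI[of _ w] bexI[of _ 0]) (auto simp: d0)
  next
    case (Suc k)
    define a where "a = m - Suc k"
    have a: "Suc a = m - k" "a < m" "m - a = Suc k" using Suc.prems by (auto simp: a_def)
    obtain u v where uv: "u \<in> C (Suc a) (Suc k)" "v \<in> C (Suc (Suc a)) k" "z (Suc a) = e u + d (Suc a) v"
      using Suc a by auto
    \<comment> \<open>What is left of \<open>z a\<close> after subtracting \<open>d a u\<close> is
      killed by \<open>e\<close>, hence equal to some \<open>e y\<close>; the old \<open>u\<close>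
      serves as the new \<open>v\<close>.\<close>
    have "d a (z (Suc a)) = d a (e u) + d a (d (Suc a) v)"
      using d_diff[of a "z (Suc a)" "d (Suc a) v"] uv(3) by (simp add: algebra_simps)
    then have "e (z a - d a u) = 0" using dz[OF a(2)] by (simp add: dd comm e_diff)
    moreover have "z a - d a u \<in> C a (Suc k)" using z[of a] a d[OF uv(1)] by (intro Cdiff) auto
    ultimately obtain y where y: "y \<in> C a (Suc (Suc k))" "e y = z a - d a u" using exact by blast
    have "z a = e y + d a u" using y(2) by simp
    then show ?case using y(1) uv(1) unfolding a_def[symmetric] by blast
  qed
  from this[of m] show ?thesis by simp
qed

text \<open>The direction opposite to \<open>zigzag_up\<close>: it starts in the bottom row and uses
  exactness of \<open>e\<close> only. This matters because the Koszul complex on the generators of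
  \<open>I\<close> need not be exact.\<close>

lemma zigzag_down:
  fixes C :: "nat \<Rightarrow> nat \<Rightarrow> 'm::ab_group_add set"
  assumes d: "\<And>a b z. z \<in> C (Suc a) b \<Longrightarrow> d a z \<in> C a b"
    and comm: "\<And>a z. d a (e z) = e (d a z)" and dd: "\<And>a z. d a (d (Suc a) z) = 0"
    and exact: "\<And>a b z. z \<in> C a (Suc b) \<Longrightarrow> e z = 0 \<Longrightarrow> \<exists>w\<in>C a (Suc (Suc b)). e w = z"
    and z: "z \<in> C (Suc m) 0" and w: "w \<in> C m 1" "e w = d m z"
  shows "\<exists>u. u (Suc m) = z \<and> (\<forall>a\<le>Suc m. u a \<in> C a (Suc m - a)) \<and> (\<forall>a\<le>m. d a (u (Suc a)) = e (u a))"
proof -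
  have "\<exists>u. u (Suc m) = z \<and> (\<forall>a\<le>Suc m. m - k \<le> a \<longrightarrow> u a \<in> C a (Suc m - a)) \<and>
      (\<forall>a\<le>m. m - k \<le> a \<longrightarrow> d a (u (Suc a)) = e (u a))" if "k \<le> m" for k
    using that
  proof (induction k)
    case 0
    show ?case
      by (rule exI[of _ "\<lambda>a. if a = m then w else z"]) (use z w in \<open>auto simp: le_Suc_eq\<close>)
  next
    case (Suc k)
    then obtain u where u: "u (Suc m) = z" "\<And>a. a \<le> Suc m \<Longrightarrow> m - k \<le> a \<Longrightarrow> u a \<in> C a (Suc m - a)"
      "\<And>a. a \<le> m \<Longrightarrow> m - k \<le> a \<Longrightarrow> d a (u (Suc a)) = e (u a)" by auto
    define a where "a = m - Suc k"
    have a: "Suc a = m - k" "a < m" "m - a = Suc k" using Suc.prems by (auto simp: a_def)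
    have "u (Suc a) \<in> C (Suc a) (Suc k)" using u(2)[of "Suc a"] a by auto
    then have "d a (u (Suc a)) \<in> C a (Suc k)" by (rule d)
    moreover have "e (u (Suc a)) = d (Suc a) (u (Suc (Suc a)))" using u(3)[of "Suc a"] a by simp
    then have "e (d a (u (Suc a))) = 0" by (simp add: dd flip: comm)
    ultimately obtain y where y: "y \<in> C a (Suc (Suc k))" "e y = d a (u (Suc a))" using exact by blast
    have le: "m - Suc k \<le> b \<longleftrightarrow> b = a \<or> m - k \<le> b" for b using a by (auto simp: a_def)
    have aa: "Suc m - a = Suc (Suc k)" using a by auto
    show ?case
      by (rule exI[of _ "u(a := y)"]) (use u y a aa in \<open>auto simp: le\<close>)
  qed
  from this[of m] show ?thesis by auto
qed

section \<open>The Koszul complex on the forms\<close>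

lemma subseqs_sorted:
  "S \<in> set (subseqs xs) \<Longrightarrow> sorted_wrt (<) xs \<Longrightarrow> sorted_wrt (<) (S :: nat list)"
proof (induction xs arbitrary: S)
  case (Cons x xs)
  have sub: "set T \<subseteq> set xs" if "T \<in> set (subseqs xs)" for T
    using that subseqs_powset[of xs] by blast
  show ?case using Cons sub by (fastforce simp: Let_def)
qed simp

lemma koszul_basis_props:
  assumes "S \<in> set (koszul_basis N i)"
  shows "sorted_wrt (<) S" "set S \<subseteq> {..<N}" "length S = i" "distinct S" "card (set S) = i"
proof -
  have S: "S \<in> set (subseqs [0..<N])" "length S = i" using assms by (auto simp: koszul_basis_def)
  show s: "sorted_wrt (<) S" by (rule subseqs_sorted[OF S(1)]) simp
  show "set S \<subseteq> {..<N}" using S(1) subseqs_powset[of "[0..<N]"] by (auto simp: atLeast0LessThan)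
  show "length S = i" by fact
  show d: "distinct S" using s strict_sorted_iff by blast
  show "card (set S) = i" using d S(2) by (simp add: distinct_card)
qed

lemma koszul_basis_bij:
  "bij_betw (\<lambda>b. set (koszul_basis N i ! b)) {..<length (koszul_basis N i)} {T. T \<subseteq> {..<N} \<and> card T = i}"
proof -
  let ?B = "koszul_basis N i"
  have "distinct (map set (subseqs [0..<N]))" by (simp add: distinct_set_subseqs)
  then have "distinct (map set ?B)" unfolding koszul_basis_def by (rule distinct_map_filter)
  then have "bij_betw ((!) (map set ?B)) {..<length (map set ?B)} (set (map set ?B))"
    by (intro bij_betw_nth) auto
  moreover have "set (map set ?B) = {T. T \<subseteq> {..<N} \<and> card T = i}"
  proof (intro equalityI subsetI)
    fix T assume "T \<in> set (map set ?B)"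
    then show "T \<in> {T. T \<subseteq> {..<N} \<and> card T = i}" using koszul_basis_props[of _ N i] by auto
  next
    fix T assume T: "T \<in> {T. T \<subseteq> {..<N} \<and> card T = i}"
    then have "T \<in> set ` set (subseqs [0..<N])" unfolding subseqs_powset by auto
    then obtain S where S: "S \<in> set (subseqs [0..<N])" "T = set S" by auto
    have "distinct S" using subseqs_distinctD[OF S(1)] by simp
    then have "length S = i" using T S(2) by (simp add: distinct_card)
    then show "T \<in> set (map set ?B)" using S by (auto simp: koszul_basis_def)
  qed
  ultimately have "bij_betw ((!) (map set ?B)) {..<length ?B} {T. T \<subseteq> {..<N} \<and> card T = i}" by simp
  moreover have "bij_betw ((!) (map set ?B)) {..<length ?B} A \<longleftrightarrow> bij_betw (\<lambda>b. set (?B ! b)) {..<length ?B} A" for A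
    by (intro bij_betw_cong) simp
  ultimately show ?thesis by simp
qed

abbreviation kbasis :: "'a list \<Rightarrow> nat \<Rightarrow> nat list list" where
  "kbasis Fs \<equiv> koszul_basis (length Fs)"

lemma koszul_diff_dim [simp]:
  "dim_row (koszul_diff Fs i) = length (kbasis Fs i)"
  "dim_col (koszul_diff Fs i) = length (kbasis Fs (Suc i))"
  by (simp_all add: koszul_diff_def Let_def)

lemma koszul_diff_entry:
  assumes "a < length (kbasis Fs i)" "b < length (kbasis Fs (Suc i))"
  shows "koszul_diff Fs i $$ (a, b) = (let S = kbasis Fs (Suc i) ! b in
    \<Sum>r<Suc i. if kbasis Fs i ! a = take r S @ drop (Suc r) S then (-1) ^ r * Fs ! (S ! r) else 0)"
  using assms by (simp add: koszul_diff_def Let_def)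

text \<open>Up to transposition the Koszul differential is exterior multiplication by the vector of the forms.\<close>

lemma koszul_diff_eq_wedge:
  assumes a: "a < length (kbasis Fs i)" and b: "b < length (kbasis Fs (Suc i))"
  shows "koszul_diff Fs i $$ (a, b) =
    wedge ((!) Fs) (set_basis (set (kbasis Fs i ! a))) (set (kbasis Fs (Suc i) ! b))"
proof -
  define A where "A = kbasis Fs i ! a"
  define S where "S = kbasis Fs (Suc i) ! b"
  have A: "sorted_wrt (<) A" unfolding A_def by (rule koszul_basis_props[OF nth_mem[OF a]])
  have S: "sorted_wrt (<) S" "length S = Suc i" "distinct S"
    unfolding S_def by (rule koszul_basis_props[OF nth_mem[OF b]])+
  have less: "S ! r < S ! q \<longleftrightarrow> r < q" if "r < Suc i" "q < Suc i" for r q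
    using S(1,2) that by (metis linorder_neqE_nat not_less_iff_gr_or_eq sorted_wrt_nth_less)
  have "wedge ((!) Fs) (set_basis (set A)) (set S) =
      (\<Sum>r<Suc i. (-1) ^ card {j \<in> set S. j < S ! r} * (Fs ! (S ! r) * set_basis (set A) (set S - {S ! r})))"
    unfolding wedge_def
    by (rule sum.reindex_bij_betw[symmetric]) (rule bij_betw_nth, use S in auto)
  also have "\<dots> = (\<Sum>r<Suc i. if A = take r S @ drop (Suc r) S then (-1) ^ r * Fs ! (S ! r) else 0)"
  proof (intro sum.cong refl)
    fix r assume r: "r \<in> {..<Suc i}"
    have "{j \<in> set S. j < S ! r} = (!) S ` {..<r}"
      using S(2) r less by (auto simp: in_set_conv_nth) (metis less_trans)
    moreover have "inj_on ((!) S) {..<r}" using S r by (auto simp: inj_on_def nth_eq_iff_index_eq)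
    ultimately have card: "card {j \<in> set S. j < S ! r} = r" by (simp add: card_image)
    define R where "R = take r S @ drop (Suc r) S"
    have split: "S = take r S @ S ! r # drop (Suc r) S" using r S(2) by (intro id_take_nth_drop) simp
    have "sorted_wrt (<) (take r S @ S ! r # drop (Suc r) S)" "distinct (take r S @ S ! r # drop (Suc r) S)"
      using S split by metis+
    then have R: "sorted_wrt (<) R" "S ! r \<notin> set R" by (auto simp: R_def sorted_wrt_append)
    have "set S = insert (S ! r) (set R)" using arg_cong[OF split, of set] by (simp add: R_def)
    then have "set S - {S ! r} = set R" using R(2) by auto
    moreover have "set R = set A \<longleftrightarrow> A = R" using strict_sorted_equal[OF A R(1)] by auto
    ultimately show "(-1) ^ card {j \<in> set S. j < S ! r} * (Fs ! (S ! r) * set_basis (set A) (set S - {S ! r})) =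
      (if A = take r S @ drop (Suc r) S then (-1) ^ r * Fs ! (S ! r) else 0)"
      unfolding card by (simp add: set_basis_def R_def)
  qed
  finally show ?thesis unfolding koszul_diff_entry[OF a b] Let_def A_def S_def ..
qed

text \<open>Turns a product of two Koszul matrices into two successive exterior multiplications, so
  that its vanishing becomes \<open>wedge_wedge_self\<close>.\<close>

lemma wedge_expand_basis:
  assumes C: "C \<subseteq> {..<N}" "card C = Suc i"
  shows "wedge y g C = (\<Sum>b<length (koszul_basis N i).
    g (set (koszul_basis N i ! b)) * wedge y (set_basis (set (koszul_basis N i ! b))) C)"
proof -
  let ?T = "\<lambda>b. set (koszul_basis N i ! b)"
  have fin: "finite C" using C finite_subset by blast
  have g: "g (C - {x}) = (\<Sum>b<length (koszul_basis N i). g (?T b) * set_basis (?T b) (C - {x}))" if x: "x \<in> C" for x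
  proof -
    have "(\<Sum>b<length (koszul_basis N i). g (?T b) * set_basis (?T b) (C - {x})) =
        (\<Sum>T | T \<subseteq> {..<N} \<and> card T = i. g T * set_basis T (C - {x}))"
      by (rule sum.reindex_bij_betw[OF koszul_basis_bij])
    also have "\<dots> = (\<Sum>T | T \<subseteq> {..<N} \<and> card T = i. if T = C - {x} then g (C - {x}) else 0)"
      by (intro sum.cong refl) (auto simp: set_basis_def)
    also have "\<dots> = g (C - {x})"
    proof -
      have "finite {T. T \<subseteq> {..<N} \<and> card T = i}" by (rule finite_subset[of _ "Pow {..<N}"]) auto
      then show ?thesis using C x fin by (auto simp: card_Diff_singleton)
    qed
    finally show ?thesis ..
  qed
  have "wedge y g C = wedge y (\<lambda>U. \<Sum>b<length (koszul_basis N i). g (?T b) * set_basis (?T b) U) C"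
    by (intro wedge_cong) (simp add: g[symmetric])
  then show ?thesis by (simp add: wedge_sum wedge_mult)
qed

lemma koszul_diff_mult_zero:
  "mat_map (koszul_diff Fs i) (mat_map (koszul_diff Fs (Suc i)) f) = 0"
proof -
  let ?N = "length Fs"
  have "(koszul_diff Fs i * koszul_diff Fs (Suc i)) $$ (a, c) = 0"
    if a: "a < length (koszul_basis ?N i)" and c: "c < length (koszul_basis ?N (Suc (Suc i)))" for a c
  proof -
    let ?T = "\<lambda>b. set (koszul_basis ?N (Suc i) ! b)"
    let ?A = "set (koszul_basis ?N i ! a)" and ?C = "set (koszul_basis ?N (Suc (Suc i)) ! c)"
    have C: "?C \<subseteq> {..<?N}" "card ?C = Suc (Suc i)"
      by (rule koszul_basis_props[OF nth_mem[OF c]])+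
    have "(koszul_diff Fs i * koszul_diff Fs (Suc i)) $$ (a, c) =
        (\<Sum>b<length (koszul_basis ?N (Suc i)). koszul_diff Fs i $$ (a, b) * koszul_diff Fs (Suc i) $$ (b, c))"
      using a c by (simp add: scalar_prod_def atLeast0LessThan)
    also have "\<dots> = (\<Sum>b<length (koszul_basis ?N (Suc i)).
        wedge ((!) Fs) (set_basis ?A) (?T b) * wedge ((!) Fs) (set_basis (?T b)) ?C)"
      using a c by (intro sum.cong refl) (simp add: koszul_diff_eq_wedge)
    also have "\<dots> = wedge ((!) Fs) (wedge ((!) Fs) (set_basis ?A)) ?C"
      by (rule wedge_expand_basis[OF C, symmetric])
    also have "\<dots> = 0" by (rule wedge_wedge_self)
    finally show ?thesis .
  qed
  then have "mat_map (koszul_diff Fs i * koszul_diff Fs (Suc i)) f = 0"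
    by (intro mat_map_zero_mat) (simp only: index_mult_mat koszul_diff_dim)
  then show ?thesis by (simp only: mat_map_mat_map koszul_diff_dim)
qed

text \<open>An entry is a sum of signed forms, so any additive property of these passes to it. Used
  for degrees, supports, constant terms and membership in \<open>J\<close>.\<close>

lemma koszul_diff_entry_cases:
  assumes a: "a < length (kbasis Fs i)" and b: "b < length (kbasis Fs (Suc i))"
    and P0: "P 0" and Padd: "\<And>x y. P x \<Longrightarrow> P y \<Longrightarrow> P (x + y)"
    and P: "\<And>r. r < Suc i \<Longrightarrow> kbasis Fs i ! a = take r (kbasis Fs (Suc i) ! b) @
        drop (Suc r) (kbasis Fs (Suc i) ! b) \<Longrightarrow> P ((-1) ^ r * Fs ! (kbasis Fs (Suc i) ! b ! r))"
  shows "P (koszul_diff Fs i $$ (a, b))"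
proof -
  have sum: "P (\<Sum>r\<in>A. f r)" if "finite A" "\<And>r. r \<in> A \<Longrightarrow> P (f r)" for f and A :: "nat set"
    using that by (induction A) (simp_all add: P0 Padd)
  show ?thesis unfolding koszul_diff_entry[OF a b] Let_def
    by (rule sum) (simp_all add: P P0)
qed

lemma koszul_diff_graded:
  assumes Fs: "Fs \<in> form_tuples es"
  shows "graded_hom (koszul_shifts es (Suc i)) (koszul_shifts es i) (koszul_diff Fs i)"
proof -
  have len: "length Fs = length es" and F: "\<And>x. x < length es \<Longrightarrow> Fs ! x \<in> forms (int (es ! x))"
    using Fs by (auto simp: form_tuples_def)
  have "koszul_diff Fs i $$ (a, b) \<in> forms (koszul_shifts es (Suc i) ! b - koszul_shifts es i ! a)"
    if a: "a < length (kbasis Fs i)" and b: "b < length (kbasis Fs (Suc i))" for a b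
  proof (rule koszul_diff_entry_cases[OF a b])
    fix r
    let ?S = "kbasis Fs (Suc i) ! b"
    assume r: "r < Suc i" and eq: "kbasis Fs i ! a = take r ?S @ drop (Suc r) ?S"
    have S: "length ?S = Suc i" "set ?S \<subseteq> {..<length es}"
      using koszul_basis_props[OF nth_mem[OF b]] len by simp_all
    have split: "?S = take r ?S @ ?S ! r # drop (Suc r) ?S" using r S(1) by (intro id_take_nth_drop) simp
    have "koszul_shifts es (Suc i) ! b = (\<Sum>j\<leftarrow>?S. int (es ! j))"
      using b by (simp add: koszul_shifts_def len)
    also have "\<dots> = (\<Sum>j\<leftarrow>take r ?S @ ?S ! r # drop (Suc r) ?S. int (es ! j))" using split by simp
    also have "\<dots> = (\<Sum>j\<leftarrow>take r ?S @ drop (Suc r) ?S. int (es ! j)) + int (es ! (?S ! r))" by simp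
    also have "(\<Sum>j\<leftarrow>take r ?S @ drop (Suc r) ?S. int (es ! j)) = koszul_shifts es i ! a"
      unfolding eq[symmetric] using a by (simp add: koszul_shifts_def len)
    finally have "koszul_shifts es (Suc i) ! b - koszul_shifts es i ! a = int (es ! (?S ! r))" by simp
    moreover have "?S ! r \<in> set ?S" using r S(1) by simp
    then have "Fs ! (?S ! r) \<in> forms (int (es ! (?S ! r)))" using S(2) by (intro F) blast
    ultimately show "(-1) ^ r * Fs ! (?S ! r) \<in> forms (koszul_shifts es (Suc i) ! b - koszul_shifts es i ! a)"
      by (metis forms_minus_one_power)
  qed (auto intro: forms_add)
  moreover have "length (koszul_shifts es l) = length (kbasis Fs l)" for l
    by (simp add: koszul_shifts_def len)
  ultimately show ?thesis
    unfolding graded_hom_def by (intro conjI carrier_matI allI impI) (simp_all only: koszul_diff_dim)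
qed

lemma const_coeff_add: "const_coeff (f + g) = const_coeff f + const_coeff g"
  by (simp add: const_coeff_def lookup_add)

lemma const_coeff_diff: "const_coeff (f - g) = const_coeff f - const_coeff g"
  by (simp add: const_coeff_def lookup_minus)

lemma const_coeff_zero [simp]: "const_coeff 0 = 0"
  by (simp add: const_coeff_def)

lemma const_coeff_sum: "const_coeff (\<Sum>i\<in>A. f i) = (\<Sum>i\<in>A. const_coeff (f i))"
  by (simp add: const_coeff_def lookup_sum)

lemma const_coeff_mult_single:
  fixes f :: "('n, 'k::comm_ring_1) mpol"
  shows "const_coeff (f * single 0 c) = const_coeff f * c"
  using lookup_single_times[of 0 c f 0] by (simp add: const_coeff_def mult.commute)

lemma const_coeff_minus_one_power:
  "const_coeff ((-1) ^ r * f :: ('n, 'k::comm_ring_1) mpol) = (-1) ^ r * const_coeff f"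
  by (cases "even r") (simp_all add: const_coeff_def)

text \<open>In positive homological degree there is no component at the full set, so the condition
  on constant terms is vacuous.\<close>

lemma kos_exact_pos:
  fixes z :: "nat set \<Rightarrow> nat \<Rightarrow> ('n::finite, 'k::field) mpol"
  assumes z: "z \<in> hchains t sh Q (Suc b)" and k: "kos z = 0"
  shows "\<exists>w\<in>hchains t sh Q (Suc (Suc b)). kos w = z"
proof (rule kos_exact_homog[OF z])
  show "kos z S i = 0" for S i using k by simp
  show "const_coeff (z {..<CARD('n)} i) = 0" for i
    using hchains_support(2)[OF z, of "{..<CARD('n)}" i] by (cases "z {..<CARD('n)} i = 0") auto
qed

text \<open>In degree zero only the full set occurs, so being a cycle is automatic and the constant
  terms are the whole obstruction.\<close>

lemma kos_exact_zero:
  fixes z :: "nat set \<Rightarrow> nat \<Rightarrow> ('n::finite, 'k::field) mpol"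
  assumes z: "z \<in> hchains t sh Q 0" and k: "\<And>i. const_coeff (z {..<CARD('n)} i) = 0"
  shows "\<exists>w\<in>hchains t sh Q 1. kos w = z"
  unfolding One_nat_def
proof (rule kos_exact_homog[OF z _ k])
  fix S i assume S: "S \<subseteq> {..<CARD('n)}"
  have "z (S - {l}) i = 0" if l: "l \<in> S" for l
  proof (rule ccontr)
    assume nz: "z (S - {l}) i \<noteq> 0"
    have "finite S" using S finite_subset by blast
    then have "card (S - {l}) < card S" using l by (intro psubset_card_mono) auto
    also have "card S \<le> CARD('n)" using card_mono[OF _ S] by simp
    finally show False using hchains_support(2)[OF z nz] by simp
  qed
  then show "kos z S i = 0" by (simp add: kos_def wedge_def)
qed

section \<open>Ghost terms of the resolution\<close>

lemma sum_lessThan_add: "(\<Sum>i<m + n. f i) = (\<Sum>i<m. f i) + (\<Sum>i<n. f (m + i :: nat) :: 'a::comm_monoid_add)"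
  by (induction n) (simp_all add: add.assoc)

section \<open>Koszul homology of the quotient read off from a resolution\<close>

locale resolution =
  fixes I :: "('n::finite, 'k::field) mpol set" and sh :: "nat \<Rightarrow> int list" and D :: "nat \<Rightarrow> ('n, 'k) mpol mat"
  assumes res: "minimal_free_resolution I sh D"
begin

abbreviation C :: "int \<Rightarrow> nat \<Rightarrow> nat \<Rightarrow> (nat set \<Rightarrow> nat \<Rightarrow> ('n, 'k) mpol) set" where
  "C t a b \<equiv> hchains t (sh a) (\<lambda>_. True) b"

lemma sh_zero: "sh 0 = [0]"
  using res by (simp add: minimal_free_resolution_def)

lemma graded: "graded_hom (sh (Suc a)) (sh a) (D a)"
  using res by (simp add: minimal_free_resolution_def)

lemma D_dim [simp]: "dim_row (D a) = length (sh a)" "dim_col (D a) = length (sh (Suc a))"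
  using graded[of a] by (auto simp: graded_hom_def)

lemma D_chains: "z \<in> C t (Suc a) b \<Longrightarrow> mat_map (D a) z \<in> C t a b"
  by (rule mat_map_hchains[OF graded]) auto

lemma vec_mat_map: "vec (length (sh a)) (mat_map (D a) f S) = D a *\<^sub>v vec (length (sh (Suc a))) (f S)"
proof (rule eq_vecI)
  fix i assume "i < dim_vec (D a *\<^sub>v vec (length (sh (Suc a))) (f S))"
  then have i: "i < dim_row (D a)" by (simp only: dim_mult_mat_vec)
  show "vec (length (sh a)) (mat_map (D a) f S) $ i = (D a *\<^sub>v vec (length (sh (Suc a))) (f S)) $ i"
    using mat_map_eq_mult_mat_vec[OF i, of f S] i by (simp only: D_dim index_vec)
qed (simp only: dim_mult_mat_vec dim_vec D_dim)

lemma vec_mat_map_in_image: "vec (length (sh a)) (mat_map (D a) f S) \<in> mat_image (D a)"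
  unfolding vec_mat_map mat_image_def D_dim by (rule imageI, rule vec_carrier)

lemma kernel_iff: "vec (length (sh (Suc a))) (f S) \<in> mat_kernel (D a) \<longleftrightarrow> (\<forall>i. mat_map (D a) f S i = 0)"
proof -
  have "vec (length (sh (Suc a))) (f S) \<in> mat_kernel (D a) \<longleftrightarrow> vec (length (sh a)) (mat_map (D a) f S) = 0\<^sub>v (length (sh a))"
    unfolding mat_kernel_def vec_mat_map by (simp only: D_dim mem_Collect_eq vec_carrier simp_thms)
  also have "\<dots> \<longleftrightarrow> (\<forall>i<length (sh a). mat_map (D a) f S i = 0)"
    by (auto simp: vec_eq_iff)
  also have "\<dots> \<longleftrightarrow> (\<forall>i. mat_map (D a) f S i = 0)"
    by (auto simp: mat_map_def)
  finally show ?thesis .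
qed

lemma kernel_eq_image: "mat_kernel (D a) = mat_image (D (Suc a))"
  using res by (simp add: minimal_free_resolution_def)

lemma D_D: "mat_map (D a) (mat_map (D (Suc a)) f) = 0"
proof (intro ext)
  fix S i
  have "vec (length (sh (Suc a))) (mat_map (D (Suc a)) f S) \<in> mat_kernel (D a)"
    unfolding kernel_eq_image by (rule vec_mat_map_in_image)
  then show "mat_map (D a) (mat_map (D (Suc a)) f) S i = 0 S i"
    unfolding kernel_iff by simp
qed

lemma D_exact:
  assumes z: "z \<in> C t (Suc a) b" and "mat_map (D a) z = 0"
  shows "\<exists>w\<in>C t (Suc (Suc a)) b. mat_map (D (Suc a)) w = z"
proof (rule mat_map_lift[OF graded z])
  fix S show "vec (length (sh (Suc a))) (z S) \<in> mat_image (D (Suc a))"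
    unfolding kernel_eq_image[symmetric] kernel_iff using assms by simp
qed

lemma image_zero: "mat_image (D 0) = {vec 1 (\<lambda>_. f) | f. f \<in> I}"
  using res by (simp add: minimal_free_resolution_def)

lemma D_zero_exact:
  assumes z: "z \<in> C t 0 b" and I: "\<And>S. z S 0 \<in> I"
  shows "\<exists>w\<in>C t 1 b. mat_map (D 0) w = z"
  unfolding One_nat_def
proof (rule mat_map_lift[OF graded z])
  fix S
  have "vec (length (sh 0)) (z S) = vec 1 (\<lambda>_. z S 0)" by (rule eq_vecI) (auto simp: sh_zero)
  then show "vec (length (sh 0)) (z S) \<in> mat_image (D 0)" unfolding image_zero using I by blast
qed

lemma D_zero_in_I: "mat_map (D 0) w S 0 \<in> I"
proof -
  obtain f where "f \<in> I" "vec (length (sh 0)) (mat_map (D 0) w S) = vec 1 (\<lambda>_. f)"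
    using vec_mat_map_in_image[of 0 w S] unfolding image_zero by blast
  then have "vec (length (sh 0)) (mat_map (D 0) w S) $ 0 = f" by simp
  then show ?thesis using \<open>f \<in> I\<close> by (simp add: sh_zero)
qed

text \<open>In homological degree zero a component has degree \<open>t - sh a ! i\<close>, so a
  nonzero constant term exhibits a copy of \<open>R(-t)\<close>.\<close>

lemma chains_const_coeff:
  assumes z: "z \<in> C t a 0" and "z S i \<noteq> 0" "sh a ! i \<noteq> t"
  shows "const_coeff (z S i) = 0"
  using hchains_forms[OF z, of S i] assms by (intro forms_const_coeff) auto

text \<open>
  A cycle of the Koszul complex of \<open>R/I\<close> on the variables gives a class in
  \<open>Tor\<close>, computed by the resolution as the residue of \<open>z (Suc m)\<close>;
  if that residue vanishes then the cycle is a boundary.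
\<close>

lemma lift_cycle:
  assumes z0: "z0 \<in> C t 0 (Suc m)" and I: "\<And>S. kos z0 S 0 \<in> I"
  shows "\<exists>z. z 0 = z0 \<and> (\<forall>a\<le>Suc m. z a \<in> C t a (Suc m - a)) \<and> (\<forall>a\<le>m. mat_map (D a) (z (Suc a)) = kos (z a))"
proof -
  obtain z1 where z1: "z1 \<in> C t 1 m" "mat_map (D 0) z1 = kos z0"
    using D_zero_exact[OF kos_hchains[OF z0] I] by blast
  show ?thesis
    by (rule zigzag_up[where C = "C t" and d = "\<lambda>a. mat_map (D a)" and e = kos, OF _ _ _ _ _ z0 z1])
      (auto intro: D_chains kos_hchains D_exact simp: kos_mat_map kos_kos)
qed

text \<open>The image of \<open>D 0\<close> is \<open>I\<close>, so the conclusion says that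
  \<open>z 0\<close> is a Koszul boundary modulo \<open>I\<close>. A vanishing residue makes the
  last component a boundary, and the zigzag carries this back to column zero.\<close>

lemma residue_zero_imp_boundary:
  assumes z: "\<And>a. a \<le> m \<Longrightarrow> z a \<in> C t a (m - a)"
    and dz: "\<And>a. a < m \<Longrightarrow> mat_map (D a) (z (Suc a)) = kos (z a)"
    and r: "\<And>i. const_coeff (z m {..<CARD('n)} i) = 0"
  shows "\<exists>u\<in>C t 0 (Suc m). \<exists>v\<in>C t 1 m. z 0 = kos u + mat_map (D 0) v"
proof -
  have "z m \<in> C t m 0" using z[of m] by simp
  then obtain w where w: "w \<in> C t m 1" "kos w = z m" using kos_exact_zero[of "z m" t "sh m" "\<lambda>_. True"] r by blast
  show ?thesis
    by (rule zigzag_boundary[where C = "C t" and d = "\<lambda>a. mat_map (D a)" and e = kos, OF _ _ _ _ _ _ _ _ _ z dz w])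
      (auto intro: D_chains hchains_zero hchains_diff kos_exact_pos
        simp: kos_mat_map D_D mat_map_diff kos_diff)
qed

end

text \<open>Isolates what the ghost terms need of the forms: duality of \<open>R/J\<close> between
  degrees 0 and \<open>c + 1\<close>, 1 and \<open>c\<close>, and in part 2 and
  \<open>c - 1\<close>, where only symmetric matrices of rank at most one are prescribed.
  \<open>phi_wedges\<close> says that a minor is nonzero, namely that of the vectors
  \<open>v l\<close> in the first \<open>p\<close> coordinates.\<close>

locale general_ideal =
  fixes Fs :: "('n::finite, 'k::field) mpol list" and ds :: "nat list" and c p :: nat
    and \<phi> :: "('n, 'k) mpol \<Rightarrow> 'k"
  assumes len_ds: "length ds = CARD('n)" and ds_ge: "\<And>i. i < CARD('n) \<Longrightarrow> 3 \<le> ds ! i"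
    and c_ge: "3 \<le> c" and p_ge: "1 \<le> p" and p_le: "p + 2 \<le> CARD('n)"
    and Fs: "Fs \<in> form_tuples (ds @ replicate p c)"
    and phi_add: "\<And>f g. \<phi> (f + g) = \<phi> f + \<phi> g"
    and phi_scale: "\<And>a f. \<phi> (single 0 a * f) = a * \<phi> f"
    and phi_ideal: "\<And>f. f \<in> ideal_of (set (take CARD('n) Fs)) \<Longrightarrow> f \<in> forms (int c + 1) \<Longrightarrow> \<phi> f = 0"
    and phi_socle: "\<And>f. f \<in> forms (int c + 1) \<Longrightarrow> \<phi> f = 0 \<Longrightarrow> f \<in> ideal_of (set (take CARD('n) Fs))"
    and phi_nondegenerate: "\<And>h. h \<in> forms (int c) \<Longrightarrow> (\<And>i. i < CARD('n) \<Longrightarrow> \<phi> (X i * h) = 0) \<Longrightarrow>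
      h \<in> ideal_of (set (take CARD('n) Fs))"
    and phi_linear_surj: "\<And>w. \<exists>h\<in>forms (int c). \<forall>i<CARD('n). \<phi> (X i * h) = w i"
    and phi_quadratic_surj: "\<And>w. \<exists>g\<in>forms (int c - 1). \<forall>a<CARD('n). \<forall>b<CARD('n). \<phi> (X a * (X b * g)) = w a * w b"
    and phi_wedges: "wedges (map (\<lambda>l i. \<phi> (X i * Fs ! (CARD('n) + l))) [0..<p]) (set_basis {p..<CARD('n)}) {..<CARD('n)} \<noteq> 0"
begin

abbreviation J where "J \<equiv> ideal_of (set (take CARD('n) Fs))"
abbreviation I where "I \<equiv> ideal_of (set Fs)"

definition v :: "nat \<Rightarrow> nat \<Rightarrow> 'k" where "v l i = \<phi> (X i * Fs ! (CARD('n) + l))"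

lemma phi_zero [simp]: "\<phi> 0 = 0"
  using phi_scale[of 0 0] by simp

lemma phi_uminus: "\<phi> (- f) = - \<phi> f"
  using phi_add[of f "- f"] by (simp add: eq_neg_iff_add_eq_0 add.commute)

lemma phi_diff: "\<phi> (f - g) = \<phi> f - \<phi> g"
  using phi_add[of f "- g"] by (simp add: phi_uminus)

lemma phi_sum: "\<phi> (\<Sum>i\<in>A. f i) = (\<Sum>i\<in>A. \<phi> (f i))"
  by (induction A rule: infinite_finite_induct) (auto simp: phi_add)

lemma phi_minus_one_power: "\<phi> ((-1) ^ k * f) = (-1) ^ k * \<phi> f"
  by (cases "even k") (auto simp: phi_uminus)

lemma phi_wedge: "\<phi> (wedge X f S) = (\<Sum>i\<in>S. (-1) ^ card {j\<in>S. j < i} * \<phi> (X i * f (S - {i})))"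
  by (simp add: wedge_def phi_sum phi_minus_one_power)

lemma len_Fs: "length Fs = CARD('n) + p"
  using Fs len_ds by (simp add: form_tuples_def)

lemma F_forms: "i < CARD('n) \<Longrightarrow> Fs ! i \<in> forms (int (ds ! i))"
proof -
  assume i: "i < CARD('n)"
  then have "Fs ! i \<in> forms (int ((ds @ replicate p c) ! i))" using Fs len_ds by (simp add: form_tuples_def)
  then show ?thesis using i len_ds by (simp add: nth_append)
qed

lemma G_forms: "l < p \<Longrightarrow> Fs ! (CARD('n) + l) \<in> forms (int c)"
proof -
  assume l: "l < p"
  then have "Fs ! (CARD('n) + l) \<in> forms (int ((ds @ replicate p c) ! (CARD('n) + l)))"
    using Fs len_ds by (simp add: form_tuples_def)
  then show ?thesis using l len_ds by (simp add: nth_append)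
qed

lemma F_in_J: "i < CARD('n) \<Longrightarrow> Fs ! i \<in> J"
  using len_Fs by (intro ideal_of_base) (auto simp: set_conv_nth intro!: exI[of _ i])

lemma G_in_I: "l < p \<Longrightarrow> Fs ! (CARD('n) + l) \<in> I"
  using len_Fs by (intro ideal_of_base nth_mem) simp

lemma J_subset_I: "f \<in> J \<Longrightarrow> f \<in> I"
  by (rule ideal_of_mono[OF set_take_subset])

text \<open>The coefficients of the extra forms have degree \<open>e - c\<close>: they vanish below
  degree \<open>c\<close> and are constants in degree \<open>c\<close>.\<close>

lemma I_homogeneous_expand:
  assumes f: "f \<in> I" "f \<in> forms e"
  shows "\<exists>q\<in>J. \<exists>r. f = q + (\<Sum>l<p. hpart (e - int c) (r l) * Fs ! (CARD('n) + l))"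
proof -
  have "set Fs = (!) Fs ` {..<CARD('n) + p}" using len_Fs by (auto simp: set_conv_nth)
  then obtain r where r: "f = (\<Sum>i<CARD('n) + p. r i * Fs ! i)" using f(1) ideal_of_image by metis
  have "f = hpart e f" using f(2) by (simp add: hpart_forms)
  also have "\<dots> = (\<Sum>i<CARD('n) + p. hpart e (r i * Fs ! i))" unfolding r hpart_sum ..
  also have "\<dots> = (\<Sum>i<CARD('n). hpart e (r i * Fs ! i)) + (\<Sum>l<p. hpart e (r (CARD('n) + l) * Fs ! (CARD('n) + l)))"
    by (rule sum_lessThan_add)
  also have "(\<Sum>l<p. hpart e (r (CARD('n) + l) * Fs ! (CARD('n) + l))) =
      (\<Sum>l<p. hpart (e - int c) (r (CARD('n) + l)) * Fs ! (CARD('n) + l))"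
  proof (intro sum.cong refl)
    fix l assume "l \<in> {..<p}"
    then show "hpart e (r (CARD('n) + l) * Fs ! (CARD('n) + l)) = hpart (e - int c) (r (CARD('n) + l)) * Fs ! (CARD('n) + l)"
      using hpart_mult[OF G_forms, of l e "r (CARD('n) + l)"] by (simp add: mult.commute)
  qed
  finally have "f = (\<Sum>i<CARD('n). hpart e (r i * Fs ! i)) +
      (\<Sum>l<p. hpart (e - int c) (r (CARD('n) + l)) * Fs ! (CARD('n) + l))" .
  moreover have "hpart e (r i * Fs ! i) \<in> J" if "i < CARD('n)" for i
    using hpart_mult[OF F_forms[OF that], of e "r i"] F_in_J[OF that] by (simp add: mult.commute ideal_of_mult_right)
  then have "(\<Sum>i<CARD('n). hpart e (r i * Fs ! i)) \<in> J" by (intro ideal_of_sum) simp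
  ultimately show ?thesis by (intro bexI[where x = "\<Sum>i<CARD('n). hpart e (r i * Fs ! i)"] exI[of _ "\<lambda>l. r (CARD('n) + l)"])
qed

lemma I_below_c: "f \<in> I \<Longrightarrow> f \<in> forms e \<Longrightarrow> e < int c \<Longrightarrow> f \<in> J"
proof -
  assume f: "f \<in> I" "f \<in> forms e" "e < int c"
  obtain q r where q: "q \<in> J" "f = q + (\<Sum>l<p. hpart (e - int c) (r l) * Fs ! (CARD('n) + l))"
    using I_homogeneous_expand[OF f(1,2)] by blast
  have "hpart (e - int c) (r l) = 0" for l using f(3) by (intro forms_neg[OF _ hpart_in_forms]) simp
  then show "f \<in> J" using q by simp
qed

lemma I_degree_c:
  assumes "f \<in> I" "f \<in> forms (int c)"
  shows "\<exists>\<kappa>. f - (\<Sum>l<p. single 0 (\<kappa> l) * Fs ! (CARD('n) + l)) \<in> J"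
proof -
  obtain q r where q: "q \<in> J" "f = q + (\<Sum>l<p. hpart (int c - int c) (r l) * Fs ! (CARD('n) + l))"
    using I_homogeneous_expand[OF assms] by blast
  have "hpart (int c - int c) (r l) = single 0 (const_coeff (hpart 0 (r l)))" for l
    using forms_degree_zero[OF hpart_in_forms[of 0 "r l"]] by simp
  then have "f - (\<Sum>l<p. single 0 (const_coeff (hpart 0 (r l))) * Fs ! (CARD('n) + l)) = q"
    using q(2) by simp
  then show ?thesis using q(1) by (intro exI[of _ "\<lambda>l. const_coeff (hpart 0 (r l))"]) simp
qed

lemma X_mult_J: "f \<in> J \<Longrightarrow> f \<in> forms (int c) \<Longrightarrow> \<phi> (X i * f) = 0"
  using forms_mult[OF X_in_forms, of f "int c" i] by (intro phi_ideal ideal_of_mult_left) (simp_all add: add.commute)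

lemma phi_wedges_v: "wedges (map v [0..<p]) (set_basis {p..<CARD('n)}) {..<CARD('n)} \<noteq> 0"
  using phi_wedges unfolding v_def[abs_def] by simp

lemma v_zero_nonzero: "\<exists>i<CARD('n). v 0 i \<noteq> 0"
proof (rule ccontr)
  assume a: "\<not> ?thesis"
  have "[0..<p] = 0 # [1..<p]" using p_ge by (simp add: upt_conv_Cons)
  then have "wedges (map v [0..<p]) (set_basis {p..<CARD('n)}) {..<CARD('n)} =
      wedge (v 0) (wedges (map v [1..<p]) (set_basis {p..<CARD('n)})) {..<CARD('n)}" by simp
  also have "\<dots> = 0" using a by (simp add: wedge_def)
  finally show False using phi_wedges_v by simp
qed

text \<open>Modulo \<open>J\<close> a form of this degree is determined by \<open>\<phi>\<close>, so
  a single product of a variable with the first extra form that \<open>\<phi>\<close> does not kill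
  accounts for all of them.\<close>

lemma socle_degree_in_I:
  assumes f: "f \<in> forms (int c + 1)"
  shows "f \<in> I"
proof -
  obtain i where i: "i < CARD('n)" "v 0 i \<noteq> 0" using v_zero_nonzero by blast
  define h where "h = single 0 (\<phi> f / v 0 i) * (X i * Fs ! CARD('n))"
  have G: "Fs ! CARD('n) \<in> forms (int c)" "Fs ! CARD('n) \<in> I" using G_forms[of 0] G_in_I[of 0] p_ge by auto
  have "h \<in> I" unfolding h_def by (intro ideal_of_mult_left G)
  have "h \<in> forms (0 + (1 + int c))" unfolding h_def by (intro forms_mult forms_const X_in_forms G)
  then have "f - h \<in> forms (int c + 1)" using f by (simp add: forms_diff add.commute)
  moreover have "\<phi> (f - h) = 0" using i(2) by (simp add: phi_diff h_def phi_scale v_def)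
  ultimately have "f - h \<in> J" by (rule phi_socle)
  then have "(f - h) + h \<in> I" using \<open>h \<in> I\<close> J_subset_I by (simp only: ideal_of_add)
  then show ?thesis by simp
qed

lemma const_coeff_F:
  assumes "x < length Fs"
  shows "const_coeff (Fs ! x) = 0"
proof (cases "x < CARD('n)")
  case True
  then show ?thesis using forms_const_coeff[OF F_forms[OF True]] ds_ge[OF True] by simp
next
  case False
  then obtain l where "x = CARD('n) + l" "l < p" using assms len_Fs by (metis le_add_diff_inverse nat_add_left_cancel_less not_less)
  then show ?thesis using forms_const_coeff[OF G_forms] c_ge by simp
qed

end

section \<open>The two copies of the shift and the test against Koszul syzygies\<close>

locale general_resolution = general_ideal Fs ds c p \<phi> + resolution "ideal_of (set Fs)" sh D
  for Fs :: "('n::finite, 'k::field) mpol list" and ds c p \<phi> sh D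
begin

text \<open>If the shift were missing, \<open>h\<close> times the basis element of the indices from
  \<open>j\<close> on would be a boundary modulo \<open>I\<close>. Under \<open>\<phi>\<close> its
  Koszul boundary becomes the basis element of the indices from \<open>j - 1\<close> on, which would
  then be a sum of exterior multiples of the \<open>v l\<close>; wedging with all of these
  contradicts \<open>phi_wedges\<close>.\<close>

lemma shift_in_lower:
  assumes j: "p + 1 \<le> j" "j \<le> CARD('n) - 1"
  shows "int (c + j) \<in> set (sh j)"
proof (rule ccontr)
  assume notin: "int (c + j) \<notin> set (sh j)"
  define t where "t = int (c + j)"
  obtain m where m: "j = Suc m" using j by (cases j) auto
  have jn: "j < CARD('n)" using j p_le by simp
  obtain h where h: "h \<in> forms (int c)" "\<And>i. i < CARD('n) \<Longrightarrow> \<phi> (X i * h) = unit_at m i"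
    using phi_linear_surj[of "unit_at m"] by blast
  have Xh: "\<phi> (X i * h) = unit_at m i" for i
    using h(2)[of i] jn m by (cases "i < CARD('n)") (auto simp: X_def unit_at_def)
  \<comment> \<open>The set has \<open>n - j\<close> elements, hence homological degree
    \<open>j\<close>, and it starts just after the index \<open>m\<close> that \<open>h\<close>
    singles out.\<close>
  define z0 where "z0 S i = (if S = {j..<CARD('n)} \<and> i = 0 then h else 0)" for S and i :: nat
  have z0: "z0 \<in> C t 0 (Suc m)"
    using h(1) jn by (auto simp: hchains_def z0_def sh_zero t_def m)
  have I: "kos z0 S 0 \<in> I" for S
    using hchains_forms[OF kos_hchains[OF z0], of S 0]
    by (intro socle_degree_in_I) (simp add: sh_zero t_def m add.commute)
  obtain z where z: "z 0 = z0" "\<And>a. a \<le> Suc m \<Longrightarrow> z a \<in> C t a (Suc m - a)"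
    "\<And>a. a \<le> m \<Longrightarrow> mat_map (D a) (z (Suc a)) = kos (z a)"
    using lift_cycle[OF z0 I] by blast
  have zS: "z (Suc m) \<in> C t (Suc m) 0" using z(2)[of "Suc m"] by simp
  have "const_coeff (z (Suc m) {..<CARD('n)} i) = 0" for i
  proof (cases "z (Suc m) {..<CARD('n)} i = 0")
    case False
    have "i < length (sh (Suc m))" by (rule hchains_support(3)[OF zS False])
    then have "sh (Suc m) ! i \<noteq> t" using notin m t_def nth_mem by metis
    then show ?thesis by (rule chains_const_coeff[OF zS False])
  qed simp
  then obtain u w where uw: "u \<in> C t 0 (Suc (Suc m))" "w \<in> C t 1 (Suc m)" "z0 = kos u + mat_map (D 0) w"
    using residue_zero_imp_boundary[of "Suc m" z t] z by auto
  define q where "q S = mat_map (D 0) w S 0" for S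
  have q: "q S \<in> I" "q S \<in> forms (int c)" for S
  proof -
    show "q S \<in> I" unfolding q_def by (rule D_zero_in_I)
    have "mat_map (D 0) w \<in> C t 0 (Suc m)" using uw(2) by (intro D_chains) simp
    from hchains_forms[OF this, of S 0] show "q S \<in> forms (int c)"
      by (simp add: q_def sh_zero t_def m)
  qed
  define \<kappa> where "\<kappa> S = (SOME k. q S - (\<Sum>l<p. single 0 (k l) * Fs ! (CARD('n) + l)) \<in> J)" for S
  have \<kappa>: "q S - (\<Sum>l<p. single 0 (\<kappa> S l) * Fs ! (CARD('n) + l)) \<in> J" for S
    unfolding \<kappa>_def by (rule someI_ex[OF I_degree_c[OF q]])
  have Xq: "\<phi> (X i * q S) = (\<Sum>l<p. v l i * \<kappa> S l)" for i S
  proof -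
    define g where "g = (\<Sum>l<p. single 0 (\<kappa> S l) * Fs ! (CARD('n) + l))"
    have "single 0 (\<kappa> S l) * Fs ! (CARD('n) + l) \<in> forms (0 + int c)" if "l < p" for l
      by (intro forms_mult forms_const G_forms that)
    then have "g \<in> forms (int c)" unfolding g_def by (intro forms_sum) simp
    then have "\<phi> (X i * (q S - g)) = 0" using \<kappa>[of S] q(2)[of S] by (intro X_mult_J forms_diff) (auto simp: g_def)
    then have "\<phi> (X i * q S) = \<phi> (X i * g)" by (simp add: right_diff_distrib phi_diff)
    also have "\<dots> = (\<Sum>l<p. \<phi> (single 0 (\<kappa> S l) * (X i * Fs ! (CARD('n) + l))))"
      by (simp add: g_def sum_distrib_left phi_sum mult.left_commute)
    also have "\<dots> = (\<Sum>l<p. v l i * \<kappa> S l)" by (simp only: phi_scale v_def mult.commute)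
    finally show ?thesis .
  qed
  \<comment> \<open>Under \<open>\<phi>\<close> the boundary of \<open>u\<close> vanishes, and of
    \<open>q\<close> only the constant multiples of the extra forms survive.\<close>
  have "\<phi> (wedge X (\<lambda>S. z0 S 0) S) = (\<Sum>l<p. wedge (v l) (\<lambda>T. \<kappa> T l) S)" for S
  proof -
    have "wedge X (\<lambda>S. z0 S 0) S = wedge X (\<lambda>S. kos u S 0) S + wedge X q S"
      unfolding uw(3) q_def by (simp add: wedge_add)
    moreover have "wedge X (\<lambda>S. kos u S 0) S = 0" unfolding kos_def by (rule wedge_wedge_self)
    ultimately have "\<phi> (wedge X (\<lambda>S. z0 S 0) S) = (\<Sum>i\<in>S. (-1) ^ card {j\<in>S. j < i} * (\<Sum>l<p. v l i * \<kappa> (S - {i}) l))"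
      by (simp add: phi_wedge Xq)
    also have "\<dots> = (\<Sum>l<p. wedge (v l) (\<lambda>T. \<kappa> T l) S)"
      unfolding wedge_def sum_distrib_left by (rule sum.swap)
    finally show ?thesis .
  qed
  moreover have "\<phi> (wedge X (\<lambda>S. z0 S 0) S) = set_basis {m..<CARD('n)} S" for S
  proof -
    have "\<phi> (wedge X (\<lambda>S. z0 S 0) S) = wedge (unit_at m) (set_basis {Suc m..<CARD('n)}) S"
      unfolding phi_wedge unfolding wedge_def by (intro sum.cong refl) (simp add: z0_def m set_basis_def Xh)
    then show ?thesis using jn m by (simp add: wedge_unit_at)
  qed
  ultimately have eq: "set_basis {m..<CARD('n)} = (\<lambda>S. \<Sum>l<p. wedge (v l) (\<lambda>T. \<kappa> T l) S)" by auto
  \<comment> \<open>The unit vectors fill the gap between the \<open>p\<close> extra vectors and the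
    interval starting at \<open>m\<close>; this needs \<open>p \<le> m\<close>.\<close>
  define vs where "vs = map v [0..<p] @ map unit_at [p..<m]"
  have "wedges vs (\<lambda>S. \<Sum>l<p. wedge (v l) (\<lambda>T. \<kappa> T l) S) {..<CARD('n)} = 0"
    unfolding wedges_sum
  proof (rule sum.neutral, rule ballI)
    fix l assume "l \<in> {..<p}"
    then show "wedges vs (wedge (v l) (\<lambda>T. \<kappa> T l)) {..<CARD('n)} = 0"
      by (intro wedges_wedge_eq_zero) (auto simp: vs_def)
  qed
  moreover have "wedges vs (set_basis {m..<CARD('n)}) = wedges (map v [0..<p]) (set_basis {p..<CARD('n)})"
  proof -
    have "wedges (map unit_at [p..<m]) (set_basis {m..<CARD('n)}) = (set_basis {p..<CARD('n)} :: nat set \<Rightarrow> 'k)"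
      using wedges_unit_at[of p "m - p" "CARD('n)"] j jn m by simp
    then show ?thesis unfolding vs_def wedges_append by simp
  qed
  ultimately show False using phi_wedges_v eq by simp
qed

text \<open>Taking \<open>y = 0\<close> gives the shift, and \<open>y\<close> coming from a Koszul
  syzygy shows that the class is not Koszul. If the residues agreed, \<open>z 0 - y 0\<close> would
  be a boundary up to elements of \<open>I\<close> of degree \<open>c - 1\<close>, which lie in
  \<open>J\<close>. Then the Koszul boundary of \<open>z 0\<close> would lie in \<open>J\<close>;
  but \<open>X i0\<close> times one of its coefficients has, up to sign, the square of
  \<open>v 0 i0\<close> as its value under \<open>\<phi>\<close>.\<close>

lemma obstruction:
  assumes j: "j < CARD('n)"
  defines "t \<equiv> int (c + j)"
  shows "\<exists>z. (\<forall>a\<le>Suc j. z a \<in> C t a (Suc j - a)) \<and>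
    (\<forall>y. (\<forall>a\<le>Suc j. y a \<in> C t a (Suc j - a)) \<longrightarrow> (\<forall>a\<le>j. mat_map (D a) (y (Suc a)) = kos (y a)) \<longrightarrow>
      (\<forall>S. kos (y 0) S 0 \<in> J) \<longrightarrow>
      (\<exists>i. const_coeff (z (Suc j) {..<CARD('n)} i - y (Suc j) {..<CARD('n)} i) \<noteq> 0))"
proof -
  obtain i0 where i0: "i0 < CARD('n)" "v 0 i0 \<noteq> 0" using v_zero_nonzero by blast
  obtain g where g: "g \<in> forms (int c - 1)"
    "\<And>a b. a < CARD('n) \<Longrightarrow> b < CARD('n) \<Longrightarrow> \<phi> (X a * (X b * g)) = v 0 a * v 0 b"
    using phi_quadratic_surj[of "v 0"] by blast
  \<comment> \<open>Leaving \<open>i0\<close> out of \<open>S0\<close> makes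
    \<open>X i0 * g\<close>, up to sign, a coefficient of the Koszul boundary.\<close>
  have "CARD('n) - Suc j \<le> card ({..<CARD('n)} - {i0})" using i0(1) by simp
  then obtain S0 where S0: "S0 \<subseteq> {..<CARD('n)} - {i0}" "card S0 = CARD('n) - Suc j" "finite S0"
    by (rule obtain_subset_with_card_n)
  have i0S: "i0 \<notin> S0" using S0(1) by auto
  define z0 where "z0 S i = (if S = S0 \<and> i = 0 then g else 0)" for S and i :: nat
  have z0: "z0 \<in> C t 0 (Suc j)"
    using g(1) j S0 by (auto simp: hchains_def z0_def sh_zero t_def)
  have G: "Fs ! CARD('n) \<in> forms (int c)" "Fs ! CARD('n) \<in> I" using G_forms[of 0] G_in_I[of 0] p_ge by auto
  have Xg: "X i * g \<in> forms (int c)" for i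
    using forms_mult[OF X_in_forms g(1), of i] by simp
  \<comment> \<open>\<open>X i * g\<close> and \<open>v 0 i\<close> times the first extra form have
    the same products with the variables under \<open>\<phi>\<close>, so they agree modulo
    \<open>J\<close>.\<close>
  have Xg_I: "X i * g \<in> I" for i
  proof (cases "i < CARD('n)")
    case True
    define h where "h = single 0 (v 0 i) * Fs ! CARD('n)"
    have "h \<in> forms (0 + int c)" unfolding h_def by (intro forms_mult forms_const G)
    then have "X i * g - h \<in> forms (int c)" using Xg by (simp add: forms_diff)
    moreover have "\<phi> (X b * (X i * g - h)) = 0" if "b < CARD('n)" for b
    proof -
      have "\<phi> (X b * h) = v 0 i * v 0 b"
        unfolding h_def mult.left_commute[of "X b"] phi_scale by (simp add: v_def)
      then show ?thesis using g(2)[OF that True] by (simp add: right_diff_distrib phi_diff)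
    qed
    ultimately have "X i * g - h \<in> J" by (rule phi_nondegenerate)
    then have "X i * g - h \<in> I" by (rule J_subset_I)
    moreover have "h \<in> I" unfolding h_def by (intro ideal_of_mult_left G)
    ultimately have "(X i * g - h) + h \<in> I" by (rule ideal_of_add)
    then show ?thesis by simp
  qed (simp add: X_def)
  have Xz0_I: "X i * z0 S 0 \<in> I" for i S
    using Xg_I[of i] by (cases "S = S0") (simp_all add: z0_def)
  have "kos z0 S 0 \<in> I" for S
    unfolding kos_def wedge_def
    by (rule ideal_of_sum, rule ideal_of_mult_left, rule Xz0_I)
  then obtain z where z: "z 0 = z0" "\<And>a. a \<le> Suc j \<Longrightarrow> z a \<in> C t a (Suc j - a)"
    "\<And>a. a \<le> j \<Longrightarrow> mat_map (D a) (z (Suc a)) = kos (z a)"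
    using lift_cycle[OF z0] by blast
  have "\<exists>i. const_coeff (z (Suc j) {..<CARD('n)} i - y (Suc j) {..<CARD('n)} i) \<noteq> 0"
    if y: "\<forall>a\<le>Suc j. y a \<in> C t a (Suc j - a)" "\<forall>a\<le>j. mat_map (D a) (y (Suc a)) = kos (y a)"
      and yJ: "\<forall>S. kos (y 0) S 0 \<in> J" for y
  proof (rule ccontr)
    assume neg: "\<not> ?thesis"
    have "\<exists>u\<in>C t 0 (Suc (Suc j)). \<exists>w\<in>C t 1 (Suc j). z 0 - y 0 = kos u + mat_map (D 0) w"
    proof (rule residue_zero_imp_boundary[of "Suc j" "\<lambda>a. z a - y a"])
      show "z a - y a \<in> C t a (Suc j - a)" if "a \<le> Suc j" for a
        using z(2)[OF that] y(1) that by (intro hchains_diff) auto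
      show "mat_map (D a) (z (Suc a) - y (Suc a)) = kos (z a - y a)" if "a < Suc j" for a
        using z(3)[of a] y(2) that by (simp add: mat_map_diff kos_diff)
      show "const_coeff ((z (Suc j) - y (Suc j)) {..<CARD('n)} i) = 0" for i
        using neg by simp
    qed
    then obtain u w where uw: "u \<in> C t 0 (Suc (Suc j))" "w \<in> C t 1 (Suc j)" "z 0 - y 0 = kos u + mat_map (D 0) w"
      by blast
    define q where "q = mat_map (D 0) w"
    have q: "q \<in> C t 0 (Suc j)" unfolding q_def using uw(2) by (intro D_chains) simp
    \<comment> \<open>Total degree \<open>c + j\<close> minus homological degree
      \<open>j + 1\<close> leaves \<open>c - 1\<close>, below the degree of the extra forms.\<close>
    have qJ: "q S 0 \<in> J" for S
    proof (rule I_below_c)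
      show "q S 0 \<in> I" unfolding q_def by (rule D_zero_in_I)
      show "q S 0 \<in> forms (int c - 1)" using hchains_forms[OF q, of S 0] by (simp add: sh_zero t_def)
    qed simp
    have "kos z0 = kos (y 0) + kos q"
    proof -
      have "kos (z 0 - y 0 - q) = 0" unfolding uw(3) q_def by (simp add: kos_kos)
      then have "kos z0 - kos (y 0) - kos q = 0" by (simp only: kos_diff z(1))
      then show ?thesis by (simp add: algebra_simps)
    qed
    then have "kos z0 S 0 = kos (y 0) S 0 + kos q S 0" for S by simp
    moreover have "kos q S 0 \<in> J" for S
      unfolding kos_def wedge_def by (intro ideal_of_sum ideal_of_mult_left qJ)
    ultimately have kJ: "kos z0 S 0 \<in> J" for S using yJ by (simp add: ideal_of_add)
    define S1 where "S1 = insert i0 S0"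
    have "kos z0 S1 0 = (\<Sum>i\<in>S1. if i = i0 then (-1) ^ card {j\<in>S1. j < i0} * (X i0 * g) else 0)"
      unfolding kos_def wedge_def
    proof (intro sum.cong refl)
      fix i assume "i \<in> S1"
      then have "S1 - {i} = S0 \<longleftrightarrow> i = i0" using i0S by (auto simp: S1_def)
      then show "(-1) ^ card {j\<in>S1. j < i} * (X i * z0 (S1 - {i}) 0) =
          (if i = i0 then (-1) ^ card {j\<in>S1. j < i0} * (X i0 * g) else 0)"
        by (simp add: z0_def)
    qed
    also have "\<dots> = (-1) ^ card {j\<in>S1. j < i0} * (X i0 * g)" using S0(3) by (simp add: S1_def)
    finally have "(-1) ^ card {j\<in>S1. j < i0} * (X i0 * g) \<in> J" using kJ[of S1] by simp
    then have "(-1) ^ card {j\<in>S1. j < i0} * ((-1) ^ card {j\<in>S1. j < i0} * (X i0 * g)) \<in> J"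
      by (rule ideal_of_mult_left)
    then have "X i0 * g \<in> J" by simp
    then have "\<phi> (X i0 * (X i0 * g)) = 0" using Xg by (rule X_mult_J)
    then show False using g(2)[OF i0(1) i0(1)] i0(2) by simp
  qed
  then show ?thesis using z(2) by (intro exI[of _ z]) blast
qed

lemma shift_in_upper:
  assumes j: "j < CARD('n)"
  shows "int (c + j) \<in> set (sh (Suc j))"
proof -
  define t where "t = int (c + j)"
  obtain z where z: "\<And>a. a \<le> Suc j \<Longrightarrow> z a \<in> C t a (Suc j - a)"
    "\<And>y. (\<forall>a\<le>Suc j. y a \<in> C t a (Suc j - a)) \<Longrightarrow> (\<forall>a\<le>j. mat_map (D a) (y (Suc a)) = kos (y a)) \<Longrightarrow>
      (\<forall>S. kos (y 0) S 0 \<in> J) \<Longrightarrow> (\<exists>i. const_coeff (z (Suc j) {..<CARD('n)} i - y (Suc j) {..<CARD('n)} i) \<noteq> 0)"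
    using obstruction[OF j] unfolding t_def by blast
  obtain i where i: "const_coeff (z (Suc j) {..<CARD('n)} i) \<noteq> 0"
    using z(2)[of "\<lambda>_. 0"] by (auto simp: hchains_zero)
  have zS: "z (Suc j) \<in> C t (Suc j) 0" using z(1)[of "Suc j"] by simp
  have nz: "z (Suc j) {..<CARD('n)} i \<noteq> 0" using i by auto
  have "sh (Suc j) ! i = t" using chains_const_coeff[OF zS nz] i by blast
  then show ?thesis using hchains_support(3)[OF zS nz] t_def nth_mem by metis
qed

text \<open>If an extra form took part, the other \<open>j\<close> forms, of degree at least three,
  would raise the total to at least \<open>c + 3 * j\<close>, more than
  \<open>c + j\<close>.\<close>

lemma koszul_shift_small:
  assumes k: "k < length (koszul_basis (CARD('n) + p) (Suc j))" and j: "1 \<le> j"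
    and t: "koszul_shifts (ds @ replicate p c) (Suc j) ! k = int (c + j)"
  shows "set (koszul_basis (CARD('n) + p) (Suc j) ! k) \<subseteq> {..<CARD('n)}"
proof (rule ccontr)
  define es where "es = ds @ replicate p c"
  define T where "T = koszul_basis (CARD('n) + p) (Suc j) ! k"
  have len: "length es = CARD('n) + p" by (simp add: es_def len_ds)
  have T: "set T \<subseteq> {..<CARD('n) + p}" "distinct T" "card (set T) = Suc j"
    unfolding T_def by (rule koszul_basis_props[OF nth_mem[OF k]])+
  assume "\<not> ?thesis"
  then obtain x where x: "x \<in> set T" "\<not> x < CARD('n)" by (auto simp: T_def)
  have esx: "es ! x = c" using x T(1) by (auto simp: es_def nth_append len_ds)
  have es3: "3 \<le> es ! y" if "y \<in> set T" for y
    using that T(1) ds_ge[of y] c_ge by (auto simp: es_def nth_append len_ds)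
  have "int (c + j) = (\<Sum>y\<leftarrow>T. int (es ! y))"
    using t k by (simp add: koszul_shifts_def T_def flip: es_def len)
  also have "\<dots> = int (\<Sum>y\<in>set T. es ! y)" using T(2) by (simp add: sum_list_distinct_conv_sum_set)
  finally have "c + j = (\<Sum>y\<in>set T. es ! y)" by (simp only: of_nat_eq_iff)
  also have "(\<Sum>y\<in>set T. es ! y) = c + (\<Sum>y\<in>set T - {x}. es ! y)"
    using x(1) esx by (simp add: sum.remove)
  also have "(\<Sum>y\<in>set T - {x}. es ! y) \<ge> (\<Sum>y\<in>set T - {x}. 3)"
    using es3 by (intro sum_mono) simp
  then have "(\<Sum>y\<in>set T - {x}. es ! y) \<ge> 3 * j" using T(3) x(1) by simp
  ultimately show False using j by simp
qed

text \<open>A preimage of the residue of the obstruction class is lifted to a chain of constants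
  over the Koszul complex on the forms, pulled down to column zero and mapped to the resolution. The
  result \<open>y\<close> has the same residue, yet its column zero has boundary in
  \<open>J\<close>, which \<open>obstruction\<close> excludes.\<close>

lemma not_koszul:
  assumes j: "1 \<le> j" "j < CARD('n)"
  shows "\<not> koszul_syzygies (ds @ replicate p c) Fs sh D (Suc j) (int (c + j))"
proof
  define t where "t = int (c + j)"
  define es where "es = ds @ replicate p c"
  have Fs': "Fs \<in> form_tuples es" using Fs by (simp add: es_def)
  have len: "length es = CARD('n) + p" by (simp add: es_def len_ds)
  have len_shifts: "length (koszul_shifts es a) = length (koszul_basis (CARD('n) + p) a)" for a
    by (simp add: koszul_shifts_def len)
  obtain z where z: "\<And>a. a \<le> Suc j \<Longrightarrow> z a \<in> C t a (Suc j - a)"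
    "\<And>y. (\<forall>a\<le>Suc j. y a \<in> C t a (Suc j - a)) \<Longrightarrow> (\<forall>a\<le>j. mat_map (D a) (y (Suc a)) = kos (y a)) \<Longrightarrow>
      (\<forall>S. kos (y 0) S 0 \<in> J) \<Longrightarrow> (\<exists>i. const_coeff (z (Suc j) {..<CARD('n)} i - y (Suc j) {..<CARD('n)} i) \<noteq> 0)"
    using obstruction[OF j(2)] unfolding t_def by blast
  have zS: "z (Suc j) \<in> C t (Suc j) 0" using z(1)[of "Suc j"] by simp
  assume "koszul_syzygies (ds @ replicate p c) Fs sh D (Suc j) (int (c + j))"
  then obtain \<alpha> where \<alpha>: "comparison_map es Fs sh D \<alpha>"
    and surj: "(\<lambda>v. map_mat const_coeff (\<alpha> (Suc j)) *\<^sub>v v) ` residue_part (koszul_shifts es (Suc j)) t = residue_part (sh (Suc j)) t"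
    unfolding koszul_syzygies_def es_def t_def by blast
  have \<alpha>_graded: "graded_hom (koszul_shifts es a) (sh a) (\<alpha> a)" for a
    using \<alpha> by (simp add: comparison_map_def)
  have \<alpha>_dim: "dim_row (\<alpha> a) = length (sh a)" "dim_col (\<alpha> a) = length (koszul_basis (CARD('n) + p) a)" for a
    using \<alpha>_graded[of a] len_shifts[of a] by (auto simp: graded_hom_def)
  have \<alpha>_chain: "D a * \<alpha> (Suc a) = \<alpha> a * koszul_diff Fs a" for a
    using \<alpha> by (simp add: comparison_map_def)
  \<comment> \<open>Only basis elements built from generators of \<open>J\<close> are allowed; the
    differential respects this because it deletes indices.\<close>
  define Q where "Q a k \<longleftrightarrow> set (koszul_basis (CARD('n) + p) a ! k) \<subseteq> {..<CARD('n)}" for a k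
  define K where "K a b = (hchains t (koszul_shifts es a) (Q a) b :: (nat set \<Rightarrow> nat \<Rightarrow> ('n, 'k) mpol) set)" for a b
  define d where "d a = mat_map (koszul_diff Fs a)" for a
  have d: "d a f \<in> K a b" if f: "f \<in> K (Suc a) b" for a b f
    unfolding K_def d_def
  proof (rule mat_map_hchains[OF koszul_diff_graded[OF Fs'] f[unfolded K_def]])
    fix i k assume ik: "i < length (koszul_shifts es a)" "k < length (koszul_shifts es (Suc a))"
      and Qk: "Q (Suc a) k" and nz: "koszul_diff Fs a $$ (i, k) \<noteq> 0"
    have ik': "i < length (kbasis Fs a)" "k < length (kbasis Fs (Suc a))"
      using ik by (simp_all add: len_shifts len_Fs)
    have "koszul_diff Fs a $$ (i, k) = 0 \<or> Q a i"
      by (rule koszul_diff_entry_cases[OF ik'])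
        (use Qk in \<open>auto simp: Q_def len_Fs dest!: in_set_takeD in_set_dropD\<close>)
    then show "Q a i" using nz by simp
  qed
  define r where "r = vec (length (sh (Suc j))) (\<lambda>i. const_coeff (z (Suc j) {..<CARD('n)} i))"
  have "r \<in> residue_part (sh (Suc j)) t"
    using chains_const_coeff[OF zS] by (auto simp: residue_part_def r_def) (metis const_coeff_zero)
  then obtain u0 where u0: "u0 \<in> residue_part (koszul_shifts es (Suc j)) t"
    "map_mat const_coeff (\<alpha> (Suc j)) *\<^sub>v u0 = r"
    using surj by (metis (no_types, lifting) imageE)
  \<comment> \<open>At the full set the homological degree is zero, and the constants have the right
    degree because \<open>u0\<close> is supported on shifts equal to \<open>t\<close>.\<close>
  define U where "U S k = (if S = {..<CARD('n)} \<and> k < length (koszul_shifts es (Suc j))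
      then single 0 (u0 $ k) else (0 :: ('n, 'k) mpol))" for S k
  have u0_shift: "koszul_shifts es (Suc j) ! k = t" if "k < length (koszul_shifts es (Suc j))" "u0 $ k \<noteq> 0" for k
    using u0(1) that by (auto simp: residue_part_def)
  have U: "U \<in> K (Suc j) 0"
    unfolding K_def hchains_def
  proof (intro CollectI allI conjI impI)
    fix S k
    show "U S k \<in> forms (t - int 0 - koszul_shifts es (Suc j) ! k)"
      using u0_shift[of k] by (cases "u0 $ k = 0") (auto simp: U_def forms_const)
    assume nz: "U S k \<noteq> 0"
    then have S: "S = {..<CARD('n)}" and k: "k < length (koszul_shifts es (Suc j))" and uk: "u0 $ k \<noteq> 0"
      by (auto simp: U_def split: if_splits)
    show "S \<subseteq> {..<CARD('n)}" "card S + 0 = CARD('n)" "k < length (koszul_shifts es (Suc j))"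
      using S k by auto
    have "k < length (koszul_basis (CARD('n) + p) (Suc j))" using k by (simp only: len_shifts)
    then show "Q (Suc j) k" unfolding Q_def
      using u0_shift[OF k uk] j(1) by (intro koszul_shift_small) (simp_all only: es_def t_def)
  qed
  \<comment> \<open>The forms have no constant term, so this chain in the bottom row is a Koszul
    boundary and the descent can start.\<close>
  have "const_coeff (d j U {..<CARD('n)} i) = 0" for i
  proof (cases "i < length (kbasis Fs j)")
    case True
    have "const_coeff (koszul_diff Fs j $$ (i, k)) = 0" if k: "k < length (kbasis Fs (Suc j))" for k
    proof (rule koszul_diff_entry_cases[OF True k])
      fix r assume "r < Suc j"
      then have "kbasis Fs (Suc j) ! k ! r < length Fs"
        using koszul_basis_props(2,3)[OF nth_mem[OF k]] by (metis lessThan_iff nth_mem subsetD)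
      then show "const_coeff ((-1) ^ r * Fs ! (kbasis Fs (Suc j) ! k ! r)) = 0"
        by (simp add: const_coeff_minus_one_power const_coeff_F)
    qed (simp_all add: const_coeff_add)
    then show ?thesis
      by (auto simp: d_def mat_map_def const_coeff_sum U_def const_coeff_mult_single intro!: sum.neutral)
  qed (simp add: d_def mat_map_def)
  then obtain w where w: "w \<in> K j 1" "kos w = d j U"
    using kos_exact_zero[of "d j U" t "koszul_shifts es j" "Q j"] d[OF U] unfolding K_def by blast
  have "\<exists>u. u (Suc j) = U \<and> (\<forall>a\<le>Suc j. u a \<in> K a (Suc j - a)) \<and> (\<forall>a\<le>j. d a (u (Suc a)) = kos (u a))"
  proof (rule zigzag_down[where C = K and d = d and e = kos, OF d _ _ _ U w])
    show "d a (kos f) = kos (d a f)" for a f by (simp add: d_def kos_mat_map)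
    show "d a (d (Suc a) f) = 0" for a f unfolding d_def by (rule koszul_diff_mult_zero)
    show "\<exists>w\<in>K a (Suc (Suc b)). kos w = f" if "f \<in> K a (Suc b)" "kos f = 0" for a b f
      using that unfolding K_def by (rule kos_exact_pos)
  qed
  then obtain u where u: "u (Suc j) = U" "\<And>a. a \<le> Suc j \<Longrightarrow> u a \<in> K a (Suc j - a)"
    "\<And>a. a \<le> j \<Longrightarrow> d a (u (Suc a)) = kos (u a)" by blast
  define y where "y a = mat_map (\<alpha> a) (u a)" for a
  have "\<exists>i. const_coeff (z (Suc j) {..<CARD('n)} i - y (Suc j) {..<CARD('n)} i) \<noteq> 0"
  proof (rule z(2))
    show "\<forall>a\<le>Suc j. y a \<in> C t a (Suc j - a)"
      unfolding y_def using u(2) by (auto simp: K_def intro!: mat_map_hchains[OF \<alpha>_graded])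
    show "\<forall>a\<le>j. mat_map (D a) (y (Suc a)) = kos (y a)"
    proof (intro allI impI)
      fix a assume a: "a \<le> j"
      have "mat_map (D a) (y (Suc a)) = mat_map (\<alpha> a) (d a (u (Suc a)))"
        unfolding y_def d_def by (simp add: mat_map_mat_map \<alpha>_dim len_Fs \<alpha>_chain)
      then show "mat_map (D a) (y (Suc a)) = kos (y a)"
        using u(3)[OF a] by (simp add: y_def kos_mat_map)
    qed
    \<comment> \<open>The boundary of \<open>y 0\<close> is the image under
      \<open>\<alpha> 0\<close> of \<open>d 0 (u 1)\<close>, a combination of generators of
      \<open>J\<close>.\<close>
    show "\<forall>S. kos (y 0) S 0 \<in> J"
    proof
      fix S
      have "d 0 (u 1) S i \<in> J" for i
      proof (cases "i < length (kbasis Fs 0)")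
        case True
        have "koszul_diff Fs 0 $$ (i, k) * u 1 S k \<in> J" if k: "k < length (kbasis Fs (Suc 0))" for k
        proof (cases "u 1 S k = 0")
          case False
          have "u 1 \<in> K 1 j" using u(2)[of 1] by simp
          then have Qk: "Q 1 k" using hchains_support(4) False unfolding K_def by blast
          have "koszul_diff Fs 0 $$ (i, k) \<in> J"
          proof (rule koszul_diff_entry_cases[OF True k])
            fix r assume "r < Suc 0"
            then have "kbasis Fs (Suc 0) ! k ! r < CARD('n)"
              using koszul_basis_props(3)[OF nth_mem[OF k]] Qk
              unfolding Q_def len_Fs One_nat_def by (metis lessThan_iff nth_mem subsetD)
            then show "(-1) ^ r * Fs ! (kbasis Fs (Suc 0) ! k ! r) \<in> J"
              by (intro ideal_of_mult_left F_in_J)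
          qed (auto intro: ideal_of_add)
          then show ?thesis by (rule ideal_of_mult_right)
        qed simp
        then show ?thesis by (auto simp: d_def mat_map_def intro!: ideal_of_sum)
      qed (simp add: d_def mat_map_def)
      then have "kos (u 0) S i \<in> J" for i using u(3)[of 0] by simp
      then have "mat_map (\<alpha> 0) (kos (u 0)) S 0 \<in> J"
        by (auto simp: mat_map_def intro!: ideal_of_sum ideal_of_mult_left)
      then show "kos (y 0) S 0 \<in> J" by (simp add: y_def kos_mat_map)
    qed
  qed
  moreover have "const_coeff (y (Suc j) {..<CARD('n)} i) = const_coeff (z (Suc j) {..<CARD('n)} i)" for i
  proof (cases "i < length (sh (Suc j))")
    case True
    have dim_u0: "dim_vec u0 = length (koszul_basis (CARD('n) + p) (Suc j))"
      using u0(1) by (auto simp: residue_part_def len_shifts)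
    have "const_coeff (y (Suc j) {..<CARD('n)} i) =
        (\<Sum>k<length (koszul_basis (CARD('n) + p) (Suc j)). const_coeff (\<alpha> (Suc j) $$ (i, k)) * u0 $ k)"
      using True by (simp add: y_def u(1) mat_map_def \<alpha>_dim const_coeff_sum U_def len_shifts const_coeff_mult_single)
    also have "\<dots> = (map_mat const_coeff (\<alpha> (Suc j)) *\<^sub>v u0) $ i"
      using True dim_u0 by (simp add: \<alpha>_dim scalar_prod_def atLeast0LessThan)
    also have "\<dots> = const_coeff (z (Suc j) {..<CARD('n)} i)" unfolding u0(2) r_def using True by simp
    finally show ?thesis .
  next
    case False
    then have "z (Suc j) {..<CARD('n)} i = 0" using hchains_support(3)[OF zS] by blast
    then show ?thesis using False by (simp add: y_def mat_map_def \<alpha>_dim)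
  qed
  ultimately show False by (simp add: const_coeff_diff)
qed

lemma non_koszul_ghost:
  assumes "p + 1 \<le> j" "j \<le> CARD('n) - 1"
  shows "non_koszul_ghost_term (ds @ replicate p c) Fs sh D j (int (c + j))"
proof -
  have "1 \<le> j" "j < CARD('n)" using assms p_le by auto
  then show ?thesis
    using shift_in_lower[OF assms] shift_in_upper[of j] not_koszul[of j]
    by (simp add: non_koszul_ghost_term_def ghost_term_def koszul_ghost_term_def)
qed

end

section \<open>Polynomial conditions on the coefficients\<close>

definition monom_value :: "('v \<Rightarrow> 'k::comm_ring_1) \<Rightarrow> ('v \<Rightarrow>\<^sub>0 nat) \<Rightarrow> 'k" where
  "monom_value a m = (\<Prod>v\<in>keys m. a v ^ lookup m v)"

lemma monom_value_superset:
  assumes "finite A" "keys m \<subseteq> A"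
  shows "monom_value a m = (\<Prod>v\<in>A. a v ^ lookup m v)"
  unfolding monom_value_def using assms by (intro prod.mono_neutral_left) (auto simp: in_keys_iff)

lemma monom_value_add: "monom_value a (m + m') = monom_value a m * monom_value a m'"
proof -
  let ?A = "keys m \<union> keys m'"
  have "monom_value a (m + m') = (\<Prod>v\<in>?A. a v ^ lookup (m + m') v)"
    using keys_add[of m m'] by (intro monom_value_superset) auto
  also have "\<dots> = (\<Prod>v\<in>?A. a v ^ lookup m v) * (\<Prod>v\<in>?A. a v ^ lookup m' v)"
    by (simp add: lookup_add power_add prod.distrib)
  also have "\<dots> = monom_value a m * monom_value a m'"
    using monom_value_superset[of ?A m a] monom_value_superset[of ?A m' a] by simp
  finally show ?thesis .
qed

lemma poly_value_superset:
  fixes q :: "('v \<Rightarrow>\<^sub>0 nat) \<Rightarrow>\<^sub>0 'k::comm_ring_1"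
  assumes "finite A" "keys q \<subseteq> A"
  shows "poly_value a q = (\<Sum>m\<in>A. lookup q m * monom_value a m)"
  unfolding poly_value_def monom_value_def[symmetric]
  using assms by (intro sum.mono_neutral_left) (auto simp: in_keys_iff)

lemma poly_value_zero [simp]: "poly_value a 0 = 0"
  by (simp add: poly_value_def)

lemma poly_value_add:
  fixes q r :: "('v \<Rightarrow>\<^sub>0 nat) \<Rightarrow>\<^sub>0 'k::comm_ring_1"
  shows "poly_value a (q + r) = poly_value a q + poly_value a r"
proof -
  let ?A = "keys q \<union> keys r"
  have "poly_value a (q + r) = (\<Sum>m\<in>?A. lookup (q + r) m * monom_value a m)"
    using keys_add[of q r] by (intro poly_value_superset) auto
  then show ?thesis
    using poly_value_superset[of ?A q a] poly_value_superset[of ?A r a]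
    by (simp add: lookup_add distrib_right sum.distrib)
qed

lemma poly_value_sum:
  fixes q :: "'i \<Rightarrow> ('v \<Rightarrow>\<^sub>0 nat) \<Rightarrow>\<^sub>0 'k::comm_ring_1"
  shows "poly_value a (\<Sum>i\<in>A. q i) = (\<Sum>i\<in>A. poly_value a (q i))"
  by (induction A rule: infinite_finite_induct) (simp_all add: poly_value_add)

lemma poly_value_single:
  fixes x :: "'k::comm_ring_1"
  shows "poly_value a (single m x) = x * monom_value a m"
  using poly_value_superset[of "{m}" "single m x" a] by simp

lemma poly_value_mult:
  fixes q r :: "('v \<Rightarrow>\<^sub>0 nat) \<Rightarrow>\<^sub>0 'k::comm_ring_1"
  shows "poly_value a (q * r) = poly_value a q * poly_value a r"
proof -
  have "poly_value a (q * r) = (\<Sum>m\<in>keys q. \<Sum>m'\<in>keys r.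
      (lookup q m * monom_value a m) * (lookup r m' * monom_value a m'))"
    unfolding mpol_times_expand[of q r] poly_value_sum poly_value_single monom_value_add
    by (intro sum.cong refl) (simp add: ac_simps)
  also have "\<dots> = poly_value a q * poly_value a r"
    unfolding poly_value_def monom_value_def[symmetric] sum_product ..
  finally show ?thesis .
qed

definition coords :: "('n, 'k) mpol list \<Rightarrow> nat \<times> 'n monom \<Rightarrow> 'k::zero" where
  "coords Fs = (\<lambda>(i, m). lookup (Fs ! i) m)"

definition coord_poly :: "(('n::finite, 'k::field) mpol list \<Rightarrow> 'k) \<Rightarrow> bool" where
  "coord_poly G \<longleftrightarrow> (\<exists>q. \<forall>Fs. poly_value (coords Fs) q = G Fs)"

lemma coord_poly_const: "coord_poly (\<lambda>_. x)"
  unfolding coord_poly_def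
  by (intro exI[of _ "single 0 x"]) (simp add: poly_value_single monom_value_def)

lemma coord_poly_coord: "coord_poly (\<lambda>Fs. lookup (Fs ! i) m)"
  unfolding coord_poly_def
  by (intro exI[of _ "single (single (i, m) 1) 1"])
    (simp add: poly_value_single monom_value_def coords_def)

lemma coord_poly_add: "coord_poly G \<Longrightarrow> coord_poly H \<Longrightarrow> coord_poly (\<lambda>Fs. G Fs + H Fs)"
  unfolding coord_poly_def by (metis poly_value_add)

lemma coord_poly_mult: "coord_poly G \<Longrightarrow> coord_poly H \<Longrightarrow> coord_poly (\<lambda>Fs. G Fs * H Fs)"
  unfolding coord_poly_def by (metis poly_value_mult)

lemma coord_poly_sum: "(\<And>i. i \<in> A \<Longrightarrow> coord_poly (G i)) \<Longrightarrow> coord_poly (\<lambda>Fs. \<Sum>i\<in>A. G i Fs)"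
  by (induction A rule: infinite_finite_induct) (auto intro: coord_poly_const coord_poly_add)

lemma coord_poly_prod: "(\<And>i. i \<in> A \<Longrightarrow> coord_poly (G i)) \<Longrightarrow> coord_poly (\<lambda>Fs. \<Prod>i\<in>A. G i Fs)"
  by (induction A rule: infinite_finite_induct) (auto intro: coord_poly_const coord_poly_mult)

lemma coord_poly_det:
  assumes "\<And>Fs. A Fs \<in> carrier_mat N N" and "\<And>i j. i < N \<Longrightarrow> j < N \<Longrightarrow> coord_poly (\<lambda>Fs. A Fs $$ (i, j))"
  shows "coord_poly (\<lambda>Fs. det (A Fs))"
proof -
  have "coord_poly (\<lambda>Fs. \<Sum>\<pi> | \<pi> permutes {0..<N}. signof \<pi> * (\<Prod>i = 0..<N. A Fs $$ (i, \<pi> i)))"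
  proof (intro coord_poly_sum coord_poly_mult coord_poly_prod coord_poly_const assms(2))
    fix \<pi> i assume "\<pi> \<in> {\<pi>. \<pi> permutes {0..<N}}" "i \<in> {0..<N}"
    then show "i < N" "\<pi> i < N" using permutes_in_image[of \<pi> "{0..<N}" i] by auto
  qed
  then show ?thesis using assms(1) by (simp add: det_def'[of _ N])
qed

lemma coord_poly_wedges:
  assumes "\<And>l i. l \<in> set ls \<Longrightarrow> coord_poly (\<lambda>Fs. V Fs l i)"
  shows "coord_poly (\<lambda>Fs. wedges (map (V Fs) ls) f S)"
  using assms
proof (induction ls arbitrary: S)
  case (Cons l ls)
  show ?case unfolding list.map wedges_simps wedge_def
    by (intro coord_poly_sum coord_poly_mult coord_poly_const Cons.IH Cons.prems) auto
qed (simp add: coord_poly_const)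

definition coord_form :: "(('n::finite, 'k::field) mpol list \<Rightarrow> ('n, 'k) mpol) \<Rightarrow> bool" where
  "coord_form H \<longleftrightarrow> (\<forall>m. coord_poly (\<lambda>Fs. lookup (H Fs) m))"

lemma coord_form_const: "coord_form (\<lambda>_. f)"
  by (simp add: coord_form_def coord_poly_const)

lemma coord_form_nth: "coord_form (\<lambda>Fs. Fs ! i)"
  by (simp add: coord_form_def coord_poly_coord)

text \<open>The supports of \<open>f\<close> and \<open>g\<close> vary with the forms. Summing over
  all monomials of bounded degree gives one polynomial expression valid for all of them.\<close>

lemma lookup_times_mdeg:
  fixes f g :: "('n::finite, 'k::field) mpol"
  shows "lookup (f * g) m = (\<Sum>a | mdeg a \<le> mdeg m. \<Sum>b | mdeg b \<le> mdeg m.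
    if a + b = m then lookup f a * lookup g b else 0)"
proof -
  let ?A = "{a. mdeg a \<le> mdeg m}" and ?Z = "\<lambda>a b. if a + b = m then lookup f a * lookup g b else 0"
  have inner: "(\<Sum>b\<in>keys g. ?Z a b) = (\<Sum>b\<in>?A. ?Z a b)" for a
  proof -
    have "(\<Sum>b\<in>keys g. ?Z a b) = (\<Sum>b\<in>keys g \<union> ?A. ?Z a b)"
      by (intro sum.mono_neutral_left) (auto simp: finite_mdeg in_keys_iff)
    also have "\<dots> = (\<Sum>b\<in>?A. ?Z a b)"
      by (intro sum.mono_neutral_right) (auto simp: finite_mdeg)
    finally show ?thesis .
  qed
  have "(\<Sum>a\<in>keys f. \<Sum>b\<in>?A. ?Z a b) = (\<Sum>a\<in>keys f \<union> ?A. \<Sum>b\<in>?A. ?Z a b)"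
    by (intro sum.mono_neutral_left) (auto simp: finite_mdeg in_keys_iff)
  also have "\<dots> = (\<Sum>a\<in>?A. \<Sum>b\<in>?A. ?Z a b)"
    by (intro sum.mono_neutral_right) (auto simp: finite_mdeg intro!: sum.neutral split: if_splits)
  finally show ?thesis unfolding lookup_times inner .
qed

lemma coord_form_mult:
  assumes "coord_form G" "coord_form H"
  shows "coord_form (\<lambda>Fs. G Fs * H Fs)"
  unfolding coord_form_def
proof
  fix m
  have "coord_poly (\<lambda>Fs. if a + b = m then lookup (G Fs) a * lookup (H Fs) b else 0)" for a b
    using assms by (cases "a + b = m") (auto simp: coord_form_def intro: coord_poly_mult coord_poly_const)
  then show "coord_poly (\<lambda>Fs. lookup (G Fs * H Fs) m)"
    unfolding lookup_times_mdeg by (intro coord_poly_sum)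
qed

lemma coord_form_power: "coord_form G \<Longrightarrow> coord_form (\<lambda>Fs. G Fs ^ k)"
  by (induction k) (auto intro: coord_form_const coord_form_mult)

lemma coord_form_prod: "(\<And>i. i \<in> A \<Longrightarrow> coord_form (G i)) \<Longrightarrow> coord_form (\<lambda>Fs. \<Prod>i\<in>A. G i Fs)"
  by (induction A rule: infinite_finite_induct) (auto intro: coord_form_const coord_form_mult)

subsection \<open>Bases adapted to a complete intersection\<close>

definition exponent :: "'n::finite monom \<Rightarrow> nat \<Rightarrow> nat" where
  "exponent a i = lookup a (var_at i)"

definition monom_of :: "(nat \<Rightarrow> nat) \<Rightarrow> 'n::finite monom" where
  "monom_of e = (\<Sum>i<CARD('n). var_power i (e i))"

lemma exponent_add [simp]: "exponent (a + b) i = exponent a i + exponent b i"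
  by (simp add: exponent_def lookup_add)

lemma exponent_minus [simp]: "exponent (a - b) i = exponent a i - exponent b i"
  by (simp add: exponent_def lookup_minus)

lemma exponent_var_power:
  "i < CARD('n) \<Longrightarrow> j < CARD('n) \<Longrightarrow> exponent (var_power i k :: 'n::finite monom) j = (if i = j then k else 0)"
  by (simp add: exponent_def lookup_var_power)

lemma exponent_monom_of:
  assumes "i < CARD('n)"
  shows "exponent (monom_of e :: 'n::finite monom) i = e i"
proof -
  have "exponent (monom_of e :: 'n monom) i = (\<Sum>j<CARD('n). if j = i then e i else 0)"
    unfolding exponent_def monom_of_def lookup_sum
    by (intro sum.cong refl) (use assms in \<open>simp add: lookup_var_power\<close>)
  then show ?thesis using assms by simp
qed

lemma monom_eq_iff: "(a :: 'n::finite monom) = b \<longleftrightarrow> (\<forall>i<CARD('n). exponent a i = exponent b i)"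
  using monom_eqI[of a b] by (auto simp: exponent_def)

lemma mdeg_exponent: "mdeg (a :: 'n::finite monom) = (\<Sum>i<CARD('n). exponent a i)"
  unfolding mdeg_def exponent_def by (rule sum_var_at)

text \<open>\<open>c_eq\<close> expresses \<open>c + 1\<close> as the socle degree of the complete
  intersection; \<open>ty\<close> ties the locale to the type of the variables.\<close>

locale degrees =
  fixes ds :: "nat list" and ty :: "'n::finite itself" and c :: nat
  assumes len_ds: "length ds = CARD('n)" and ds_ge: "\<And>i. i < CARD('n) \<Longrightarrow> 3 \<le> ds ! i"
    and c_eq: "(\<Sum>i<CARD('n). ds ! i - 1) = Suc c"
begin

lemma ds_pos: "i < CARD('n) \<Longrightarrow> 0 < ds ! i"
  using ds_ge[of i] by simp

definition basis_form :: "('n, 'k::field) mpol list \<Rightarrow> 'n monom \<Rightarrow> ('n, 'k) mpol" where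
  "basis_form Fs a = monic (monom_of (\<lambda>i. exponent a i mod ds ! i)) * (\<Prod>i<CARD('n). Fs ! i ^ (exponent a i div ds ! i))"

text \<open>Linear over the field and not multiplicative, but by \<open>Theta_shift\<close> it can
  transport the ideals of the model \<open>x_i ^ d_i\<close> to those of \<open>Fs\<close>.\<close>

definition Theta :: "('n, 'k::field) mpol list \<Rightarrow> ('n, 'k) mpol \<Rightarrow> ('n, 'k) mpol" where
  "Theta Fs f = (\<Sum>m\<in>keys f. single 0 (lookup f m) * basis_form Fs m)"

definition top_monom :: "'n monom" where
  "top_monom = monom_of (\<lambda>i. ds ! i - 1)"

definition Mons :: "nat \<Rightarrow> 'n monom list" where
  "Mons e = (SOME xs. set xs = {m. mdeg m \<le> e} \<and> distinct xs)"

definition basis_mat :: "nat \<Rightarrow> ('n, 'k::field) mpol list \<Rightarrow> 'k mat" where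
  "basis_mat e Fs = mat (length (Mons e)) (length (Mons e)) (\<lambda>(i, j). lookup (basis_form Fs (Mons e ! j)) (Mons e ! i))"

definition coeff_vec :: "nat \<Rightarrow> ('n, 'k::field) mpol \<Rightarrow> 'k vec" where
  "coeff_vec e f = vec (length (Mons e)) (\<lambda>i. lookup f (Mons e ! i))"

lemma Mons: "set (Mons e) = {m. mdeg m \<le> e}" "distinct (Mons e)"
proof -
  have "set (Mons e) = {m. mdeg m \<le> e} \<and> distinct (Mons e)"
    unfolding Mons_def by (rule someI_ex, rule finite_distinct_list[OF finite_mdeg])
  then show "set (Mons e) = {m. mdeg m \<le> e}" "distinct (Mons e)" by auto
qed

lemma sum_Mons: "(\<Sum>i<length (Mons e). f (Mons e ! i)) = (\<Sum>m | mdeg m \<le> e. f m)"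
  using sum.reindex_bij_betw[OF bij_betw_nth[OF Mons(2) refl refl], of f e] by (simp add: Mons(1))

lemma Theta_superset:
  assumes "finite A" "keys f \<subseteq> A"
  shows "Theta Fs f = (\<Sum>m\<in>A. single 0 (lookup f m) * basis_form Fs m)"
  unfolding Theta_def using assms by (intro sum.mono_neutral_left) (auto simp: in_keys_iff)

lemma Theta_zero [simp]: "Theta Fs 0 = 0"
  by (simp add: Theta_def)

lemma Theta_add: "Theta Fs (f + g) = Theta Fs f + Theta Fs g"
proof -
  let ?A = "keys f \<union> keys g"
  have "Theta Fs (f + g) = (\<Sum>m\<in>?A. single 0 (lookup (f + g) m) * basis_form Fs m)"
    using keys_add[of f g] by (intro Theta_superset) auto
  then show ?thesis
    using Theta_superset[of ?A f Fs] Theta_superset[of ?A g Fs]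
    by (simp add: lookup_add single_add distrib_right sum.distrib)
qed

lemma Theta_sum: "Theta Fs (\<Sum>i\<in>A. f i) = (\<Sum>i\<in>A. Theta Fs (f i))"
  by (induction A rule: infinite_finite_induct) (simp_all add: Theta_add)

lemma Theta_single: "Theta Fs (single m x) = single 0 x * basis_form Fs m"
  using Theta_superset[of "{m}" "single m x" Fs] by simp

lemma Theta_scale: "Theta Fs (single 0 x * f) = single 0 x * Theta Fs f"
proof -
  have "single 0 x * f = (\<Sum>m\<in>keys f. single m (x * lookup f m))"
    by (subst mpol_expand[of f], simp only: sum_distrib_left mult_single) simp
  then have "Theta Fs (single 0 x * f) =
      (\<Sum>m\<in>keys f. single 0 x * (single 0 (lookup f m) * basis_form Fs m))"
    by (simp only: Theta_sum Theta_single mult_single mult.assoc[symmetric]) simp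
  then show ?thesis by (simp add: Theta_def sum_distrib_left)
qed

lemma Theta_diff: "Theta Fs (f - g) = Theta Fs f - Theta Fs g"
  using Theta_add[of Fs "f - g" g] by (simp add: algebra_simps)

lemma basis_form_shift:
  assumes i: "i < CARD('n)"
  shows "basis_form Fs (var_power i (ds ! i) + a) = Fs ! i * basis_form Fs a"
proof -
  have e: "exponent (var_power i (ds ! i) + a) j = (if j = i then ds ! i else 0) + exponent a j" if "j < CARD('n)" for j
    using exponent_var_power[OF i that, of "ds ! i"] by auto
  have pos: "ds ! i > 0" using ds_ge[OF i] by simp
  have "monom_of (\<lambda>j. exponent (var_power i (ds ! i) + a) j mod ds ! j) = (monom_of :: _ \<Rightarrow> 'n monom) (\<lambda>j. exponent a j mod ds ! j)"
    unfolding monom_of_def by (intro sum.cong refl arg_cong2[of _ _ _ _ var_power]) (use e in auto)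
  moreover have "(\<Prod>j<CARD('n). Fs ! j ^ (exponent (var_power i (ds ! i) + a) j div ds ! j)) =
      (\<Prod>j<CARD('n). (if j = i then Fs ! i else 1) * Fs ! j ^ (exponent a j div ds ! j))"
    by (intro prod.cong refl) (use e pos in auto)
  moreover have "\<dots> = Fs ! i * (\<Prod>j<CARD('n). Fs ! j ^ (exponent a j div ds ! j))"
    using i by (simp add: prod.distrib)
  ultimately show ?thesis by (simp add: basis_form_def mult.left_commute)
qed

text \<open>Adding \<open>d_i\<close> to an exponent keeps its remainder and raises its quotient by
  one, so multiplying by the power corresponds to multiplying by the form.\<close>

lemma Theta_shift:
  assumes i: "i < CARD('n)"
  shows "Theta Fs (monic (var_power i (ds ! i)) * f) = Fs ! i * Theta Fs f"
proof -
  have "monic (var_power i (ds ! i)) * f =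
      (\<Sum>m\<in>keys f. single (var_power i (ds ! i) + m) (lookup f m))"
    by (subst mpol_expand[of f], simp only: sum_distrib_left monic_def mult_single) simp
  then show ?thesis
    by (simp add: Theta_sum Theta_single basis_form_shift[OF i]) (simp add: Theta_def sum_distrib_left mult.left_commute)
qed

lemma basis_form_box:
  assumes "\<And>i. i < CARD('n) \<Longrightarrow> exponent a i < ds ! i"
  shows "basis_form Fs a = monic a"
proof -
  have "monom_of (\<lambda>i. exponent a i mod ds ! i) = a"
    using assms by (simp add: monom_eq_iff exponent_monom_of)
  then show ?thesis using assms by (simp add: basis_form_def)
qed

lemma Theta_one: "Theta Fs 1 = 1"
proof -
  have "basis_form Fs 0 = (monic 0 :: ('n, 'k::field) mpol)" for Fs
    by (intro basis_form_box) (simp add: exponent_def ds_pos)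
  then show ?thesis using Theta_single[of Fs 0 1] by (simp add: monic_def)
qed

lemma basis_form_special:
  assumes "\<And>i. i < CARD('n) \<Longrightarrow> Fs ! i = monic (var_power i (ds ! i))"
  shows "basis_form Fs a = monic a"
proof -
  have pow: "monic b ^ k = (monic (\<Sum>j<k. b) :: ('n, 'k::field) mpol)" for b :: "'n monom" and k
    by (induction k) (simp_all add: monic_def mult_single add.commute)
  have prod: "(\<Prod>i\<in>A. monic (b i)) = (monic (\<Sum>i\<in>A. b i) :: ('n, 'k::field) mpol)" for b :: "nat \<Rightarrow> 'n monom" and A
    by (induction A rule: infinite_finite_induct) (simp_all add: monic_mult, simp_all add: monic_def)
  have var_mult: "(\<Sum>j<k. var_power i d) = (var_power i (k * d) :: 'n monom)" for i k d
    by (induction k) (simp_all add: var_power_def single_add[symmetric] add.commute)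
  have "(\<Prod>i<CARD('n). Fs ! i ^ (exponent a i div ds ! i)) = monic (monom_of (\<lambda>i. (exponent a i div ds ! i) * ds ! i))"
    unfolding monom_of_def prod[symmetric] using assms by (intro prod.cong refl) (simp add: pow var_mult)
  moreover have "monom_of (\<lambda>i. exponent a i mod ds ! i) + monom_of (\<lambda>i. (exponent a i div ds ! i) * ds ! i) = a"
    by (simp add: monom_eq_iff exponent_monom_of mod_div_mult_eq)
  ultimately show ?thesis by (simp add: basis_form_def flip: monic_mult)
qed

lemma keys_top_box:
  fixes u :: "('n, 'k::field) mpol"
  assumes "m \<in> keys u" "u \<in> ideal_of ((\<lambda>i. monic (var_power i (ds ! i))) ` {..<CARD('n)})"
  shows "\<exists>i<CARD('n). ds ! i \<le> exponent m i"
  using assms unfolding monomial_ideal_iff[OF order_refl, of u "(!) ds"] exponent_def by blast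

lemma mdeg_top: "mdeg top_monom = Suc c"
  unfolding mdeg_exponent top_monom_def using c_eq by (simp add: exponent_monom_of)

lemma exponent_top: "i < CARD('n) \<Longrightarrow> exponent top_monom i = ds ! i - 1"
  by (simp add: top_monom_def exponent_monom_of)

end

lemma lookup_scale:
  fixes g :: "('n, 'k::field) mpol"
  shows "lookup (single 0 a * g) k = a * lookup g k"
  using lookup_single_times[of 0 a g k] by simp

lemma forms_one: "1 \<in> forms 0"
  using forms_const[of 1] by simp

lemma forms_power: "f \<in> forms e \<Longrightarrow> f ^ k \<in> forms (int k * e)"
proof (induction k)
  case (Suc k)
  then have "f * f ^ k \<in> forms (e + int k * e)" by (intro forms_mult) auto
  then show ?case by (simp add: algebra_simps)
qed (simp add: forms_one)

lemma forms_prod: "(\<And>i. i \<in> A \<Longrightarrow> f i \<in> forms (e i)) \<Longrightarrow> (\<Prod>i\<in>A. f i) \<in> forms (\<Sum>i\<in>A. e i)"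
  by (induction A rule: infinite_finite_induct) (auto simp: forms_one intro: forms_mult)

lemma forms_keys: "f \<in> forms (int e) \<Longrightarrow> m \<in> keys f \<Longrightarrow> mdeg m = e"
  by (simp add: forms_def)

section \<open>The adapted basis in bounded degree\<close>

context degrees
begin

lemma basis_form_forms:
  assumes F: "\<And>i. i < CARD('n) \<Longrightarrow> Fs ! i \<in> forms (int (ds ! i))"
  shows "basis_form Fs a \<in> forms (int (mdeg a))"
proof -
  have "basis_form Fs a \<in> forms (int (mdeg (monom_of (\<lambda>i. exponent a i mod ds ! i) :: 'n monom)) +
      (\<Sum>i<CARD('n). int (exponent a i div ds ! i) * int (ds ! i)))"
    unfolding basis_form_def by (intro forms_mult monic_in_forms refl forms_prod forms_power F) simp
  moreover have "mdeg (monom_of (\<lambda>i. exponent a i mod ds ! i) :: 'n monom) + (\<Sum>i<CARD('n). exponent a i div ds ! i * ds ! i) = mdeg a"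
    by (simp add: mdeg_exponent exponent_monom_of mod_div_mult_eq flip: sum.distrib)
  then have "int (mdeg (monom_of (\<lambda>i. exponent a i mod ds ! i) :: 'n monom)) +
      (\<Sum>i<CARD('n). int (exponent a i div ds ! i) * int (ds ! i)) = int (mdeg a)"
    by (simp flip: of_nat_mult of_nat_sum of_nat_add)
  ultimately show ?thesis by simp
qed

lemma coeff_vec_carrier [simp]: "coeff_vec e f \<in> carrier_vec (length (Mons e))"
  by (simp add: coeff_vec_def)

lemma basis_mat_carrier [simp]: "basis_mat e Fs \<in> carrier_mat (length (Mons e)) (length (Mons e))"
  by (simp add: basis_mat_def)

lemma coeff_vec_inj:
  assumes "coeff_vec e f = coeff_vec e g"
    and "\<And>m. m \<in> keys f \<Longrightarrow> mdeg m \<le> e" "\<And>m. m \<in> keys g \<Longrightarrow> mdeg m \<le> e"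
  shows "f = g"
proof (rule poly_mapping_eqI)
  fix m
  show "lookup f m = lookup g m"
  proof (cases "mdeg m \<le> e")
    case True
    then have "m \<in> set (Mons e)" by (simp add: Mons(1))
    then obtain i where i: "i < length (Mons e)" "m = Mons e ! i" by (auto simp: in_set_conv_nth)
    have "coeff_vec e f $ i = coeff_vec e g $ i" using assms(1) by simp
    then show ?thesis using i by (simp add: coeff_vec_def)
  next
    case False
    then show ?thesis using assms(2,3) by (metis in_keys_iff)
  qed
qed

lemma lookup_Theta:
  assumes "\<And>m. m \<in> keys u \<Longrightarrow> mdeg m \<le> e"
  shows "lookup (Theta Fs u) k = (\<Sum>m | mdeg m \<le> e. lookup u m * lookup (basis_form Fs m) k)"
proof -
  have "Theta Fs u = (\<Sum>m | mdeg m \<le> e. single 0 (lookup u m) * basis_form Fs m)"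
    using assms by (intro Theta_superset finite_mdeg) auto
  then show ?thesis by (simp add: lookup_sum lookup_scale)
qed

lemma coeff_vec_Theta:
  assumes "\<And>m. m \<in> keys u \<Longrightarrow> mdeg m \<le> e"
  shows "coeff_vec e (Theta Fs u) = basis_mat e Fs *\<^sub>v coeff_vec e u"
proof (rule eq_vecI)
  fix i assume "i < dim_vec (basis_mat e Fs *\<^sub>v coeff_vec e u)"
  then have i: "i < length (Mons e)" by (simp add: basis_mat_def)
  have "coeff_vec e (Theta Fs u) $ i =
      (\<Sum>m | mdeg m \<le> e. lookup u m * lookup (basis_form Fs m) (Mons e ! i))"
    unfolding coeff_vec_def using i lookup_Theta[OF assms] by simp
  also have "\<dots> = (\<Sum>j<length (Mons e). lookup u (Mons e ! j) * lookup (basis_form Fs (Mons e ! j)) (Mons e ! i))"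
    by (rule sum_Mons[symmetric])
  also have "\<dots> = (basis_mat e Fs *\<^sub>v coeff_vec e u) $ i"
    using i by (simp add: basis_mat_def coeff_vec_def scalar_prod_def atLeast0LessThan mult.commute)
  finally show "coeff_vec e (Theta Fs u) $ i = (basis_mat e Fs *\<^sub>v coeff_vec e u) $ i" .
qed (simp add: basis_mat_def coeff_vec_def)

definition poly_of_vec :: "nat \<Rightarrow> 'k::field vec \<Rightarrow> ('n, 'k) mpol" where
  "poly_of_vec e w = (\<Sum>j<length (Mons e). single (Mons e ! j) (w $ j))"

lemma keys_poly_of_vec: "m \<in> keys (poly_of_vec e w) \<Longrightarrow> mdeg m \<le> e"
proof -
  assume "m \<in> keys (poly_of_vec e w)"
  then obtain j where "j < length (Mons e)" "m = Mons e ! j"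
    unfolding poly_of_vec_def using keys_sum[of "\<lambda>j. single (Mons e ! j) (w $ j)" "{..<length (Mons e)}"]
    by (auto split: if_splits)
  then have "m \<in> set (Mons e)" by simp
  then show "mdeg m \<le> e" by (simp add: Mons(1))
qed

lemma lookup_poly_of_vec: "i < length (Mons e) \<Longrightarrow> lookup (poly_of_vec e w) (Mons e ! i) = w $ i"
proof -
  assume i: "i < length (Mons e)"
  have "lookup (poly_of_vec e w) (Mons e ! i) = (\<Sum>j<length (Mons e). if j = i then w $ i else 0)"
    unfolding poly_of_vec_def lookup_sum
    by (intro sum.cong refl) (use i Mons(2) in \<open>auto simp: lookup_single when_def nth_eq_iff_index_eq\<close>)
  then show ?thesis using i by simp
qed

lemma coeff_vec_poly_of_vec: "w \<in> carrier_vec (length (Mons e)) \<Longrightarrow> coeff_vec e (poly_of_vec e w) = w"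
  by (rule eq_vecI) (auto simp: coeff_vec_def lookup_poly_of_vec)

lemma keys_Theta:
  assumes F: "\<And>i. i < CARD('n) \<Longrightarrow> Fs ! i \<in> forms (int (ds ! i))"
    and u: "\<And>m. m \<in> keys u \<Longrightarrow> mdeg m \<le> e"
    and m: "m \<in> keys (Theta Fs u)"
  shows "mdeg m \<le> e"
proof -
  obtain a where a: "a \<in> keys u" "m \<in> keys (single 0 (lookup u a) * basis_form Fs a)"
    using m keys_sum[of "\<lambda>m. single 0 (lookup u m) * basis_form Fs m" "keys u"]
    unfolding Theta_def by blast
  have "single 0 (lookup u a) * basis_form Fs a \<in> forms (0 + int (mdeg a))"
    by (intro forms_mult forms_const basis_form_forms F)
  then have "mdeg m = mdeg a" using a(2) by (intro forms_keys) simp_all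
  then show ?thesis using u a(1) by simp
qed

lemma invertible_obtain:
  assumes A: "(A :: 'k::field mat) \<in> carrier_mat N N" and d: "det A \<noteq> 0"
  obtains B where "B \<in> carrier_mat N N" "B * A = 1\<^sub>m N" "A * B = 1\<^sub>m N"
  using det_non_zero_imp_unit[OF A d, unfolded Units_def, of "()"] by (auto simp: ring_mat_def)

lemma Theta_surj_low:
  assumes F: "\<And>i. i < CARD('n) \<Longrightarrow> Fs ! i \<in> forms (int (ds ! i))"
    and det: "det (basis_mat e Fs) \<noteq> 0" and f: "\<And>m. m \<in> keys f \<Longrightarrow> mdeg m \<le> e"
  shows "\<exists>u. (\<forall>m\<in>keys u. mdeg m \<le> e) \<and> Theta Fs u = f"
proof -
  obtain B where B: "B \<in> carrier_mat (length (Mons e)) (length (Mons e))" "basis_mat e Fs * B = 1\<^sub>m (length (Mons e))"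
    using invertible_obtain[OF basis_mat_carrier det] by blast
  define u where "u = poly_of_vec e (B *\<^sub>v coeff_vec e f)"
  have "coeff_vec e (Theta Fs u) = basis_mat e Fs *\<^sub>v (B *\<^sub>v coeff_vec e f)"
    unfolding u_def using B(1) by (subst coeff_vec_Theta) (auto simp: keys_poly_of_vec coeff_vec_poly_of_vec)
  also have "\<dots> = (basis_mat e Fs * B) *\<^sub>v coeff_vec e f"
    by (rule assoc_mult_mat_vec[symmetric, OF basis_mat_carrier B(1) coeff_vec_carrier])
  also have "\<dots> = coeff_vec e f" unfolding B(2) by simp
  finally have eq: "coeff_vec e (Theta Fs u) = coeff_vec e f" .
  have "mdeg m \<le> e" if "m \<in> keys (Theta Fs u)" for m
    using that by (rule keys_Theta[OF F, rotated 2]) (simp_all add: u_def keys_poly_of_vec)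
  then have "Theta Fs u = f" using f by (rule coeff_vec_inj[OF eq])
  then show ?thesis using keys_poly_of_vec unfolding u_def by blast
qed

text \<open>Bounded preimages of the monomials form a right inverse of the square matrix, hence a
  left inverse. This gives injectivity in degrees where no determinant is assumed to be
  nonzero.\<close>

lemma Theta_inj_bounded:
  fixes Fs :: "('n, 'k::field) mpol list"
  assumes w: "\<And>m. mdeg m \<le> e \<Longrightarrow> \<exists>w. (\<forall>k\<in>keys w. mdeg k \<le> e) \<and> Theta Fs w = monic m"
    and u: "\<And>m. m \<in> keys u \<Longrightarrow> mdeg m \<le> e" and 0: "Theta Fs u = 0"
  shows "u = 0"
proof -
  let ?N = "length (Mons e)"
  obtain W where W: "\<And>m k. mdeg m \<le> e \<Longrightarrow> k \<in> keys (W m) \<Longrightarrow> mdeg k \<le> e"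
    "\<And>m. mdeg m \<le> e \<Longrightarrow> Theta Fs (W m) = monic m" using w by metis
  define B where "B = mat ?N ?N (\<lambda>(i, j). lookup (W (Mons e ! j)) (Mons e ! i))"
  have B: "B \<in> carrier_mat ?N ?N" by (simp add: B_def)
  have "basis_mat e Fs * B = 1\<^sub>m ?N"
  proof (rule eq_matI)
    fix i j assume "i < dim_row (1\<^sub>m ?N :: 'k mat)" "j < dim_col (1\<^sub>m ?N :: 'k mat)"
    then have ij: "i < ?N" "j < ?N" by auto
    then have mj: "mdeg (Mons e ! j) \<le> e" using nth_mem[of j "Mons e"] by (simp add: Mons(1))
    have "col B j = coeff_vec e (W (Mons e ! j))"
      by (rule eq_vecI) (use ij in \<open>auto simp: B_def coeff_vec_def\<close>)
    then have "(basis_mat e Fs * B) $$ (i, j) = (basis_mat e Fs *\<^sub>v coeff_vec e (W (Mons e ! j))) $ i"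
      using ij B by (simp add: basis_mat_def)
    also have "\<dots> = coeff_vec e (monic (Mons e ! j)) $ i"
      using coeff_vec_Theta[of "W (Mons e ! j)" e Fs] W[OF mj] by simp
    also have "\<dots> = 1\<^sub>m ?N $$ (i, j)"
      using ij Mons(2) by (auto simp: coeff_vec_def monic_def lookup_single when_def nth_eq_iff_index_eq)
    finally show "(basis_mat e Fs * B) $$ (i, j) = 1\<^sub>m ?N $$ (i, j)" .
  qed (use B in \<open>auto simp: basis_mat_def\<close>)
  then have BA: "B * basis_mat e Fs = 1\<^sub>m ?N" by (rule mat_mult_left_right_inverse[OF basis_mat_carrier B])
  have "coeff_vec e u = (B * basis_mat e Fs) *\<^sub>v coeff_vec e u" unfolding BA by simp
  also have "\<dots> = B *\<^sub>v (basis_mat e Fs *\<^sub>v coeff_vec e u)"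
    by (rule assoc_mult_mat_vec[OF B basis_mat_carrier coeff_vec_carrier])
  also have "basis_mat e Fs *\<^sub>v coeff_vec e u = 0\<^sub>v ?N"
  proof -
    have "basis_mat e Fs *\<^sub>v coeff_vec e u = coeff_vec e (Theta Fs u)"
      by (rule coeff_vec_Theta[symmetric]) (rule u)
    then show ?thesis unfolding 0 by (auto simp: coeff_vec_def)
  qed
  also have "B *\<^sub>v 0\<^sub>v ?N = coeff_vec e 0" using B by (auto simp: coeff_vec_def)
  finally show ?thesis by (rule coeff_vec_inj) (use u in auto)
qed

end

text \<open>One determinant will serve all degrees. The bound \<open>c + 3\<close> comes from
  \<open>pairing_mat\<close>, where monomials of degree at most two multiply divisors of the socle
  monomial, of degree at most \<open>c + 1\<close>.\<close>

locale nondegenerate_forms = degrees ds ty c for ds and ty :: "'n::finite itself" and c +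
  fixes Fs :: "('n, 'k::field) mpol list"
  assumes F_forms: "\<And>i. i < CARD('n) \<Longrightarrow> Fs ! i \<in> forms (int (ds ! i))"
    and det_nz: "det (basis_mat (c + 3) Fs) \<noteq> 0"
    and len_ge: "CARD('n) \<le> length Fs"
begin

abbreviation mono_ideal :: "nat \<Rightarrow> ('n, 'k) mpol set" where
  "mono_ideal k \<equiv> ideal_of ((\<lambda>i. monic (var_power i (ds ! i))) ` {..<k})"

abbreviation ci_ideal :: "('n, 'k) mpol set" where
  "ci_ideal \<equiv> ideal_of (set (take CARD('n) Fs))"

lemma hpart_Theta: "hpart e (Theta Fs f) = Theta Fs (hpart e f)"
proof -
  have "hpart e (Theta Fs f) = (\<Sum>m\<in>keys f. hpart e (single 0 (lookup f m) * basis_form Fs m))"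
    unfolding Theta_def hpart_sum ..
  also have "\<dots> = (\<Sum>m\<in>keys f. single 0 (lookup (hpart e f) m) * basis_form Fs m)"
  proof (intro sum.cong refl)
    fix m
    show "hpart e (single 0 (lookup f m) * basis_form Fs m) =
        single 0 (lookup (hpart e f) m) * basis_form Fs m"
      using hpart_mult[OF forms_const, of e "lookup f m" "basis_form Fs m"]
        hpart_forms[OF basis_form_forms[OF F_forms, of m], of e] by (simp add: lookup_hpart)
  qed
  also have "\<dots> = Theta Fs (hpart e f)"
    by (intro Theta_superset[symmetric]) (auto simp: in_keys_iff lookup_hpart split: if_splits)
  finally show ?thesis .
qed

lemma outside_box_mono_ideal:
  assumes "\<And>m. m \<in> keys u \<Longrightarrow> \<exists>i<CARD('n). ds ! i \<le> exponent m i"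
  shows "u \<in> mono_ideal CARD('n)"
  unfolding monomial_ideal_iff[OF order_refl, of u "(!) ds"] using assms by (simp add: exponent_def)

lemma large_degree_outside_box:
  assumes "Suc c < mdeg (m :: 'n monom)"
  shows "\<exists>i<CARD('n). ds ! i \<le> exponent m i"
proof (rule ccontr)
  assume a: "\<not> ?thesis"
  have "mdeg m \<le> (\<Sum>i<CARD('n). ds ! i - 1)"
    unfolding mdeg_exponent
  proof (rule sum_mono)
    fix i assume "i \<in> {..<CARD('n)}"
    then have "exponent m i < ds ! i" using a by (meson lessThan_iff not_less)
    then show "exponent m i \<le> ds ! i - 1" by simp
  qed
  then show False using assms c_eq by simp
qed

lemma socle_degree_box:
  assumes m: "mdeg (m :: 'n monom) = Suc c" and box: "\<And>i. i < CARD('n) \<Longrightarrow> exponent m i < ds ! i"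
  shows "m = top_monom"
proof -
  have le: "exponent m i \<le> ds ! i - 1" if "i < CARD('n)" for i using box[OF that] by simp
  have "(\<Sum>i<CARD('n). ds ! i - 1 - exponent m i) = 0"
    using c_eq m le by (subst sum_subtractf_nat) (auto simp: mdeg_exponent)
  then have ge: "ds ! i - 1 - exponent m i = 0" if "i < CARD('n)" for i using that by simp
  have "exponent m i = ds ! i - 1" if "i < CARD('n)" for i using le[OF that] ge[OF that] by simp
  then show ?thesis by (simp add: monom_eq_iff exponent_top)
qed

text \<open>Beyond degree \<open>c + 3\<close> write a monomial as \<open>x_l\<close> times
  \<open>m'\<close>. The preimage of \<open>m'\<close> has degree above \<open>c + 1\<close>, so
  each of its monomials is divisible by some \<open>x_i ^ d_i\<close>; after multiplying by
  \<open>x_l\<close>, preimages are needed only in degrees \<open>e - d_i\<close>.\<close>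

lemma Theta_surj_forms: "f \<in> forms (int e) \<Longrightarrow> \<exists>u\<in>forms (int e). Theta Fs u = f"
proof (induction e arbitrary: f rule: less_induct)
  case (less e)
  have homog: "\<exists>u\<in>forms (int e). Theta Fs u = f" if "Theta Fs u = f" "f \<in> forms (int e)" for u f
    using hpart_Theta[of "int e" u] that by (intro bexI[of _ "hpart (int e) u"]) (simp_all add: hpart_forms)
  show ?case
  proof (cases "e \<le> c + 3")
    case True
    then have "mdeg m \<le> c + 3" if "m \<in> keys f" for m using forms_keys[OF less.prems that] by simp
    then obtain u where "Theta Fs u = f" using Theta_surj_low[OF F_forms det_nz] by blast
    then show ?thesis using homog less.prems by blast
  next
    case False
    have "\<exists>u. Theta Fs u = monic m" if m: "mdeg m = e" for m :: "'n monom"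
    proof -
      have "(\<Sum>i<CARD('n). exponent m i) \<noteq> 0" using m False by (simp flip: mdeg_exponent)
      then obtain l where l: "l < CARD('n)" "exponent m l \<noteq> 0" by auto
      define m' where "m' = m - var_power l 1"
      have mm: "m = var_power l 1 + m'"
        using l by (auto simp: monom_eq_iff m'_def exponent_var_power)
      have m': "Suc (mdeg m') = e" using m unfolding mm by simp
      obtain u where u: "u \<in> forms (int (mdeg m'))" "Theta Fs u = monic m'"
        using less.IH[of "mdeg m'" "monic m'"] m' monic_in_forms by blast
      have "u \<in> mono_ideal CARD('n)"
        using forms_keys[OF u(1)] m' False by (intro outside_box_mono_ideal large_degree_outside_box) simp
      then obtain r where r: "u = (\<Sum>i<CARD('n). r i * monic (var_power i (ds ! i)))" unfolding ideal_of_image by blast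
      \<comment> \<open>The coefficients are made homogeneous because the induction hypothesis
        speaks of forms of smaller degree.\<close>
      define r' where "r' i = hpart (int (mdeg m') - int (ds ! i)) (r i)" for i
      have "u = hpart (int (mdeg m')) u" using u(1) by (simp add: hpart_forms)
      also have "\<dots> = (\<Sum>i<CARD('n). hpart (int (mdeg m')) (monic (var_power i (ds ! i)) * r i))"
        unfolding r hpart_sum by (simp add: mult.commute)
      also have "\<dots> = (\<Sum>i<CARD('n). monic (var_power i (ds ! i)) * r' i)"
        by (intro sum.cong refl) (simp add: r'_def hpart_mult[OF monic_in_forms[OF refl]])
      finally have u': "u = (\<Sum>i<CARD('n). monic (var_power i (ds ! i)) * r' i)" .
      have "\<exists>w. Theta Fs w = X l * Theta Fs (r' i)" if i: "i < CARD('n)" for i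
      proof (cases "ds ! i \<le> mdeg m'")
        case True
        have "Theta Fs (r' i) \<in> forms (int (mdeg m') - int (ds ! i))"
          unfolding r'_def hpart_Theta[symmetric] by simp
        then have "X l * Theta Fs (r' i) \<in> forms (1 + (int (mdeg m') - int (ds ! i)))"
          by (intro forms_mult X_in_forms)
        moreover have "1 + (int (mdeg m') - int (ds ! i)) = int (e - ds ! i)" using True m' by simp
        moreover have "e - ds ! i < e" using ds_pos[OF i] False by simp
        ultimately show ?thesis using less.IH by metis
      next
        case False
        then have "r' i = 0" unfolding r'_def by (intro forms_neg[OF _ hpart_in_forms]) simp
        then show ?thesis by (intro exI[of _ 0]) simp
      qed
      then obtain w where w: "\<And>i. i < CARD('n) \<Longrightarrow> Theta Fs (w i) = X l * Theta Fs (r' i)" by metis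
      have "monic m = X l * Theta Fs u" unfolding u(2) mm monic_mult using l by (simp add: X_def)
      also have "\<dots> = (\<Sum>i<CARD('n). Fs ! i * (X l * Theta Fs (r' i)))"
        unfolding u' by (simp add: Theta_sum Theta_shift sum_distrib_left mult.left_commute)
      also have "\<dots> = Theta Fs (\<Sum>i<CARD('n). monic (var_power i (ds ! i)) * w i)"
        by (simp add: Theta_sum Theta_shift w)
      finally show ?thesis by metis
    qed
    then obtain W where W: "\<And>m. mdeg m = e \<Longrightarrow> Theta Fs (W m) = monic m" by metis
    have "Theta Fs (\<Sum>m\<in>keys f. single 0 (lookup f m) * W m) =
        (\<Sum>m\<in>keys f. single m (lookup f m))"
      unfolding Theta_sum Theta_scale using forms_keys[OF less.prems] W
      by (intro sum.cong refl) (simp add: monic_def mult_single)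
    then show ?thesis unfolding mpol_expand[symmetric] using homog less.prems by blast
  qed
qed

lemma Theta_surj: "\<exists>u. Theta Fs u = f"
proof -
  have "\<exists>u. Theta Fs u = monic m" for m :: "'n monom"
    using Theta_surj_forms[of "monic m" "mdeg m"] monic_in_forms by blast
  then obtain W where W: "\<And>m. Theta Fs (W m) = monic m" by metis
  have "Theta Fs (\<Sum>m\<in>keys f. single 0 (lookup f m) * W m) =
      (\<Sum>m\<in>keys f. single m (lookup f m))"
    unfolding Theta_sum Theta_scale W by (intro sum.cong refl) (simp add: monic_def mult_single)
  then show ?thesis unfolding mpol_expand[symmetric] by blast
qed

lemma Theta_eq_zero: "Theta Fs u = 0 \<Longrightarrow> u = 0"
proof -
  assume 0: "Theta Fs u = 0"
  define e where "e = Max (insert 0 (mdeg ` keys u))"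
  have u: "mdeg m \<le> e" if "m \<in> keys u" for m
    using that unfolding e_def by (intro Max_ge) auto
  show "u = 0"
  proof (rule Theta_inj_bounded[OF _ u 0])
    fix m :: "'n monom" assume m: "mdeg m \<le> e"
    obtain w where w: "w \<in> forms (int (mdeg m))" "Theta Fs w = monic m"
      using Theta_surj_forms[of "monic m" "mdeg m"] monic_in_forms by blast
    then show "\<exists>w. (\<forall>k\<in>keys w. mdeg k \<le> e) \<and> Theta Fs w = monic m"
      using forms_keys[OF w(1)] m by (intro exI[of _ w]) auto
  qed
qed

lemma Theta_eq_iff [simp]: "Theta Fs u = Theta Fs w \<longleftrightarrow> u = w"
  using Theta_eq_zero[of "u - w"] by (auto simp: Theta_diff)

text \<open>By bijectivity and \<open>Theta_shift\<close>, membership in the ideal of the first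
  \<open>k\<close> forms becomes a condition on exponents. Regularity and the socle are read off
  there.\<close>

lemma ideal_iff:
  "f \<in> ideal_of ((!) Fs ` {..<k}) \<longleftrightarrow> (\<exists>u\<in>mono_ideal k. Theta Fs u = f)" if k: "k \<le> CARD('n)"
proof
  assume "f \<in> ideal_of ((!) Fs ` {..<k})"
  then obtain r where r: "f = (\<Sum>i<k. r i * Fs ! i)" unfolding ideal_of_image by blast
  define w where "w i = (SOME u. Theta Fs u = r i)" for i
  have w: "Theta Fs (w i) = r i" for i unfolding w_def by (rule someI_ex[OF Theta_surj])
  have "Theta Fs (\<Sum>i<k. monic (var_power i (ds ! i)) * w i) = f"
    unfolding r Theta_sum
  proof (intro sum.cong refl)
    fix i assume "i \<in> {..<k}"
    then show "Theta Fs (monic (var_power i (ds ! i)) * w i) = r i * Fs ! i"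
      using Theta_shift[of i Fs "w i"] k w by (simp add: mult.commute[of "r i"])
  qed
  moreover have "(\<Sum>i<k. monic (var_power i (ds ! i)) * w i) \<in> mono_ideal k"
    by (intro ideal_of_sum ideal_of_mult_right ideal_of_base) simp
  ultimately show "\<exists>u\<in>mono_ideal k. Theta Fs u = f" by blast
next
  assume "\<exists>u\<in>mono_ideal k. Theta Fs u = f"
  then obtain u where u: "u \<in> mono_ideal k" "f = Theta Fs u" by blast
  obtain r where "u = (\<Sum>i<k. r i * monic (var_power i (ds ! i)))" using u(1) unfolding ideal_of_image by blast
  then have r: "f = Theta Fs (\<Sum>i<k. r i * monic (var_power i (ds ! i)))" using u(2) by simp
  have "f = (\<Sum>i<k. Theta Fs (r i) * Fs ! i)"
    unfolding r Theta_sum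
  proof (intro sum.cong refl)
    fix i assume "i \<in> {..<k}"
    then show "Theta Fs (r i * monic (var_power i (ds ! i))) = Theta Fs (r i) * Fs ! i"
      using Theta_shift[of i Fs "r i"] k by (simp add: mult.commute)
  qed
  then show "f \<in> ideal_of ((!) Fs ` {..<k})"
    unfolding ideal_of_image by (rule exI[of _ "\<lambda>i. Theta Fs (r i)"])
qed

lemma set_take: "k \<le> CARD('n) \<Longrightarrow> set (take k Fs) = (!) Fs ` {..<k}"
  using nth_image[of k Fs] len_ge by (simp add: atLeast0LessThan)

lemma complete_intersection_take: "complete_intersection (take CARD('n) Fs)"
  unfolding complete_intersection_def
proof (intro conjI allI impI)
  show "1 \<notin> ci_ideal"
  proof
    assume "1 \<in> ci_ideal"
    then obtain u where u: "u \<in> mono_ideal CARD('n)" "Theta Fs u = Theta Fs 1"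
      unfolding set_take[OF order_refl] ideal_iff[OF order_refl] Theta_one by blast
    then have "1 \<in> mono_ideal CARD('n)" by simp
    then obtain i where "i < CARD('n)" "ds ! i \<le> exponent (0 :: 'n monom) i"
      using keys_top_box[of 0 "1 :: ('n, 'k) mpol"] by auto
    then show False using ds_pos[of i] by (simp add: exponent_def)
  qed
  fix i g assume i: "i < length (take CARD('n) Fs)"
    and g: "take CARD('n) Fs ! i * g \<in> ideal_of (set (take i (take CARD('n) Fs)))"
  have i': "i < CARD('n)" using i by simp
  have t: "set (take i (take CARD('n) Fs)) = (!) Fs ` {..<i}" using set_take[of i] i' by (simp add: min_def)
  obtain u where u: "Theta Fs u = g" using Theta_surj by blast
  have "Fs ! i * g \<in> ideal_of ((!) Fs ` {..<i})" using g i' unfolding t by simp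
  then obtain w where w: "w \<in> mono_ideal i" "Theta Fs w = Theta Fs (monic (var_power i (ds ! i)) * u)"
    using ideal_iff[of i] i' u Theta_shift[OF i', of Fs u] by auto
  then have "monic (var_power i (ds ! i)) * u \<in> mono_ideal i" by simp
  then have "u \<in> mono_ideal i" using var_powers_regular[of i "(!) ds" u] i' by simp
  then show "g \<in> ideal_of (set (take i (take CARD('n) Fs)))" unfolding t using ideal_iff[of i] i' u by auto
qed

definition inv_Theta :: "('n, 'k) mpol \<Rightarrow> ('n, 'k) mpol" where
  "inv_Theta f = (THE u. Theta Fs u = f)"

lemma inv_Theta: "Theta Fs (inv_Theta f) = f"
proof -
  have "\<exists>!u. Theta Fs u = f" using Theta_surj Theta_eq_iff by metis
  then show ?thesis unfolding inv_Theta_def by (rule theI')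
qed

lemma inv_Theta_Theta [simp]: "inv_Theta (Theta Fs u) = u"
  using inv_Theta[of "Theta Fs u"] by simp

text \<open>The coefficient at the socle monomial in the adapted basis; the determinant clears the
  denominator of Cramer's rule.\<close>

definition socle_form :: "('n, 'k) mpol \<Rightarrow> 'k" where
  "socle_form f = det (basis_mat (c + 3) Fs) * lookup (inv_Theta f) top_monom"

lemma socle_form_Theta: "socle_form (Theta Fs u) = det (basis_mat (c + 3) Fs) * lookup u top_monom"
  by (simp add: socle_form_def)

lemma socle_form_add: "socle_form (f + g) = socle_form f + socle_form g"
proof -
  obtain u w where "f = Theta Fs u" "g = Theta Fs w" using Theta_surj by metis
  then show ?thesis by (simp add: socle_form_Theta lookup_add algebra_simps flip: Theta_add)
qed

lemma socle_form_scale: "socle_form (single 0 a * f) = a * socle_form f"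
proof -
  obtain u where "f = Theta Fs u" using Theta_surj by metis
  then show ?thesis by (simp add: socle_form_Theta lookup_scale flip: Theta_scale)
qed

lemma socle_form_hpart: "socle_form (hpart (int c + 1) f) = socle_form f"
proof -
  obtain u where "f = Theta Fs u" using Theta_surj by metis
  then show ?thesis by (simp add: hpart_Theta socle_form_Theta lookup_hpart mdeg_top)
qed

lemma socle_form_ideal:
  assumes "f \<in> ci_ideal"
  shows "socle_form f = 0"
proof -
  obtain u where u: "u \<in> mono_ideal CARD('n)" "Theta Fs u = f"
    using assms unfolding set_take[OF order_refl] ideal_iff[OF order_refl] by blast
  have "top_monom \<notin> keys u"
  proof
    assume "top_monom \<in> keys u"
    then obtain i where "i < CARD('n)" "ds ! i \<le> exponent top_monom i" using keys_top_box u(1) by blast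
    then show False using ds_pos[of i] by (simp add: exponent_top)
  qed
  then show ?thesis using u(2) by (auto simp: socle_form_Theta in_keys_iff)
qed

lemma outside_box_in_ideal:
  assumes "\<And>m. m \<in> keys u \<Longrightarrow> \<exists>i<CARD('n). ds ! i \<le> exponent m i"
  shows "Theta Fs u \<in> ci_ideal"
  unfolding set_take[OF order_refl] ideal_iff[OF order_refl] using outside_box_mono_ideal[OF assms] by blast

lemma homogeneous_preimage:
  assumes "f \<in> forms (int e)"
  obtains u where "u \<in> forms (int e)" "f = Theta Fs u"
  using Theta_surj_forms[OF assms] by auto

lemma socle_form_zero_imp_ideal:
  assumes f: "f \<in> forms (int c + 1)" and 0: "socle_form f = 0"
  shows "f \<in> ci_ideal"
proof -
  have "f \<in> forms (int (Suc c))" using f by (simp add: add.commute)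
  then obtain u where u: "u \<in> forms (int (Suc c))" "f = Theta Fs u" by (rule homogeneous_preimage)
  have top: "top_monom \<notin> keys u" using 0 det_nz by (simp add: u(2) socle_form_Theta in_keys_iff)
  show ?thesis unfolding u(2)
  proof (rule outside_box_in_ideal)
    fix m assume m: "m \<in> keys u"
    then have "m \<noteq> top_monom" "mdeg m = Suc c" using top forms_keys[OF u(1)] by auto
    then show "\<exists>i<CARD('n). ds ! i \<le> exponent m i" using socle_degree_box[of m] by (meson not_less)
  qed
qed

end

section \<open>Polynomial formulas for the conditions and a sample point\<close>

context degrees
begin

definition top_index :: nat where
  "top_index = (SOME i. i < length (Mons (c + 3)) \<and> Mons (c + 3) ! i = top_monom)"

text \<open>By Cramer's rule this is \<open>socle_form\<close>, but it is visibly polynomial in the coefficients of \<open>Fs\<close>.\<close>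

definition cramer_form :: "('n, 'k::field) mpol list \<Rightarrow> ('n, 'k) mpol \<Rightarrow> 'k" where
  "cramer_form Fs f = det (replace_col (basis_mat (c + 3) Fs) (coeff_vec (c + 3) f) top_index)"

text \<open>Pairs monomials of degree at most two with their complements in the socle monomial.
  Treating the three degrees together puts the duality into one determinant.\<close>

definition pairing_mat :: "('n, 'k::field) mpol list \<Rightarrow> 'k mat" where
  "pairing_mat Fs = mat (length (Mons 2)) (length (Mons 2))
     (\<lambda>(i, j). cramer_form Fs (monic (Mons 2 ! i + (top_monom - Mons 2 ! j))))"

lemma top_index: "top_index < length (Mons (c + 3))" "Mons (c + 3) ! top_index = top_monom"
proof -
  have "top_monom \<in> set (Mons (c + 3))" by (simp add: Mons(1) mdeg_top)
  then have "\<exists>i. i < length (Mons (c + 3)) \<and> Mons (c + 3) ! i = top_monom" by (auto simp: in_set_conv_nth)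
  then have "top_index < length (Mons (c + 3)) \<and> Mons (c + 3) ! top_index = top_monom"
    unfolding top_index_def by (rule someI_ex)
  then show "top_index < length (Mons (c + 3))" "Mons (c + 3) ! top_index = top_monom" by auto
qed

lemma cramer_form_Theta:
  assumes "\<And>m. m \<in> keys u \<Longrightarrow> mdeg m \<le> c + 3"
  shows "cramer_form Fs (Theta Fs u) = det (basis_mat (c + 3) Fs) * lookup u top_monom"
proof -
  have eq: "coeff_vec (c + 3) (Theta Fs u) = basis_mat (c + 3) Fs *\<^sub>v coeff_vec (c + 3) u"
    by (rule coeff_vec_Theta) (rule assms)
  have "cramer_form Fs (Theta Fs u) = coeff_vec (c + 3) u $ top_index * det (basis_mat (c + 3) Fs)"
    unfolding cramer_form_def eq
    by (rule cramer_lemma_mat[OF basis_mat_carrier coeff_vec_carrier top_index(1)])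
  then show ?thesis by (simp add: coeff_vec_def top_index mult.commute)
qed

lemma plus_top_minus:
  assumes "\<And>i. i < CARD('n) \<Longrightarrow> exponent m i \<le> ds ! i - 1"
  shows "m + (top_monom - m) = top_monom"
  unfolding monom_eq_iff
proof (intro allI impI)
  fix i assume i: "i < CARD('n)"
  then show "exponent (m + (top_monom - m)) i = exponent top_monom i"
    using assms[OF i] by (simp add: exponent_top)
qed

text \<open>Here the degrees must be at least three: exponents up to two have to fit below
  \<open>d_i - 1\<close>.\<close>

lemma small_plus_top_minus:
  assumes "mdeg m \<le> 2"
  shows "m + (top_monom - m) = top_monom"
proof -
  have "exponent m i \<le> ds ! i - 1" if i: "i < CARD('n)" for i
  proof -
    have "exponent m i \<le> mdeg m" unfolding mdeg_exponent using i by (intro member_le_sum) auto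
    then show ?thesis using assms ds_ge[OF i] by simp
  qed
  then show ?thesis by (rule plus_top_minus)
qed

lemma mdeg_top_minus: "mdeg (top_monom - m) \<le> Suc c"
proof -
  have "mdeg (top_monom - m) \<le> mdeg top_monom" unfolding mdeg_exponent by (intro sum_mono) simp
  then show ?thesis by (simp add: mdeg_top)
qed

lemma Mons_nth_mdeg: "i < length (Mons e) \<Longrightarrow> mdeg (Mons e ! i) \<le> e"
  using nth_mem[of i "Mons e"] by (simp add: Mons(1))

lemma Mons_index: "mdeg m \<le> e \<Longrightarrow> \<exists>i<length (Mons e). Mons e ! i = m"
  using Mons(1)[of e] by (metis in_set_conv_nth mem_Collect_eq)

lemma coord_form_basis_form: "coord_form (\<lambda>Fs. basis_form Fs a)"
  unfolding basis_form_def by (intro coord_form_mult coord_form_const coord_form_prod coord_form_power coord_form_nth)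

lemma coord_poly_basis_form: "coord_poly (\<lambda>Fs :: ('n, 'k::field) mpol list. lookup (basis_form Fs a) m)"
  using coord_form_basis_form by (auto simp: coord_form_def)

lemma coord_poly_basis_mat: "coord_poly (\<lambda>Fs :: ('n, 'k::field) mpol list. det (basis_mat e Fs))"
proof (rule coord_poly_det)
  show "basis_mat e Fs \<in> carrier_mat (length (Mons e)) (length (Mons e))" for Fs :: "('n, 'k) mpol list"
    by simp
  show "coord_poly (\<lambda>Fs :: ('n, 'k) mpol list. basis_mat e Fs $$ (i, j))"
    if "i < length (Mons e)" "j < length (Mons e)" for i j
    using that by (simp add: basis_mat_def coord_poly_basis_form)
qed

lemma coord_poly_cramer_form:
  assumes H: "coord_form H"
  shows "coord_poly (\<lambda>Fs :: ('n, 'k::field) mpol list. cramer_form Fs (H Fs))"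
  unfolding cramer_form_def
proof (rule coord_poly_det)
  let ?N = "length (Mons (c + 3))"
  show "replace_col (basis_mat (c + 3) Fs) (coeff_vec (c + 3) (H Fs)) top_index \<in> carrier_mat ?N ?N"
    for Fs :: "('n, 'k) mpol list"
    by (simp add: replace_col_def basis_mat_def)
  fix i j assume "i < ?N" "j < ?N"
  then show "coord_poly (\<lambda>Fs :: ('n, 'k) mpol list. replace_col (basis_mat (c + 3) Fs) (coeff_vec (c + 3) (H Fs)) top_index $$ (i, j))"
    using H coord_poly_basis_form
    by (cases "j = top_index") (simp_all add: replace_col_def basis_mat_def coeff_vec_def coord_form_def)
qed

lemma coord_poly_pairing_mat: "coord_poly (\<lambda>Fs :: ('n, 'k::field) mpol list. det (pairing_mat Fs))"
proof (rule coord_poly_det)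
  show "pairing_mat Fs \<in> carrier_mat (length (Mons 2)) (length (Mons 2))" for Fs :: "('n, 'k) mpol list"
    by (simp add: pairing_mat_def)
  show "coord_poly (\<lambda>Fs :: ('n, 'k) mpol list. pairing_mat Fs $$ (i, j))"
    if "i < length (Mons 2)" "j < length (Mons 2)" for i j
    using that by (simp add: pairing_mat_def coord_poly_cramer_form coord_form_const)
qed

text \<open>The socle monomial divided by a variable pairs to one with that variable and to zero
  with the others, so the vectors \<open>v l\<close> become unit vectors.\<close>

definition sample_forms :: "nat \<Rightarrow> ('n, 'k::field) mpol list" where
  "sample_forms p = map (\<lambda>i. monic (var_power i (ds ! i))) [0..<CARD('n)] @
     map (\<lambda>l. monic (top_monom - var_power l 1)) [0..<p]"

lemma sample_forms_nth:
  "i < CARD('n) \<Longrightarrow> sample_forms p ! i = monic (var_power i (ds ! i))"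
  "l < p \<Longrightarrow> sample_forms p ! (CARD('n) + l) = monic (top_monom - var_power l 1)"
  by (simp_all add: sample_forms_def nth_append)

lemma sample_forms_tuple:
  assumes "p \<le> CARD('n)"
  shows "sample_forms p \<in> form_tuples (ds @ replicate p c)"
  unfolding form_tuples_def
proof (intro CollectI conjI allI impI)
  show "length (sample_forms p) = length (ds @ replicate p c)" by (simp add: sample_forms_def len_ds)
  fix i assume i: "i < length (ds @ replicate p c)"
  show "sample_forms p ! i \<in> forms (int ((ds @ replicate p c) ! i))"
  proof (cases "i < CARD('n)")
    case True
    then show ?thesis by (simp add: sample_forms_nth nth_append len_ds monic_in_forms)
  next
    case False
    then obtain l where l: "i = CARD('n) + l" "l < p"
      using i len_ds by (metis add_less_cancel_left le_Suc_ex length_append length_replicate not_less)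
    have "mdeg (var_power l 1 + (top_monom - var_power l 1)) = Suc c"
      using small_plus_top_minus[of "var_power l 1"] mdeg_top by simp
    then have "mdeg (top_monom - var_power l 1) = c" by simp
    then have "monic (top_monom - var_power l 1) \<in> forms (int c)" by (intro monic_in_forms) simp
    then show ?thesis using l by (simp add: sample_forms_nth nth_append len_ds)
  qed
qed

lemma basis_mat_sample: "basis_mat e (sample_forms p) = 1\<^sub>m (length (Mons e))"
proof (rule eq_matI)
  fix i j assume "i < dim_row (1\<^sub>m (length (Mons e)) :: 'k::field mat)" "j < dim_col (1\<^sub>m (length (Mons e)) :: 'k mat)"
  then show "(basis_mat e (sample_forms p) :: 'k mat) $$ (i, j) = 1\<^sub>m (length (Mons e)) $$ (i, j)"
    using Mons(2)[of e] basis_form_special[of "sample_forms p :: ('n, 'k) mpol list"]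
    by (auto simp: basis_mat_def sample_forms_nth monic_def lookup_single when_def nth_eq_iff_index_eq)
qed (simp_all add: basis_mat_def)

lemma cramer_form_sample: "cramer_form (sample_forms p) f = lookup f top_monom"
proof -
  have "coeff_vec (c + 3) f = 1\<^sub>m (length (Mons (c + 3))) *\<^sub>v coeff_vec (c + 3) f" by simp
  then have "cramer_form (sample_forms p) f = det (replace_col (1\<^sub>m (length (Mons (c + 3))))
      (1\<^sub>m (length (Mons (c + 3))) *\<^sub>v coeff_vec (c + 3) f) top_index)"
    by (simp add: cramer_form_def basis_mat_sample)
  also have "\<dots> = coeff_vec (c + 3) f $ top_index * det (1\<^sub>m (length (Mons (c + 3))))"
    by (rule cramer_lemma_mat[OF one_carrier_mat coeff_vec_carrier top_index(1)])
  finally show ?thesis by (simp add: coeff_vec_def top_index)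
qed

lemma pairing_mat_sample: "pairing_mat (sample_forms p) = 1\<^sub>m (length (Mons 2))"
proof (rule eq_matI)
  fix i j assume "i < dim_row (1\<^sub>m (length (Mons 2)) :: 'k::field mat)" "j < dim_col (1\<^sub>m (length (Mons 2)) :: 'k mat)"
  then have ij: "i < length (Mons 2)" "j < length (Mons 2)" by auto
  have "Mons 2 ! i + (top_monom - Mons 2 ! j) = top_monom \<longleftrightarrow>
      Mons 2 ! i + (top_monom - Mons 2 ! j) = Mons 2 ! j + (top_monom - Mons 2 ! j)"
    using small_plus_top_minus[OF Mons_nth_mdeg[OF ij(2)]] by simp
  also have "\<dots> \<longleftrightarrow> i = j" using ij Mons(2) by (simp add: nth_eq_iff_index_eq)
  finally show "(pairing_mat (sample_forms p) :: 'k mat) $$ (i, j) = 1\<^sub>m (length (Mons 2)) $$ (i, j)"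
    using ij by (simp add: pairing_mat_def cramer_form_sample monic_def lookup_single when_def)
qed (simp_all add: pairing_mat_def)

lemma sample_wedges:
  assumes p: "p \<le> CARD('n)"
  shows "wedges (map (\<lambda>l i. cramer_form (sample_forms p) (X i * sample_forms p ! (CARD('n) + l))) [0..<p])
    (set_basis {p..<CARD('n)}) {..<CARD('n)} = (1 :: 'k::field)"
proof -
  have "cramer_form (sample_forms p) (X i * sample_forms p ! (CARD('n) + l)) = (unit_at l i :: 'k)" if l: "l < p" for l i
  proof (cases "i < CARD('n)")
    case True
    have "var_power i 1 + (top_monom - var_power l 1) = top_monom \<longleftrightarrow>
        var_power i 1 + (top_monom - var_power l 1) = var_power l 1 + (top_monom - var_power l 1)"
      using small_plus_top_minus[of "var_power l 1"] by simp
    also have "\<dots> \<longleftrightarrow> var_power i 1 = (var_power l 1 :: 'n monom)" by simp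
    also have "\<dots> \<longleftrightarrow> i = l" using True l p exponent_var_power[of i i 1, where 'n='n] exponent_var_power[of l i 1, where 'n='n]
      by (metis order.strict_trans2 zero_neq_one)
    finally have key: "var_power i 1 + (top_monom - var_power l 1) = top_monom \<longleftrightarrow> i = l" .
    have "X i * sample_forms p ! (CARD('n) + l) = (monic (var_power i 1 + (top_monom - var_power l 1)) :: ('n, 'k) mpol)"
      using True l by (simp add: sample_forms_nth X_def monic_mult)
    then show ?thesis
      by (simp only: cramer_form_sample monic_def lookup_single when_def unit_at_def key)
  next
    case False
    then show ?thesis using l p by (simp add: cramer_form_sample X_def unit_at_def)
  qed
  then have m1: "map (\<lambda>l i. cramer_form (sample_forms p) (X i * sample_forms p ! (CARD('n) + l))) [0..<p] = (map unit_at [0..<p] :: (nat \<Rightarrow> 'k) list)"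
    by (intro map_cong refl ext) simp
  have m2: "wedges (map unit_at [0..<p]) (set_basis {p..<CARD('n)}) = (set_basis {0..<CARD('n)} :: nat set \<Rightarrow> 'k)"
    using wedges_unit_at[of 0 p "CARD('n)"] p by simp
  show ?thesis unfolding m1 m2 by (simp add: set_basis_def atLeast0LessThan)
qed

end

section \<open>Duality for forms satisfying the conditions\<close>

locale generic_forms = nondegenerate_forms ds ty c Fs
  for ds and ty :: "'n::finite itself" and c and Fs :: "('n, 'k::field) mpol list" +
  fixes p :: nat
  assumes Fs: "Fs \<in> form_tuples (ds @ replicate p c)" and p: "1 \<le> p" "p + 2 \<le> CARD('n)"
    and pairing_nz: "det (pairing_mat Fs) \<noteq> 0"
    and wedges_nz: "wedges (map (\<lambda>l i. cramer_form Fs (X i * Fs ! (CARD('n) + l))) [0..<p]) (set_basis {p..<CARD('n)}) {..<CARD('n)} \<noteq> 0"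
begin

lemma socle_form_eq_cramer:
  assumes "\<And>m. m \<in> keys f \<Longrightarrow> mdeg m \<le> c + 3"
  shows "socle_form f = cramer_form Fs f"
proof -
  obtain u where "\<forall>m\<in>keys u. mdeg m \<le> c + 3" "Theta Fs u = f"
    using Theta_surj_low[OF F_forms det_nz assms] by blast
  then show ?thesis using cramer_form_Theta[of u Fs] socle_form_Theta[of u] by auto
qed

lemma socle_form_sum: "socle_form (\<Sum>i\<in>A. f i) = (\<Sum>i\<in>A. socle_form (f i))"
proof -
  have "socle_form 0 = 0" using socle_form_scale[of 0 0] by simp
  then show ?thesis by (induction A rule: infinite_finite_induct) (simp_all add: socle_form_add)
qed

text \<open>Its monomials lie in the box, so \<open>Theta\<close> fixes it; pairing it with small
  monomials is multiplication by \<open>pairing_mat\<close>.\<close>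

definition box_comb :: "'k vec \<Rightarrow> ('n, 'k) mpol" where
  "box_comb \<kappa> = (\<Sum>j<length (Mons 2). single (top_monom - Mons 2 ! j) (\<kappa> $ j))"

lemma socle_form_box_comb:
  assumes \<kappa>: "\<kappa> \<in> carrier_vec (length (Mons 2))" and i: "i < length (Mons 2)"
  shows "socle_form (monic (Mons 2 ! i) * box_comb \<kappa>) = (pairing_mat Fs *\<^sub>v \<kappa>) $ i"
proof -
  have entry: "socle_form (monic (Mons 2 ! i) * single (top_monom - Mons 2 ! j) (\<kappa> $ j)) =
      pairing_mat Fs $$ (i, j) * \<kappa> $ j" if j: "j < length (Mons 2)" for j
  proof -
    have "mdeg (Mons 2 ! i + (top_monom - Mons 2 ! j)) \<le> c + 3"
      using Mons_nth_mdeg[OF i] mdeg_top_minus[of "Mons 2 ! j"] by simp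
    then have "socle_form (monic (Mons 2 ! i + (top_monom - Mons 2 ! j))) = pairing_mat Fs $$ (i, j)"
      using i j by (subst socle_form_eq_cramer) (auto simp: monic_def pairing_mat_def)
    moreover have "monic (Mons 2 ! i) * single (top_monom - Mons 2 ! j) (\<kappa> $ j) =
        single 0 (\<kappa> $ j) * monic (Mons 2 ! i + (top_monom - Mons 2 ! j))"
      by (simp add: monic_def mult_single)
    ultimately show ?thesis by (simp add: socle_form_scale mult.commute)
  qed
  have "socle_form (monic (Mons 2 ! i) * box_comb \<kappa>) = (\<Sum>j<length (Mons 2). pairing_mat Fs $$ (i, j) * \<kappa> $ j)"
    unfolding box_comb_def sum_distrib_left socle_form_sum by (intro sum.cong refl entry) simp
  then show ?thesis using \<kappa> i by (simp add: pairing_mat_def scalar_prod_def atLeast0LessThan)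
qed

lemma pairing_carrier: "pairing_mat Fs \<in> carrier_mat (length (Mons 2)) (length (Mons 2))"
  by (simp add: pairing_mat_def)

text \<open>The pairing is inverted for all three degrees at once, and the component of the right
  degree is kept; \<open>socle_form\<close> sees degree \<open>c + 1\<close> only.\<close>

lemma pairing_surj:
  assumes "r \<le> 2"
  shows "\<exists>g\<in>forms (int c + 1 - int r). \<forall>m. mdeg m = r \<longrightarrow> socle_form (monic m * g) = \<tau> m"
proof -
  let ?N = "length (Mons 2)"
  obtain B where B: "B \<in> carrier_mat ?N ?N" "pairing_mat Fs * B = 1\<^sub>m ?N"
    using invertible_obtain[OF pairing_carrier pairing_nz] by blast
  define t where "t = vec ?N (\<lambda>i. \<tau> (Mons 2 ! i))"
  have t: "t \<in> carrier_vec ?N" by (simp add: t_def)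
  have Bt: "B *\<^sub>v t \<in> carrier_vec ?N" using B(1) t by simp
  have PBt: "pairing_mat Fs *\<^sub>v (B *\<^sub>v t) = t"
    using assoc_mult_mat_vec[OF pairing_carrier B(1) t] B(2) t by simp
  define g where "g = hpart (int c + 1 - int r) (box_comb (B *\<^sub>v t))"
  have "socle_form (monic m * g) = \<tau> m" if m: "mdeg m = r" for m
  proof -
    obtain i where i: "i < ?N" "Mons 2 ! i = m" using Mons_index[of m 2] m assms by auto
    have "monic m * g = hpart (int c + 1) (monic m * box_comb (B *\<^sub>v t))"
    proof -
      have "(monic m :: ('n, 'k) mpol) \<in> forms (int r)" using m by (intro monic_in_forms) simp
      then show ?thesis unfolding g_def by (simp add: hpart_mult)
    qed
    then have "socle_form (monic m * g) = socle_form (monic m * box_comb (B *\<^sub>v t))" by (simp add: socle_form_hpart)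
    also have "\<dots> = \<tau> m" using socle_form_box_comb[OF Bt i(1)] i unfolding PBt by (simp add: t_def)
    finally show ?thesis .
  qed
  then show ?thesis by (intro bexI[of _ g]) (simp_all add: g_def)
qed

lemma mdeg_one_var: "mdeg (m :: 'n monom) = 1 \<Longrightarrow> \<exists>a<CARD('n). m = var_power a 1"
proof -
  assume m: "mdeg m = 1"
  then have "(\<Sum>i<CARD('n). exponent m i) \<noteq> 0" by (simp flip: mdeg_exponent)
  then obtain l where l: "l < CARD('n)" "exponent m l \<noteq> 0" by auto
  have mm: "m = var_power l 1 + (m - var_power l 1)"
    using l by (auto simp: monom_eq_iff exponent_var_power)
  have "mdeg m = 1 + mdeg (m - var_power l 1)" by (subst mm, simp only: mdeg_add mdeg_var_power)
  then have "m - var_power l 1 = 0" using m by (simp add: mdeg_eq_zero)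
  then show ?thesis using mm l by auto
qed

text \<open>Modulo the ideal only box monomials of degree \<open>c\<close> remain, each the socle
  monomial divided by a variable. Their coefficient vector is annihilated by the invertible pairing
  matrix.\<close>

lemma pairing_nondegenerate:
  assumes h: "h \<in> forms (int c)" and 0: "\<And>i. i < CARD('n) \<Longrightarrow> socle_form (X i * h) = 0"
  shows "h \<in> ci_ideal"
proof -
  let ?N = "length (Mons 2)"
  obtain u where u: "u \<in> forms (int c)" "h = Theta Fs u" by (rule homogeneous_preimage[OF h])
  \<comment> \<open>Entries at monomials of degree other than one vanish, since \<open>u\<close> has
    degree \<open>c\<close>.\<close>
  define \<kappa> where "\<kappa> = vec ?N (\<lambda>j. lookup u (top_monom - Mons 2 ! j))"
  have \<kappa>: "\<kappa> \<in> carrier_vec ?N" by (simp add: \<kappa>_def)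
  have inj: "i = j" if "i < ?N" "j < ?N" "top_monom - Mons 2 ! i = top_monom - Mons 2 ! j" for i j
  proof -
    have "Mons 2 ! i + (top_monom - Mons 2 ! i) = Mons 2 ! j + (top_monom - Mons 2 ! i)"
      using small_plus_top_minus[OF Mons_nth_mdeg[OF that(1)]] small_plus_top_minus[OF Mons_nth_mdeg[OF that(2)]] that(3)
      by metis
    then show ?thesis using Mons(2) that by (simp add: nth_eq_iff_index_eq)
  qed
  have rest: "Theta Fs (u - box_comb \<kappa>) \<in> ci_ideal"
  proof (rule outside_box_in_ideal, rule ccontr)
    fix m assume m: "m \<in> keys (u - box_comb \<kappa>)" and "\<not> (\<exists>i<CARD('n). ds ! i \<le> exponent m i)"
    then have box: "exponent m i < ds ! i" if "i < CARD('n)" for i using that by (meson not_less)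
    have comb: "lookup (box_comb \<kappa>) m =
        (\<Sum>j<?N. if top_monom - Mons 2 ! j = m then lookup u m else 0)"
      unfolding box_comb_def lookup_sum by (intro sum.cong refl) (auto simp: \<kappa>_def lookup_single when_def)
    have "lookup (box_comb \<kappa>) m = lookup u m"
    proof (cases "lookup u m = 0")
      case False
      then have "mdeg m = c" using u(1) by (intro forms_keys) (simp_all add: in_keys_iff)
      moreover have le: "exponent m i \<le> ds ! i - 1" if "i < CARD('n)" for i using box[OF that] by simp
      then have eq: "m + (top_monom - m) = top_monom" by (rule plus_top_minus)
      ultimately have "mdeg (top_monom - m) = 1" using mdeg_top mdeg_add[of m "top_monom - m"] by simp
      then obtain j where j: "j < ?N" "Mons 2 ! j = top_monom - m" using Mons_index[of "top_monom - m" 2] by auto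
      have m_eq: "top_monom - Mons 2 ! j = m"
        unfolding j(2) using eq by (metis add_diff_cancel_right')
      have "(\<Sum>i<?N. if top_monom - Mons 2 ! i = m then lookup u m else 0) =
          (\<Sum>i<?N. if i = j then lookup u m else 0)"
        using inj j(1) m_eq by (intro sum.cong refl) auto
      then show ?thesis unfolding comb using j(1) by simp
    qed (simp add: comb)
    then show False using m by (simp add: in_keys_iff lookup_minus)
  qed
  have keys_box: "exponent m i < ds ! i" if m: "m \<in> keys (box_comb \<kappa>)" and i: "i < CARD('n)" for m i
  proof -
    obtain j where "m = top_monom - Mons 2 ! j"
      using m keys_sum[of "\<lambda>j. single (top_monom - Mons 2 ! j) (\<kappa> $ j)" "{..<?N}"]
      unfolding box_comb_def by (auto split: if_splits)
    then show ?thesis using ds_pos[OF i] i by (simp add: exponent_top)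
  qed
  have "Theta Fs (box_comb \<kappa>) = (\<Sum>m\<in>keys (box_comb \<kappa>). single m (lookup (box_comb \<kappa>) m))"
    unfolding Theta_def
    by (intro sum.cong refl) (simp add: basis_form_box[OF keys_box] monic_def mult_single)
  then have "Theta Fs (box_comb \<kappa>) = box_comb \<kappa>" unfolding mpol_expand[symmetric] .
  then have h_eq: "h = Theta Fs (u - box_comb \<kappa>) + box_comb \<kappa>" by (simp add: u(2) Theta_diff)
  have "pairing_mat Fs *\<^sub>v \<kappa> = 0\<^sub>v ?N"
  proof (rule eq_vecI)
    fix i assume "i < dim_vec (0\<^sub>v ?N :: 'k vec)"
    then have i: "i < ?N" by simp
    have "monic (Mons 2 ! i) * Theta Fs (u - box_comb \<kappa>) \<in> ci_ideal"
      by (rule ideal_of_mult_left[OF rest])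
    then have "socle_form (monic (Mons 2 ! i) * h) = socle_form (monic (Mons 2 ! i) * box_comb \<kappa>)"
      by (subst h_eq) (simp add: distrib_left socle_form_add socle_form_ideal)
    moreover have "socle_form (monic (Mons 2 ! i) * h) = 0"
    proof (cases "mdeg (Mons 2 ! i) = 1")
      case True
      then obtain a where "a < CARD('n)" "Mons 2 ! i = var_power a 1" using mdeg_one_var by blast
      then show ?thesis using 0[of a] by (simp add: X_def)
    next
      case False
      have "monic (Mons 2 ! i) * h \<in> forms (int (mdeg (Mons 2 ! i)) + int c)"
        by (intro forms_mult monic_in_forms refl h)
      then have "hpart (int c + 1) (monic (Mons 2 ! i) * h) = 0" using False by (simp add: hpart_forms)
      then have "socle_form (monic (Mons 2 ! i) * h) = socle_form 0" using socle_form_hpart by metis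
      then show ?thesis using socle_form_scale[of 0 0] by simp
    qed
    ultimately show "(pairing_mat Fs *\<^sub>v \<kappa>) $ i = 0\<^sub>v ?N $ i" using socle_form_box_comb[OF \<kappa> i] i by simp
  qed (simp add: pairing_mat_def)
  moreover obtain B where B: "B \<in> carrier_mat ?N ?N" "B * pairing_mat Fs = 1\<^sub>m ?N"
    using invertible_obtain[OF pairing_carrier pairing_nz] by blast
  moreover have "B *\<^sub>v 0\<^sub>v ?N = 0\<^sub>v ?N" using B(1) by auto
  ultimately have "\<kappa> = 0\<^sub>v ?N"
    using assoc_mult_mat_vec[OF B(1) pairing_carrier \<kappa>] \<kappa> by simp
  then have "box_comb \<kappa> = 0" by (simp add: box_comb_def)
  then show ?thesis using rest h_eq by simp
qed

lemma general_ideal: "general_ideal Fs ds c p socle_form"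
proof
  show "length ds = CARD('n)" by (rule len_ds)
  show "\<And>i. i < CARD('n) \<Longrightarrow> 3 \<le> ds ! i" by (rule ds_ge)
  have "(\<Sum>i<CARD('n). 2) \<le> (\<Sum>i<CARD('n). ds ! i - 1)"
  proof (rule sum_mono)
    fix i assume "i \<in> {..<CARD('n)}"
    then show "2 \<le> ds ! i - 1" using ds_ge[of i] by simp
  qed
  then show "3 \<le> c" using c_eq p by simp
  show "1 \<le> p" "p + 2 \<le> CARD('n)" "Fs \<in> form_tuples (ds @ replicate p c)" by (fact p Fs)+
  show "\<And>f g. socle_form (f + g) = socle_form f + socle_form g" by (rule socle_form_add)
  show "\<And>a f. socle_form (single 0 a * f) = a * socle_form f" by (rule socle_form_scale)
  show "\<And>f. f \<in> ci_ideal \<Longrightarrow> f \<in> forms (int c + 1) \<Longrightarrow> socle_form f = 0"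
    by (rule socle_form_ideal)
  show "\<And>f. f \<in> forms (int c + 1) \<Longrightarrow> socle_form f = 0 \<Longrightarrow> f \<in> ci_ideal"
    by (rule socle_form_zero_imp_ideal)
  show "\<And>h. h \<in> forms (int c) \<Longrightarrow> (\<And>i. i < CARD('n) \<Longrightarrow> socle_form (X i * h) = 0) \<Longrightarrow> h \<in> ci_ideal"
    by (rule pairing_nondegenerate)
  \<comment> \<open>Extending \<open>w\<close> multiplicatively to monomials serves both
    surjectivity statements: \<open>x_a\<close> gets \<open>w a\<close>, and \<open>x_a x_b\<close>
    gets \<open>w a * w b\<close>, also for \<open>a = b\<close>.\<close>
  define \<tau> :: "(nat \<Rightarrow> 'k) \<Rightarrow> 'n monom \<Rightarrow> 'k" where "\<tau> w m = (\<Prod>i<CARD('n). w i ^ exponent m i)" for w m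
  have \<tau>_add: "\<tau> w (m + m') = \<tau> w m * \<tau> w m'" for w m m' by (simp add: \<tau>_def power_add prod.distrib)
  have \<tau>_var: "\<tau> w (var_power a 1) = w a" if "a < CARD('n)" for w a
  proof -
    have "\<tau> w (var_power a 1) = (\<Prod>i<CARD('n). if i = a then w a else 1)"
      unfolding \<tau>_def by (intro prod.cong refl) (use that in \<open>auto simp: exponent_var_power\<close>)
    then show ?thesis using that by simp
  qed
  show "\<exists>h\<in>forms (int c). \<forall>i<CARD('n). socle_form (X i * h) = w i" for w
  proof -
    obtain h where h: "h \<in> forms (int c + 1 - int 1)" "\<And>m. mdeg m = 1 \<Longrightarrow> socle_form (monic m * h) = \<tau> w m"
      using pairing_surj[of 1 "\<tau> w"] by auto
    have "socle_form (X i * h) = w i" if "i < CARD('n)" for i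
      using h(2)[of "var_power i 1"] \<tau>_var[OF that] that by (simp add: X_def)
    then show ?thesis using h(1) by (intro bexI[of _ h]) simp_all
  qed
  show "\<exists>g\<in>forms (int c - 1). \<forall>a<CARD('n). \<forall>b<CARD('n). socle_form (X a * (X b * g)) = w a * w b" for w
  proof -
    obtain g where g: "g \<in> forms (int c + 1 - int 2)" "\<And>m. mdeg m = 2 \<Longrightarrow> socle_form (monic m * g) = \<tau> w m"
      using pairing_surj[of 2 "\<tau> w"] by auto
    have "socle_form (X a * (X b * g)) = w a * w b" if "a < CARD('n)" "b < CARD('n)" for a b
      using g(2)[of "var_power a 1 + var_power b 1"] \<tau>_var that
      by (simp add: X_def \<tau>_add monic_mult mult.assoc)
    then show ?thesis using g(1) by (intro bexI[of _ g]) simp_all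
  qed
  have "socle_form (X i * Fs ! (CARD('n) + l)) = cramer_form Fs (X i * Fs ! (CARD('n) + l))" if l: "l < p" for l i
  proof (rule socle_form_eq_cramer)
    have "Fs ! (CARD('n) + l) \<in> forms (int ((ds @ replicate p c) ! (CARD('n) + l)))"
      using Fs l len_ds by (simp add: form_tuples_def)
    then have "Fs ! (CARD('n) + l) \<in> forms (int c)" using l len_ds by (simp add: nth_append)
    then have "X i * Fs ! (CARD('n) + l) \<in> forms (1 + int c)" by (intro forms_mult X_in_forms)
    then have f: "X i * Fs ! (CARD('n) + l) \<in> forms (int (1 + c))" by simp
    show "mdeg m \<le> c + 3" if "m \<in> keys (X i * Fs ! (CARD('n) + l))" for m
      using forms_keys[OF f that] by simp
  qed
  then have m1: "map (\<lambda>l i. socle_form (X i * Fs ! (CARD('n) + l))) [0..<p] = map (\<lambda>l i. cramer_form Fs (X i * Fs ! (CARD('n) + l))) [0..<p]"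
    by (intro map_cong refl ext) simp
  show "wedges (map (\<lambda>l i. socle_form (X i * Fs ! (CARD('n) + l))) [0..<p]) (set_basis {p..<CARD('n)}) {..<CARD('n)} \<noteq> 0"
    unfolding m1 by (rule wedges_nz)
qed

end

section \<open>The open set of general forms\<close>

theorem theorem3p3:
  fixes ds :: "nat list" and c p :: nat
  assumes "infinite (UNIV :: 'k::field set)"
    and "length ds = CARD('n::finite)"
    and "sorted ds" and "\<forall>e\<in>set ds. 2 < e"
    and "c = sum_list ds - CARD('n) - 1"
    and "1 \<le> p" and "p \<le> CARD('n) - 2"
  shows "for_general_forms (ds @ replicate p c) (\<lambda>Fs :: ('n, 'k) mpol list.
           complete_intersection (take CARD('n) Fs) \<and>
           (\<forall>sh D. minimal_free_resolution (ideal_of (set Fs)) sh D \<longrightarrow>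
              (\<forall>j\<in>{p + 1..CARD('n) - 1}.
                 non_koszul_ghost_term (ds @ replicate p c) Fs sh D j (int (c + j)))))"
proof -
  \<comment> \<open>Subtraction is truncated, and \<open>1 \<le> p\<close> forces at least three
    variables.\<close>
  have p2: "p + 2 \<le> CARD('n)" using assms(6,7) by simp
  have ds_ge: "3 \<le> ds ! i" if "i < CARD('n)" for i
    using assms(2,4) that by (metis nth_mem Suc_leI numeral_2_eq_2 numeral_3_eq_3)
  have "(\<Sum>i<CARD('n). ds ! i - 1) + CARD('n) = (\<Sum>i<CARD('n). (ds ! i - 1) + 1)"
    by (simp only: sum.distrib) simp
  also have "\<dots> = (\<Sum>i<CARD('n). ds ! i)"
  proof (rule sum.cong)
    fix i assume "i \<in> {..<CARD('n)}"
    then show "(ds ! i - 1) + 1 = ds ! i" using ds_ge[of i] by simp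
  qed simp
  also have "\<dots> = sum_list ds" using assms(2) by (simp add: sum_list_sum_nth atLeast0LessThan)
  finally have sum: "(\<Sum>i<CARD('n). ds ! i - 1) + CARD('n) = sum_list ds" .
  \<comment> \<open>The sum of the \<open>d_i - 1\<close> is at least \<open>2 * n\<close>, so the
    subtraction defining \<open>c\<close> loses nothing.\<close>
  have "(\<Sum>i<CARD('n). 2) \<le> (\<Sum>i<CARD('n). ds ! i - 1)"
  proof (rule sum_mono)
    fix i assume "i \<in> {..<CARD('n)}"
    then show "2 \<le> ds ! i - 1" using ds_ge[of i] by simp
  qed
  then have c: "(\<Sum>i<CARD('n). ds ! i - 1) = Suc c" using sum assms(5) p2 by simp
  interpret degrees ds "TYPE('n)" c
    by standard (use assms(2) ds_ge c in auto)
  \<comment> \<open>The product is nonzero exactly when all three conditions hold, so a single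
    polynomial cuts out the complement of the open set.\<close>
  define G where "G Fs = det (basis_mat (c + 3) Fs) * det (pairing_mat Fs) *
      wedges (map (\<lambda>l i. cramer_form Fs (X i * Fs ! (CARD('n) + l))) [0..<p]) (set_basis {p..<CARD('n)}) {..<CARD('n)}"
    for Fs :: "('n, 'k) mpol list"
  have "coord_poly G"
    unfolding G_def
    by (intro coord_poly_mult coord_poly_basis_mat coord_poly_pairing_mat coord_poly_wedges coord_poly_cramer_form
        coord_form_mult coord_form_const coord_form_nth)
  then obtain q where q: "\<And>Fs. poly_value (coords Fs) q = G Fs" unfolding coord_poly_def by blast
  define U where "U = form_tuples (ds @ replicate p c) - {Fs :: ('n, 'k) mpol list. G Fs = 0}"
  have "zariski_open (ds @ replicate p c) U"
    unfolding zariski_open_def U_def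
    by (rule exI[of _ "{q}"]) (simp add: q flip: coords_def)
  \<comment> \<open>At the sample both matrices are identities and the exterior product is one, so
    the open set is nonempty.\<close>
  moreover have "sample_forms p \<in> U"
  proof -
    have p': "p \<le> CARD('n)" using p2 by simp
    have "G (sample_forms p) = 1"
      unfolding G_def basis_mat_sample pairing_mat_sample sample_wedges[OF p'] by simp
    then show ?thesis using sample_forms_tuple[OF p'] by (simp add: U_def)
  qed
  moreover have "complete_intersection (take CARD('n) Fs) \<and>
           (\<forall>sh D. minimal_free_resolution (ideal_of (set Fs)) sh D \<longrightarrow>
              (\<forall>j\<in>{p + 1..CARD('n) - 1}.
                 non_koszul_ghost_term (ds @ replicate p c) Fs sh D j (int (c + j))))" if Fs: "Fs \<in> U" for Fs
  proof -
    have tup: "Fs \<in> form_tuples (ds @ replicate p c)" and G: "G Fs \<noteq> 0" using Fs by (auto simp: U_def)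
    have len: "length Fs = CARD('n) + p" using tup assms(2) by (simp add: form_tuples_def)
    have F: "Fs ! i \<in> forms (int (ds ! i))" if "i < CARD('n)" for i
    proof -
      have "Fs ! i \<in> forms (int ((ds @ replicate p c) ! i))" using tup that assms(2) by (simp add: form_tuples_def)
      then show ?thesis using that assms(2) by (simp add: nth_append)
    qed
    interpret generic_forms ds "TYPE('n)" c Fs p
      by standard (use F G len tup assms(6) p2 in \<open>auto simp: G_def\<close>)
    interpret general_ideal Fs ds c p socle_form by (rule general_ideal)
    show ?thesis
    proof (intro conjI allI impI ballI)
      show "complete_intersection (take CARD('n) Fs)" by (rule complete_intersection_take)
      fix sh D j
      assume res: "minimal_free_resolution (ideal_of (set Fs)) sh D" and j: "j \<in> {p + 1..CARD('n) - 1}"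
      interpret general_resolution Fs ds c p socle_form sh D by standard (rule res)
      show "non_koszul_ghost_term (ds @ replicate p c) Fs sh D j (int (c + j))"
        using j by (intro non_koszul_ghost) auto
    qed
  qed
  ultimately show ?thesis unfolding for_general_forms_def by blast
qed

end
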